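(* Let $\mathcal{E}=\mathbf{Set}(T)$ be the classifying topos of a positive existential theory $T$ having disjoint coproducts and eliminating imaginaries, and let $\mathcal{K}$ be a class of objects of $\mathcal{E}$ closed under binary products. Then the languages recognized by non-deterministic automata whose object of states belongs to $\mathcal{K}$ coincide with the languages recognized by promonoids whose underlying object belongs to $\mathcal{K}$.
   Context: $\Omega$ is the subobject classifier of $\mathcal{E}$; $\Sigma^*$ is the free monoid on $\Sigma$; a language is a subobject of $\Sigma^*$. $\mathbf{Rel}(T)$ is the category of binary relations in $\mathcal{E}$, monoidal under the cartesian product $\times$ and $1$. A promonoid is a monoid object in $\mathbf{Rel}(T)$: an object $M$ with a multiplication relation $\mu\colon M\times M\nrightarrow M$ and a unit monomorphism $\eta\colon M_0\rightarrowtail M$ satisfying the monoid laws in $\mathbf{Rel}(T)$; homomorphisms of promonoids are relations compatible with multiplications and units. $\Sigma^*$ is also the free promonoid on $\Sigma$. A language $L$ over $\Sigma$ is recognized by a promonoid $\mathcal{M}$ if there are a promonoid homomorphism $\overline{h}\colon\Sigma^*\nrightarrow\mathcal{M}$ and a subobject $F$ of $M$ such that $L$ is the relational composite of $\overline{h}$ with (the characteristic relation of) $F$. A non-deterministic automaton consists of a state object $S$, monomorphisms $s_0\colon I\rightarrowtail S$ (initial) and $s_f\colon F\rightarrowtail S$ (final) and a transition relation $\sigma\colon\Sigma\times S\nrightarrow S$; $\sigma$ induces a monoid homomorphism from $\Sigma^*$ into binary relations on $S$ under composition, hence $\overline{\sigma}\colon\Sigma^*\times S\nrightarrow S$, and the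 language $L(A)$ is the composite $\Sigma^*\nrightarrow\Sigma^*\times S\nrightarrow S\nrightarrow1$ via $s_0$, $\overline{\sigma}$, $s_f$ (words leading from an initial to a final state). *)

theory Defs
  imports Main "HOL-Library.FuncSet"
begin

section \<open>Positive existential theories\<close>

text \<open>
  Many-sorted languages; the elements of the types \<open>'s\<close>, \<open>'f\<close>, \<open>'p\<close> are the sorts, function
  symbols and relation symbols.  Formulas are in de Bruijn form: a context is a list of sorts,
  \<open>Var i\<close> refers to its \<open>i\<close>-th entry, and \<open>Ex s\<close> pushes \<open>s\<close> onto the front of the context.
\<close>

record ('s, 'f, 'p) signature =
  fun_type :: "'f \<Rightarrow> 's list \<times> 's"
  rel_type :: "'p \<Rightarrow> 's list"

datatype 'f tm = Var nat | App 'f "'f tm list"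

datatype ('s, 'f, 'p) fm =
    Atom 'p "'f tm list"
  | Eq "'f tm" "'f tm"
  | Top
  | Conj "('s, 'f, 'p) fm" "('s, 'f, 'p) fm"
  | Bot
  | Disj "('s, 'f, 'p) fm" "('s, 'f, 'p) fm"
  | Ex 's "('s, 'f, 'p) fm"

inductive tm_sort :: "('s, 'f, 'p) signature \<Rightarrow> 's list \<Rightarrow> 'f tm \<Rightarrow> 's \<Rightarrow> bool"
  for Sg :: "('s, 'f, 'p) signature" and \<Gamma> :: "'s list" where
  "i < length \<Gamma> \<Longrightarrow> tm_sort Sg \<Gamma> (Var i) (\<Gamma> ! i)"
| "list_all2 (tm_sort Sg \<Gamma>) ts (fst (fun_type Sg f)) \<Longrightarrow>
     tm_sort Sg \<Gamma> (App f ts) (snd (fun_type Sg f))"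

primrec wf_fm :: "('s, 'f, 'p) signature \<Rightarrow> 's list \<Rightarrow> ('s, 'f, 'p) fm \<Rightarrow> bool" where
  "wf_fm Sg \<Gamma> (Atom p ts) = list_all2 (tm_sort Sg \<Gamma>) ts (rel_type Sg p)"
| "wf_fm Sg \<Gamma> (Eq t u) = (\<exists>s. tm_sort Sg \<Gamma> t s \<and> tm_sort Sg \<Gamma> u s)"
| "wf_fm Sg \<Gamma> Top = True"
| "wf_fm Sg \<Gamma> (Conj \<phi> \<psi>) = (wf_fm Sg \<Gamma> \<phi> \<and> wf_fm Sg \<Gamma> \<psi>)"
| "wf_fm Sg \<Gamma> Bot = True"
| "wf_fm Sg \<Gamma> (Disj \<phi> \<psi>) = (wf_fm Sg \<Gamma> \<phi> \<and> wf_fm Sg \<Gamma> \<psi>)"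
| "wf_fm Sg \<Gamma> (Ex s \<phi>) = wf_fm Sg (s # \<Gamma>) \<phi>"

text \<open>\<open>(\<Gamma>, \<phi>, \<psi>)\<close> stands for the axiom \<open>\<forall>x:\<Gamma>. \<phi>(x) \<longrightarrow> \<psi>(x)\<close>.\<close>

type_synonym ('s, 'f, 'p) sequent = "'s list \<times> ('s, 'f, 'p) fm \<times> ('s, 'f, 'p) fm"

definition positive_existential_theory ::
    "('s, 'f, 'p) signature \<Rightarrow> ('s, 'f, 'p) sequent set \<Rightarrow> bool" where
  "positive_existential_theory Sg T \<longleftrightarrow>
     (\<forall>(\<Gamma>, \<phi>, \<psi>) \<in> T. wf_fm Sg \<Gamma> \<phi> \<and> wf_fm Sg \<Gamma> \<psi>)"

text \<open>
  Throughout, "set" means "subset of the type \<open>'u\<close>"; the main statement requires \<open>'u\<close> to be at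
  least as large as the set of formulas of the language.  Sorts may be empty.
\<close>

record ('s, 'f, 'p, 'u) interp =
  carr :: "'s \<Rightarrow> 'u set"
  ifun :: "'f \<Rightarrow> 'u list \<Rightarrow> 'u"
  irel :: "'p \<Rightarrow> 'u list set"

definition tuples :: "('s, 'f, 'p, 'u) interp \<Rightarrow> 's list \<Rightarrow> 'u list set" where
  "tuples M \<Gamma> = {xs. list_all2 (\<lambda>x s. x \<in> carr M s) xs \<Gamma>}"

primrec tm_val :: "('s, 'f, 'p, 'u) interp \<Rightarrow> 'u list \<Rightarrow> 'f tm \<Rightarrow> 'u" where
  "tm_val M xs (Var i) = xs ! i"
| "tm_val M xs (App f ts) = ifun M f (map (tm_val M xs) ts)"

primrec sat :: "('s, 'f, 'p, 'u) interp \<Rightarrow> 'u list \<Rightarrow> ('s, 'f, 'p) fm \<Rightarrow> bool" where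
  "sat M xs (Atom p ts) = (map (tm_val M xs) ts \<in> irel M p)"
| "sat M xs (Eq t u) = (tm_val M xs t = tm_val M xs u)"
| "sat M xs Top = True"
| "sat M xs (Conj \<phi> \<psi>) = (sat M xs \<phi> \<and> sat M xs \<psi>)"
| "sat M xs Bot = False"
| "sat M xs (Disj \<phi> \<psi>) = (sat M xs \<phi> \<or> sat M xs \<psi>)"
| "sat M xs (Ex s \<phi>) = (\<exists>a \<in> carr M s. sat M (a # xs) \<phi>)"

definition models ::
    "('s, 'f, 'p) signature \<Rightarrow> ('s, 'f, 'p) sequent set \<Rightarrow> ('s, 'f, 'p, 'u) interp set" where
  "models Sg T = {M.
     (\<forall>f. \<forall>xs \<in> tuples M (fst (fun_type Sg f)). ifun M f xs \<in> carr M (snd (fun_type Sg f))) \<and>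
     (\<forall>(\<Gamma>, \<phi>, \<psi>) \<in> T. \<forall>xs \<in> tuples M \<Gamma>. sat M xs \<phi> \<longrightarrow> sat M xs \<psi>)}"


section \<open>Sheaves on a site\<close>

text \<open>
  \<open>cmp C g f\<close> is "\<open>g\<close> after \<open>f\<close>".  \<open>Cov C X\<close> consists of families of arrows with codomain \<open>X\<close>
  (a basis of a Grothendieck topology).
\<close>

record ('o, 'a) site =
  Ob  :: "'o set"
  Ar  :: "'a set"
  dm  :: "'a \<Rightarrow> 'o"
  cd  :: "'a \<Rightarrow> 'o"
  idn :: "'o \<Rightarrow> 'a"
  cmp :: "'a \<Rightarrow> 'a \<Rightarrow> 'a"
  Cov :: "'o \<Rightarrow> 'a set set"

definition arrows :: "('o, 'a) site \<Rightarrow> 'o \<Rightarrow> 'o \<Rightarrow> 'a set" where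
  "arrows C X Y = {f \<in> Ar C. dm C f = X \<and> cd C f = Y}"

record ('o, 'a, 'u) psh =
  sec :: "'o \<Rightarrow> 'u set"
  res :: "'a \<Rightarrow> 'u \<Rightarrow> 'u"

definition presheaf :: "('o, 'a) site \<Rightarrow> ('o, 'a, 'u) psh \<Rightarrow> bool" where
  "presheaf C F \<longleftrightarrow>
     (\<forall>X. X \<notin> Ob C \<longrightarrow> sec F X = {}) \<and>
     (\<forall>f \<in> Ar C. res F f \<in> sec F (cd C f) \<rightarrow> sec F (dm C f)) \<and>
     (\<forall>X \<in> Ob C. \<forall>x \<in> sec F X. res F (idn C X) x = x) \<and>
     (\<forall>f \<in> Ar C. \<forall>g \<in> Ar C. cd C f = dm C g \<longrightarrow>
        (\<forall>x \<in> sec F (cd C g). res F (cmp C g f) x = res F f (res F g x)))"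

definition matching ::
    "('o, 'a) site \<Rightarrow> ('o, 'a, 'u) psh \<Rightarrow> 'a set \<Rightarrow> ('a \<Rightarrow> 'u) \<Rightarrow> bool" where
  "matching C F U x \<longleftrightarrow>
     (\<forall>f \<in> U. x f \<in> sec F (dm C f)) \<and>
     (\<forall>f \<in> U. \<forall>g \<in> U. \<forall>h \<in> Ar C. \<forall>k \<in> Ar C.
        cd C h = dm C f \<and> cd C k = dm C g \<and> dm C h = dm C k \<and> cmp C f h = cmp C g k \<longrightarrow>
        res F h (x f) = res F k (x g))"

definition sheaf :: "('o, 'a) site \<Rightarrow> ('o, 'a, 'u) psh \<Rightarrow> bool" where
  "sheaf C F \<longleftrightarrow> presheaf C F \<and>
     (\<forall>X \<in> Ob C. \<forall>U \<in> Cov C X. \<forall>x. matching C F U x \<longrightarrow>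
        (\<exists>!y. y \<in> sec F X \<and> (\<forall>f \<in> U. res F f y = x f)))"

definition sheaf_mor ::
    "('o, 'a) site \<Rightarrow> ('o, 'a, 'u) psh \<Rightarrow> ('o, 'a, 'v) psh \<Rightarrow> ('o \<Rightarrow> 'u \<Rightarrow> 'v) set" where
  "sheaf_mor C F G = {\<alpha> \<in> (\<Pi>\<^sub>E X \<in> Ob C. sec F X \<rightarrow>\<^sub>E sec G X).
     \<forall>f \<in> Ar C. \<forall>x \<in> sec F (cd C f). res G f (\<alpha> (cd C f) x) = \<alpha> (dm C f) (res F f x)}"

definition sheaf_iso ::
    "('o, 'a) site \<Rightarrow> ('o, 'a, 'u) psh \<Rightarrow> ('o, 'a, 'v) psh \<Rightarrow> bool" where
  "sheaf_iso C F G \<longleftrightarrow>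
     (\<exists>\<alpha> \<in> sheaf_mor C F G. \<forall>X \<in> Ob C. bij_betw (\<alpha> X) (sec F X) (sec G X))"

definition prod_sheaf ::
    "('o, 'a, 'u) psh \<Rightarrow> ('o, 'a, 'v) psh \<Rightarrow> ('o, 'a, 'u \<times> 'v) psh" where
  "prod_sheaf F G = \<lparr>sec = (\<lambda>X. sec F X \<times> sec G X), res = (\<lambda>f. map_prod (res F f) (res G f))\<rparr>"

definition one_sheaf :: "('o, 'a) site \<Rightarrow> ('o, 'a, unit) psh" where
  "one_sheaf C = \<lparr>sec = (\<lambda>X. if X \<in> Ob C then {()} else {}), res = (\<lambda>_ _. ())\<rparr>"

text \<open>Subobjects (that is, monomorphisms up to isomorphism) are represented by subsheaves.\<close>

definition subsheaf ::
    "('o, 'a) site \<Rightarrow> ('o, 'a, 'u) psh \<Rightarrow> ('o \<Rightarrow> 'u set) \<Rightarrow> bool" where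
  "subsheaf C F R \<longleftrightarrow>
     (\<forall>X. R X \<subseteq> sec F X) \<and>
     (\<forall>f \<in> Ar C. \<forall>x \<in> R (cd C f). res F f x \<in> R (dm C f)) \<and>
     (\<forall>X \<in> Ob C. \<forall>U \<in> Cov C X. \<forall>x \<in> sec F X.
        (\<forall>f \<in> U. res F f x \<in> R (dm C f)) \<longrightarrow> x \<in> R X)"

definition closed_under_products ::
    "('o, 'a) site \<Rightarrow> ('o, 'a, 'u) psh set \<Rightarrow> bool" where
  "closed_under_products C K \<longleftrightarrow>
     (\<forall>F \<in> K. \<forall>G \<in> K. \<exists>P \<in> K. sheaf_iso C P (prod_sheaf F G))"


section \<open>The monoidal category of relations\<close>

definition relation :: "('o, 'a) site \<Rightarrow> ('o, 'a, 'u) psh \<Rightarrow> ('o, 'a, 'v) psh \<Rightarrow>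
    ('o \<Rightarrow> ('u \<times> 'v) set) \<Rightarrow> bool" where
  "relation C F G R \<longleftrightarrow> subsheaf C (prod_sheaf F G) R"

text \<open>
  Composite of \<open>R\<close> from \<open>F\<close> to some \<open>G\<close> with \<open>S\<close> from \<open>G\<close> to \<open>H\<close>, first \<open>R\<close> and then \<open>S\<close>: the image
  in \<open>F \<times> H\<close>, taken in sheaves, of the pullback of \<open>R\<close> and \<open>S\<close> over \<open>G\<close>, so the intermediate
  element need only exist locally.
\<close>

definition rcomp :: "('o, 'a) site \<Rightarrow> ('o, 'a, 'u) psh \<Rightarrow> ('o, 'a, 'w) psh \<Rightarrow>
    ('o \<Rightarrow> ('u \<times> 'v) set) \<Rightarrow> ('o \<Rightarrow> ('v \<times> 'w) set) \<Rightarrow> ('o \<Rightarrow> ('u \<times> 'w) set)" where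
  "rcomp C F H R S = (\<lambda>X. {(x, z). X \<in> Ob C \<and> x \<in> sec F X \<and> z \<in> sec H X \<and>
     (\<exists>U \<in> Cov C X. \<forall>f \<in> U. (res F f x, res H f z) \<in> R (dm C f) O S (dm C f))})"

definition graph :: "('o, 'a, 'u) psh \<Rightarrow> ('o \<Rightarrow> 'u \<Rightarrow> 'v) \<Rightarrow> ('o \<Rightarrow> ('u \<times> 'v) set)" where
  "graph F \<alpha> = (\<lambda>X. {(x, \<alpha> X x) | x. x \<in> sec F X})"

definition rid :: "('o, 'a, 'u) psh \<Rightarrow> ('o \<Rightarrow> ('u \<times> 'u) set)" where
  "rid F = (\<lambda>X. Id_on (sec F X))"

definition rprod :: "('o \<Rightarrow> ('u \<times> 'v) set) \<Rightarrow> ('o \<Rightarrow> ('u1 \<times> 'v1) set) \<Rightarrow>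
    ('o \<Rightarrow> (('u \<times> 'u1) \<times> ('v \<times> 'v1)) set)" where
  "rprod R S = (\<lambda>X. {((x, x'), (y, y')) | x x' y y'. (x, y) \<in> R X \<and> (x', y') \<in> S X})"

text \<open>A subobject of \<open>F\<close>, seen as a relation from \<open>1\<close> to \<open>F\<close> and from \<open>F\<close> to \<open>1\<close>, respectively.\<close>

definition point_rel :: "('o \<Rightarrow> 'u set) \<Rightarrow> ('o \<Rightarrow> (unit \<times> 'u) set)" where
  "point_rel I = (\<lambda>X. {()} \<times> I X)"

definition char_rel :: "('o \<Rightarrow> 'u set) \<Rightarrow> ('o \<Rightarrow> ('u \<times> unit) set)" where
  "char_rel I = (\<lambda>X. I X \<times> {()})"


section \<open>Promonoids\<close>

record ('o, 'a, 'u) promonoid =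
  pcarrier :: "('o, 'a, 'u) psh"
  pmult :: "'o \<Rightarrow> (('u \<times> 'u) \<times> 'u) set"
  punit :: "'o \<Rightarrow> 'u set"

definition is_promonoid :: "('o, 'a) site \<Rightarrow> ('o, 'a, 'u) promonoid \<Rightarrow> bool" where
  "is_promonoid C P \<longleftrightarrow>
     (let M = pcarrier P; \<mu> = pmult P; \<eta> = point_rel (punit P);
          MM_M = prod_sheaf (prod_sheaf M M) M; M_MM = prod_sheaf M (prod_sheaf M M);
          one_M = prod_sheaf (one_sheaf C) M; M_one = prod_sheaf M (one_sheaf C) in
      sheaf C M \<and> relation C (prod_sheaf M M) M \<mu> \<and> subsheaf C M (punit P) \<and>
      rcomp C MM_M M (rprod \<mu> (rid M)) \<mu> =
        rcomp C MM_M M (graph MM_M (\<lambda>X ((x, y), z). (x, (y, z))))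
          (rcomp C M_MM M (rprod (rid M) \<mu>) \<mu>) \<and>
      rcomp C one_M M (rprod \<eta> (rid M)) \<mu> = graph one_M (\<lambda>X. snd) \<and>
      rcomp C M_one M (rprod (rid M) \<eta>) \<mu> = graph M_one (\<lambda>X. fst))"

definition promonoid_hom :: "('o, 'a) site \<Rightarrow> ('o, 'a, 'u) promonoid \<Rightarrow>
    ('o, 'a, 'v) promonoid \<Rightarrow> ('o \<Rightarrow> ('u \<times> 'v) set) \<Rightarrow> bool" where
  "promonoid_hom C P Q h \<longleftrightarrow>
     (let M = pcarrier P; N = pcarrier Q in
      relation C M N h \<and>
      rcomp C (prod_sheaf M M) N (pmult P) h =
        rcomp C (prod_sheaf M M) N (rprod h h) (pmult Q) \<and>
      rcomp C (one_sheaf C) N (point_rel (punit P)) h = point_rel (punit Q))"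


section \<open>Free monoids and languages\<close>

record ('o, 'a, 'u) monoid_obj =
  mcarrier :: "('o, 'a, 'u) psh"
  mmult :: "'o \<Rightarrow> 'u \<times> 'u \<Rightarrow> 'u"
  mone :: "'o \<Rightarrow> unit \<Rightarrow> 'u"

definition is_monoid_obj :: "('o, 'a) site \<Rightarrow> ('o, 'a, 'u) monoid_obj \<Rightarrow> bool" where
  "is_monoid_obj C W \<longleftrightarrow>
     (let M = mcarrier W; m = mmult W; e = mone W in
      sheaf C M \<and> m \<in> sheaf_mor C (prod_sheaf M M) M \<and> e \<in> sheaf_mor C (one_sheaf C) M \<and>
      (\<forall>X \<in> Ob C. \<forall>x \<in> sec M X.
         (\<forall>y \<in> sec M X. \<forall>z \<in> sec M X. m X (m X (x, y), z) = m X (x, m X (y, z))) \<and>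
         m X (e X (), x) = x \<and> m X (x, e X ()) = x))"

definition monoid_obj_hom :: "('o, 'a) site \<Rightarrow> ('o, 'a, 'u) monoid_obj \<Rightarrow>
    ('o, 'a, 'v) monoid_obj \<Rightarrow> ('o \<Rightarrow> 'u \<Rightarrow> 'v) \<Rightarrow> bool" where
  "monoid_obj_hom C V W g \<longleftrightarrow>
     g \<in> sheaf_mor C (mcarrier V) (mcarrier W) \<and>
     (\<forall>X \<in> Ob C. g X (mone V X ()) = mone W X () \<and>
        (\<forall>x \<in> sec (mcarrier V) X. \<forall>y \<in> sec (mcarrier V) X.
           g X (mmult V X (x, y)) = mmult W X (g X x, g X y)))"

definition is_free_monoid :: "('o, 'a) site \<Rightarrow> ('o, 'a, 'u) psh \<Rightarrow> ('o, 'a, 'u) monoid_obj \<Rightarrow>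
    ('o \<Rightarrow> 'u \<Rightarrow> 'u) \<Rightarrow> bool" where
  "is_free_monoid C A W \<iota> \<longleftrightarrow>
     is_monoid_obj C W \<and> \<iota> \<in> sheaf_mor C A (mcarrier W) \<and>
     (\<forall>N :: ('o, 'a, 'u) monoid_obj. is_monoid_obj C N \<longrightarrow>
        (\<forall>f \<in> sheaf_mor C A (mcarrier N).
           \<exists>!g. monoid_obj_hom C W N g \<and> (\<forall>X \<in> Ob C. \<forall>a \<in> sec A X. g X (\<iota> X a) = f X a)))"

definition monoid_promonoid :: "('o, 'a) site \<Rightarrow> ('o, 'a, 'u) monoid_obj \<Rightarrow>
    ('o, 'a, 'u) promonoid" where
  "monoid_promonoid C W =
     \<lparr>pcarrier = mcarrier W,
      pmult = graph (prod_sheaf (mcarrier W) (mcarrier W)) (mmult W),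
      punit = (\<lambda>X. mone W X ` sec (one_sheaf C) X)\<rparr>"

definition recognized_by_promonoid :: "('o, 'a) site \<Rightarrow> ('o, 'a, 'u) monoid_obj \<Rightarrow>
    ('o, 'a, 'v) promonoid \<Rightarrow> ('o \<Rightarrow> 'u set) \<Rightarrow> bool" where
  "recognized_by_promonoid C W P L \<longleftrightarrow> subsheaf C (mcarrier W) L \<and>
     (\<exists>h F. promonoid_hom C (monoid_promonoid C W) P h \<and> subsheaf C (pcarrier P) F \<and>
        char_rel L = rcomp C (mcarrier W) (one_sheaf C) h (char_rel F))"


section \<open>Non-deterministic automata\<close>

record ('o, 'a, 'u, 'v) nda =
  states :: "('o, 'a, 'v) psh"
  initial :: "'o \<Rightarrow> 'v set"
  final :: "'o \<Rightarrow> 'v set"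
  trans :: "'o \<Rightarrow> (('u \<times> 'v) \<times> 'v) set"

definition is_nda :: "('o, 'a) site \<Rightarrow> ('o, 'a, 'u) psh \<Rightarrow> ('o, 'a, 'u, 'v) nda \<Rightarrow> bool" where
  "is_nda C A N \<longleftrightarrow> sheaf C (states N) \<and>
     subsheaf C (states N) (initial N) \<and> subsheaf C (states N) (final N) \<and>
     relation C (prod_sheaf A (states N)) (states N) (trans N)"

text \<open>
  \<open>\<rho>\<close> from \<open>\<Sigma>\<^sup>* \<times> S\<close> to \<open>S\<close> is the transpose of a monoid homomorphism from \<open>\<Sigma>\<^sup>*\<close> into the object
  \<open>\<Omega>\<^bsup>S \<times> S\<^esup>\<close> of binary relations on \<open>S\<close> (under composition in reading order: a product \<open>u v\<close> acts by
  first \<open>u\<close> and then \<open>v\<close>) whose restriction along \<open>\<iota>\<close> is the transition relation.  There is exactly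
  one such \<open>\<rho>\<close> when \<open>\<Sigma>\<^sup>*\<close> is the free monoid on \<open>\<Sigma>\<close> in the whole topos.
\<close>

definition induced_action :: "('o, 'a) site \<Rightarrow> ('o, 'a, 'u) psh \<Rightarrow> ('o, 'a, 'u) monoid_obj \<Rightarrow>
    ('o \<Rightarrow> 'u \<Rightarrow> 'u) \<Rightarrow> ('o, 'a, 'u, 'v) nda \<Rightarrow> ('o \<Rightarrow> (('u \<times> 'v) \<times> 'v) set) \<Rightarrow> bool" where
  "induced_action C A W \<iota> N \<rho> \<longleftrightarrow>
     (let S = states N; V = mcarrier W;
          one_S = prod_sheaf (one_sheaf C) S; VV_S = prod_sheaf (prod_sheaf V V) S in
      relation C (prod_sheaf V S) S \<rho> \<and>
      rcomp C one_S S (rprod (graph (one_sheaf C) (mone W)) (rid S)) \<rho> = graph one_S (\<lambda>X. snd) \<and>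
      rcomp C VV_S S (rprod (graph (prod_sheaf V V) (mmult W)) (rid S)) \<rho> =
        rcomp C VV_S S (graph VV_S (\<lambda>X ((u, v), s). (v, (u, s))))
          (rcomp C (prod_sheaf V (prod_sheaf V S)) S (rprod (rid V) \<rho>) \<rho>) \<and>
      rcomp C (prod_sheaf A S) S (rprod (graph A \<iota>) (rid S)) \<rho> = trans N)"

text \<open>
  \<open>L\<close> is the composite of relations from \<open>\<Sigma>\<^sup>*\<close> to \<open>\<Sigma>\<^sup>* \<times> S\<close> (given by the initial states), to \<open>S\<close>
  (given by the action), to \<open>1\<close> (given by the final states).
\<close>

definition recognized_by_nda :: "('o, 'a) site \<Rightarrow> ('o, 'a, 'u) psh \<Rightarrow> ('o, 'a, 'u) monoid_obj \<Rightarrow>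
    ('o \<Rightarrow> 'u \<Rightarrow> 'u) \<Rightarrow> ('o, 'a, 'u, 'v) nda \<Rightarrow> ('o \<Rightarrow> 'u set) \<Rightarrow> bool" where
  "recognized_by_nda C A W \<iota> N L \<longleftrightarrow>
     (let S = states N; V = mcarrier W in
      subsheaf C V L \<and>
      (\<exists>\<rho>. induced_action C A W \<iota> N \<rho> \<and>
         char_rel L =
           rcomp C V (one_sheaf C)
             (rcomp C V S
                (rcomp C V (prod_sheaf V S)
                   (graph V (\<lambda>X w. (w, ())))
                   (rprod (rid V) (point_rel (initial N))))
                \<rho>)
             (char_rel (final N))))"


section \<open>The syntactic site\<close>

text \<open>
  Objects are formulas in context.  An arrow carries, with its domain and codomain, an equivalence
  class modulo the theory of functional formulas; in a formula for an arrow from \<open>(\<Gamma>, \<phi>)\<close> to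
  \<open>(\<Delta>, \<psi>)\<close>, the variables of \<open>\<Gamma>\<close> come first.  "Modulo the theory" means in all models; by the
  completeness theorem for coherent logic and the downward Loewenheim-Skolem theorem this is
  derivability as soon as \<open>'u\<close> is at least as large as the set of formulas.  The type argument
  \<open>'u itself\<close> only fixes the sets in which models take their values.
\<close>

type_synonym ('s, 'f, 'p) obj = "'s list \<times> ('s, 'f, 'p) fm"
type_synonym ('s, 'f, 'p) arr = "('s, 'f, 'p) obj \<times> ('s, 'f, 'p) fm set \<times> ('s, 'f, 'p) obj"

definition ext :: "('s, 'f, 'p, 'u) interp \<Rightarrow> ('s, 'f, 'p) obj \<Rightarrow> 'u list set" where
  "ext M X = {xs \<in> tuples M (fst X). sat M xs (snd X)}"

definition functional :: "('s, 'f, 'p) signature \<Rightarrow> ('s, 'f, 'p) sequent set \<Rightarrow> 'u itself \<Rightarrow>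
    ('s, 'f, 'p) obj \<Rightarrow> ('s, 'f, 'p) obj \<Rightarrow> ('s, 'f, 'p) fm \<Rightarrow> bool" where
  "functional Sg T U X Y \<theta> \<longleftrightarrow> wf_fm Sg (fst X @ fst Y) \<theta> \<and>
     (\<forall>M \<in> (models Sg T :: ('s, 'f, 'p, 'u) interp set).
        (\<forall>xs \<in> tuples M (fst X). \<forall>ys \<in> tuples M (fst Y).
           sat M (xs @ ys) \<theta> \<longrightarrow> xs \<in> ext M X \<and> ys \<in> ext M Y) \<and>
        (\<forall>xs \<in> ext M X. \<exists>!ys. ys \<in> ext M Y \<and> sat M (xs @ ys) \<theta>))"

definition fm_class :: "('s, 'f, 'p) signature \<Rightarrow> ('s, 'f, 'p) sequent set \<Rightarrow>
    's list \<Rightarrow> 's list \<Rightarrow> (('s, 'f, 'p, 'u) interp \<Rightarrow> 'u list \<Rightarrow> 'u list \<Rightarrow> bool) \<Rightarrow>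
    ('s, 'f, 'p) fm set" where
  "fm_class Sg T \<Gamma> \<Delta> Q = {\<theta>. wf_fm Sg (\<Gamma> @ \<Delta>) \<theta> \<and>
     (\<forall>M \<in> models Sg T. \<forall>xs \<in> tuples M \<Gamma>. \<forall>ys \<in> tuples M \<Delta>.
        sat M (xs @ ys) \<theta> \<longleftrightarrow> Q M xs ys)}"

definition arr_rel :: "('s, 'f, 'p) arr \<Rightarrow> ('s, 'f, 'p, 'u) interp \<Rightarrow> 'u list \<Rightarrow> 'u list \<Rightarrow> bool" where
  "arr_rel a M xs ys \<longleftrightarrow> (\<exists>\<theta> \<in> fst (snd a). sat M (xs @ ys) \<theta>)"

definition syn_site :: "('s, 'f, 'p) signature \<Rightarrow> ('s, 'f, 'p) sequent set \<Rightarrow> 'u itself \<Rightarrow>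
    (('s, 'f, 'p) obj, ('s, 'f, 'p) arr) site" where
  "syn_site Sg T U =
     (let obs = {X. wf_fm Sg (fst X) (snd X)};
          ars = {(X, fm_class Sg T (fst X) (fst Y) (\<lambda>M :: ('s, 'f, 'p, 'u) interp. \<lambda>xs ys. sat M (xs @ ys) \<theta>), Y) | X Y \<theta>.
                   X \<in> obs \<and> Y \<in> obs \<and> functional Sg T U X Y \<theta>}
      in
      \<lparr>Ob = obs,
       Ar = ars,
       dm = fst,
       cd = (\<lambda>a. snd (snd a)),
       idn = (\<lambda>X. (X, fm_class Sg T (fst X) (fst X) (\<lambda>M :: ('s, 'f, 'p, 'u) interp. \<lambda>xs ys. xs = ys \<and> xs \<in> ext M X), X)),
       cmp = (\<lambda>b a.
         (fst a,
          fm_class Sg T (fst (fst a)) (fst (snd (snd b)))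
            (\<lambda>M :: ('s, 'f, 'p, 'u) interp. \<lambda>xs zs. \<exists>ys \<in> tuples M (fst (fst b)). arr_rel a M xs ys \<and> arr_rel b M ys zs),
          snd (snd b))),
       \<comment> \<open>coherent topology: finite families that are jointly surjective modulo the theory\<close>
       Cov = (\<lambda>X. {F. finite F \<and> F \<subseteq> {a \<in> ars. snd (snd a) = X} \<and>
         (\<forall>M \<in> (models Sg T :: ('s, 'f, 'p, 'u) interp set). \<forall>xs \<in> ext M X.
            \<exists>a \<in> F. \<exists>ys \<in> ext M (fst a). arr_rel a M ys xs)})\<rparr>)"

text \<open>
  The objects of the classifying topos \<open>Set(T)\<close> whose sets of sections are subsets of \<open>'u\<close>.
  Finite products, subobjects, images and free monoids computed in this full subcategory are
  those of the whole topos once \<open>'u\<close> is at least as large as the set of formulas.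
\<close>

definition classifying_topos :: "('s, 'f, 'p) signature \<Rightarrow> ('s, 'f, 'p) sequent set \<Rightarrow>
    (('s, 'f, 'p) obj, ('s, 'f, 'p) arr, 'u) psh set" where
  "classifying_topos Sg T = {F. sheaf (syn_site Sg T TYPE('u)) F}"


section \<open>Disjoint coproducts and elimination of imaginaries\<close>

definition is_initial :: "('o, 'a) site \<Rightarrow> 'o \<Rightarrow> bool" where
  "is_initial C Z \<longleftrightarrow> Z \<in> Ob C \<and> (\<forall>Y \<in> Ob C. \<exists>!f. f \<in> arrows C Z Y)"

definition is_mono :: "('o, 'a) site \<Rightarrow> 'a \<Rightarrow> bool" where
  "is_mono C m \<longleftrightarrow> (\<forall>Z \<in> Ob C. \<forall>f \<in> arrows C Z (dm C m). \<forall>g \<in> arrows C Z (dm C m).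
     cmp C m f = cmp C m g \<longrightarrow> f = g)"

definition is_coproduct :: "('o, 'a) site \<Rightarrow> 'o \<Rightarrow> 'o \<Rightarrow> 'o \<Rightarrow> 'a \<Rightarrow> 'a \<Rightarrow> bool" where
  "is_coproduct C X Y Z i j \<longleftrightarrow> Z \<in> Ob C \<and> i \<in> arrows C X Z \<and> j \<in> arrows C Y Z \<and>
     (\<forall>Q \<in> Ob C. \<forall>f \<in> arrows C X Q. \<forall>g \<in> arrows C Y Q.
        \<exists>!u. u \<in> arrows C Z Q \<and> cmp C u i = f \<and> cmp C u j = g)"

definition is_pullback :: "('o, 'a) site \<Rightarrow> 'a \<Rightarrow> 'a \<Rightarrow> 'o \<Rightarrow> 'a \<Rightarrow> 'a \<Rightarrow> bool" where
  "is_pullback C i j P p q \<longleftrightarrow> P \<in> Ob C \<and>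
     p \<in> arrows C P (dm C i) \<and> q \<in> arrows C P (dm C j) \<and> cmp C i p = cmp C j q \<and>
     (\<forall>Q \<in> Ob C. \<forall>f \<in> arrows C Q (dm C i). \<forall>g \<in> arrows C Q (dm C j).
        cmp C i f = cmp C j g \<longrightarrow>
        (\<exists>!u. u \<in> arrows C Q P \<and> cmp C p u = f \<and> cmp C q u = g))"

text \<open>The initial object always exists in a syntactic category (the formula \<open>Bot\<close>).\<close>

definition has_disjoint_coproducts ::
    "('s, 'f, 'p) signature \<Rightarrow> ('s, 'f, 'p) sequent set \<Rightarrow> 'u itself \<Rightarrow> bool" where
  "has_disjoint_coproducts Sg T U \<longleftrightarrow>
     (let C = syn_site Sg T U in
      \<forall>X \<in> Ob C. \<forall>Y \<in> Ob C. \<exists>Z i j. is_coproduct C X Y Z i j \<and> is_mono C i \<and> is_mono C j \<and>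
        (\<exists>P p q. is_pullback C i j P p q \<and> is_initial C P))"

text \<open>
  Every definable equivalence relation on a definable set is the kernel of a definable function.
\<close>

definition eliminates_imaginaries ::
    "('s, 'f, 'p) signature \<Rightarrow> ('s, 'f, 'p) sequent set \<Rightarrow> 'u itself \<Rightarrow> bool" where
  "eliminates_imaginaries Sg T U \<longleftrightarrow>
     (\<forall>X \<in> Ob (syn_site Sg T U). \<forall>\<epsilon>. wf_fm Sg (fst X @ fst X) \<epsilon> \<longrightarrow>
        (\<forall>M \<in> (models Sg T :: ('s, 'f, 'p, 'u) interp set).
           equiv (ext M X) {(x, y). x \<in> ext M X \<and> y \<in> ext M X \<and> sat M (x @ y) \<epsilon>}) \<longrightarrow>
        (\<exists>Y \<in> Ob (syn_site Sg T U). \<exists>q \<in> arrows (syn_site Sg T U) X Y.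
           \<forall>M \<in> (models Sg T :: ('s, 'f, 'p, 'u) interp set).
             \<forall>x \<in> ext M X. \<forall>y \<in> ext M X.
               sat M (x @ y) \<epsilon> \<longleftrightarrow> (\<exists>z \<in> ext M Y. arr_rel q M x z \<and> arr_rel q M y z)))"

end

theory Submission
  imports Defs
begin

text \<open>
  Kripke-Joyal reasoning: the composite of two relations is the least subsheaf containing the
  pointwise composites, so equations between relations can be checked on sections, with local
  existence eliminated into subsheaves.

  An automaton with states \<open>S\<close> and action \<open>\<rho>\<close> gives the promonoid on \<open>S \<times> S\<close> in which \<open>(a, b)\<close>
  and \<open>(b, c)\<close> multiply to \<open>(a, c)\<close>, with the diagonal as unit; \<open>w\<close> is related to \<open>(s, t)\<close> when
  \<open>w\<close> leads from \<open>s\<close> to \<open>t\<close>.  Conversely, a promonoid \<open>M\<close> with a homomorphism \<open>h\<close> gives an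
  automaton with states \<open>M\<close>, started in the unit, in which \<open>w\<close> leads from \<open>s\<close> to the products
  of \<open>s\<close> with the elements related to \<open>w\<close> by \<open>h\<close>.
\<close>

section \<open>Relations between sheaves\<close>

text \<open>Both constructions come from general monoidal facts. In the category of relations every
  object is its own dual, so \<open>S \<times> S\<close> is the internal endomorphism object of
  \<open>S\<close>; the multiplication of pairs is composition of endomorphisms, and an action on
  \<open>S\<close> transposes to a homomorphism into it. Conversely, a monoid acts on itself by
  right multiplication, and the orbit of the unit recovers the homomorphism. The obstacle is that
  the intermediate element of a composite exists only on a cover, and witnesses chosen on its
  members need not glue. The proofs therefore restrict to a member of the cover, argue with sections
  there, and return because the conclusion is membership in a subsheaf. Where coordinates determine
  the witness, as for pairs of states, it is global and the composite is pointwise. A second task is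
  to show that the syntactic site has well-behaved covers. Its arrows are classes of formulas, so
  each identity, composite and pullback needs a defining formula; these come from closure of
  definable predicates under renaming, conjunction and existential quantification.\<close>

lemma sec_prod_sheaf [simp]: "sec (prod_sheaf F G) X = sec F X \<times> sec G X"
  by (simp add: prod_sheaf_def)

lemma res_prod_sheaf [simp]: "res (prod_sheaf F G) f = map_prod (res F f) (res G f)"
  by (simp add: prod_sheaf_def)

lemma sec_one_sheaf [simp]: "sec (one_sheaf C) X = (if X \<in> Ob C then {()} else {})"
  by (simp add: one_sheaf_def)

lemma mem_rid [simp]: "(x, y) \<in> rid F X \<longleftrightarrow> x = y \<and> x \<in> sec F X"
  by (auto simp: rid_def)

lemma mem_graph [simp]: "(x, y) \<in> graph F \<alpha> X \<longleftrightarrow> x \<in> sec F X \<and> y = \<alpha> X x"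
  by (auto simp: graph_def)

lemma mem_rprod [simp]:
  "((x, x'), y, y') \<in> rprod R S X \<longleftrightarrow> (x, y) \<in> R X \<and> (x', y') \<in> S X"
  by (auto simp: rprod_def)

lemma mem_point_rel [simp]: "(u, x) \<in> point_rel I X \<longleftrightarrow> x \<in> I X"
  by (auto simp: point_rel_def)

lemma mem_char_rel [simp]: "(x, u) \<in> char_rel I X \<longleftrightarrow> x \<in> I X"
  by (auto simp: char_rel_def)

text \<open>Lets a map applied in one factor be treated as a single map, so that precomposition with
  it becomes substitution.\<close>

lemma rprod_graph_rid:
  "rprod (graph F \<alpha>) (rid S) = graph (prod_sheaf F S) (\<lambda>X. map_prod (\<alpha> X) id)"
  by (auto simp: fun_eq_iff rprod_def graph_def rid_def)

text \<open>The site axioms in the form in which composites of relations consume them: identity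
  covers make pointwise composites members of \<open>rcomp\<close>, pulled-back covers make
  \<open>rcomp\<close> stable under restriction, and composed covers make it local. Pullback
  stability asks for a cover whose members factor through the given one.\<close>

locale coverage =
  fixes C :: "('o, 'a) site"
  assumes dm_Ob: "f \<in> Ar C \<Longrightarrow> dm C f \<in> Ob C"
    and cd_Ob: "f \<in> Ar C \<Longrightarrow> cd C f \<in> Ob C"
    and idn: "X \<in> Ob C \<Longrightarrow> idn C X \<in> arrows C X X"
    and cmp: "f \<in> arrows C X Y \<Longrightarrow> g \<in> arrows C Y Z \<Longrightarrow> cmp C g f \<in> arrows C X Z"
    and Cov_arrow: "X \<in> Ob C \<Longrightarrow> U \<in> Cov C X \<Longrightarrow> f \<in> U \<Longrightarrow> f \<in> Ar C \<and> cd C f = X"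
    and Cov_idn: "X \<in> Ob C \<Longrightarrow> {idn C X} \<in> Cov C X"
    and Cov_pullback: "U \<in> Cov C X \<Longrightarrow> g \<in> arrows C Y X \<Longrightarrow>
      \<exists>V \<in> Cov C Y. \<forall>v \<in> V. \<exists>f \<in> U. \<exists>k \<in> arrows C (dm C v) (dm C f). cmp C g v = cmp C f k"
    and Cov_trans: "X \<in> Ob C \<Longrightarrow> U \<in> Cov C X \<Longrightarrow> (\<And>f. f \<in> U \<Longrightarrow> V f \<in> Cov C (dm C f)) \<Longrightarrow>
      {cmp C f g | f g. f \<in> U \<and> g \<in> V f} \<in> Cov C X"
begin

section \<open>Presheaves, sheaves and subsheaves over a coverage\<close>

lemma presheaf_Ob: "presheaf C F \<Longrightarrow> x \<in> sec F X \<Longrightarrow> X \<in> Ob C"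
  unfolding presheaf_def by blast

lemma presheaf_res: "presheaf C F \<Longrightarrow> f \<in> Ar C \<Longrightarrow> x \<in> sec F (cd C f) \<Longrightarrow> res F f x \<in> sec F (dm C f)"
  unfolding presheaf_def by blast

lemma presheaf_idn: "presheaf C F \<Longrightarrow> x \<in> sec F X \<Longrightarrow> res F (idn C X) x = x"
  unfolding presheaf_def by blast

lemma presheaf_cmp:
  "presheaf C F \<Longrightarrow> f \<in> arrows C X Y \<Longrightarrow> g \<in> arrows C Y Z \<Longrightarrow> x \<in> sec F Z \<Longrightarrow>
    res F (cmp C g f) x = res F f (res F g x)"
  unfolding presheaf_def arrows_def by auto

lemma cmp_Ar:
  assumes "f \<in> Ar C" "g \<in> Ar C" "cd C f = dm C g"
  shows "cmp C g f \<in> Ar C" "dm C (cmp C g f) = dm C f" "cd C (cmp C g f) = cd C g"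
  using cmp[of f "dm C f" "cd C f" g "cd C g"] assms by (auto simp: arrows_def)

lemma presheaf_prod: "presheaf C F \<Longrightarrow> presheaf C G \<Longrightarrow> presheaf C (prod_sheaf F G)"
proof -
  assume F: "presheaf C F" and G: "presheaf C G"
  show ?thesis
    unfolding presheaf_def
  proof (intro conjI ballI allI impI)
    show "sec (prod_sheaf F G) X = {}" if "X \<notin> Ob C" for X
      using that presheaf_Ob[OF F] by auto
    show "res (prod_sheaf F G) f \<in> sec (prod_sheaf F G) (cd C f) \<rightarrow> sec (prod_sheaf F G) (dm C f)"
      if "f \<in> Ar C" for f
      using presheaf_res[OF F that] presheaf_res[OF G that] by auto
    show "res (prod_sheaf F G) (idn C X) x = x" if "x \<in> sec (prod_sheaf F G) X" for X x
      using that presheaf_idn[OF F] presheaf_idn[OF G] by auto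
    show "res (prod_sheaf F G) (cmp C g f) x = res (prod_sheaf F G) f (res (prod_sheaf F G) g x)"
      if "f \<in> Ar C" "g \<in> Ar C" "cd C f = dm C g" "x \<in> sec (prod_sheaf F G) (cd C g)" for f g x
      using that presheaf_cmp[OF F, of f "dm C f" "dm C g" g "cd C g"]
        presheaf_cmp[OF G, of f "dm C f" "dm C g" g "cd C g"]
      by (auto simp: arrows_def)
  qed
qed

lemma presheaf_one: "presheaf C (one_sheaf C)"
  unfolding presheaf_def using dm_Ob cmp_Ar by (auto simp: one_sheaf_def)

lemma sheaf_presheaf: "sheaf C F \<Longrightarrow> presheaf C F"
  by (simp add: sheaf_def)

text \<open>The restrictions of \<open>x\<close> form a matching family, because restricting along
  \<open>f\<close> and then \<open>h\<close> depends only on the composite of the two. Both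
  \<open>x\<close> and \<open>y\<close> glue this family, and gluing is unique.\<close>

lemma sheaf_separated:
  assumes F: "sheaf C F" and U: "X \<in> Ob C" "U \<in> Cov C X"
    and x: "x \<in> sec F X" and y: "y \<in> sec F X"
    and eq: "\<And>f. f \<in> U \<Longrightarrow> res F f x = res F f y"
  shows "x = y"
proof -
  have P: "presheaf C F" using F by (rule sheaf_presheaf)
  have "matching C F U (\<lambda>f. res F f x)"
    unfolding matching_def
  proof (intro conjI ballI impI)
    fix f assume f: "f \<in> U"
    then show "res F f x \<in> sec F (dm C f)"
      using presheaf_res[OF P] Cov_arrow[OF U f] x by auto
  next
    fix f g h k
    assume a: "f \<in> U" "g \<in> U" "h \<in> Ar C" "k \<in> Ar C"
      "cd C h = dm C f \<and> cd C k = dm C g \<and> dm C h = dm C k \<and> cmp C f h = cmp C g k"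
    have "res F (cmp C f h) x = res F h (res F f x)"
      by (rule presheaf_cmp[OF P _ _ x, of h "dm C h" "dm C f" f])
        (use a Cov_arrow[OF U] in \<open>auto simp: arrows_def\<close>)
    moreover have "res F (cmp C g k) x = res F k (res F g x)"
      by (rule presheaf_cmp[OF P _ _ x, of k "dm C k" "dm C g" g])
        (use a Cov_arrow[OF U] in \<open>auto simp: arrows_def\<close>)
    ultimately show "res F h (res F f x) = res F k (res F g x)" using a by simp
  qed
  then have "\<exists>!z. z \<in> sec F X \<and> (\<forall>f \<in> U. res F f z = res F f x)"
    using F U unfolding sheaf_def by blast
  then show ?thesis using x y eq by metis
qed

lemma subsheaf_sec: "subsheaf C F R \<Longrightarrow> x \<in> R X \<Longrightarrow> x \<in> sec F X"
  unfolding subsheaf_def by blast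

lemma subsheaf_res: "subsheaf C F R \<Longrightarrow> f \<in> Ar C \<Longrightarrow> x \<in> R (cd C f) \<Longrightarrow> res F f x \<in> R (dm C f)"
  unfolding subsheaf_def by blast

lemma subsheaf_local:
  "subsheaf C F R \<Longrightarrow> X \<in> Ob C \<Longrightarrow> U \<in> Cov C X \<Longrightarrow> x \<in> sec F X \<Longrightarrow>
    (\<And>f. f \<in> U \<Longrightarrow> res F f x \<in> R (dm C f)) \<Longrightarrow> x \<in> R X"
  unfolding subsheaf_def by blast

lemma relation_sec: "relation C F G R \<Longrightarrow> (x, y) \<in> R X \<Longrightarrow> x \<in> sec F X \<and> y \<in> sec G X"
  unfolding relation_def using subsheaf_sec by fastforce

lemma relation_res:
  "relation C F G R \<Longrightarrow> f \<in> Ar C \<Longrightarrow> (x, y) \<in> R (cd C f) \<Longrightarrow> (res F f x, res G f y) \<in> R (dm C f)"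
  unfolding relation_def using subsheaf_res by fastforce

lemma relation_local:
  "relation C F G R \<Longrightarrow> X \<in> Ob C \<Longrightarrow> U \<in> Cov C X \<Longrightarrow> x \<in> sec F X \<Longrightarrow> y \<in> sec G X \<Longrightarrow>
    (\<And>f. f \<in> U \<Longrightarrow> (res F f x, res G f y) \<in> R (dm C f)) \<Longrightarrow> (x, y) \<in> R X"
  unfolding relation_def using subsheaf_local[of "prod_sheaf F G" R X U "(x, y)"] by auto

lemma relationI:
  assumes "\<And>X x y. (x, y) \<in> R X \<Longrightarrow> x \<in> sec F X \<and> y \<in> sec G X"
    and "\<And>f x y. f \<in> Ar C \<Longrightarrow> (x, y) \<in> R (cd C f) \<Longrightarrow> (res F f x, res G f y) \<in> R (dm C f)"
    and "\<And>X U x y. X \<in> Ob C \<Longrightarrow> U \<in> Cov C X \<Longrightarrow> x \<in> sec F X \<Longrightarrow> y \<in> sec G X \<Longrightarrow>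
      (\<And>f. f \<in> U \<Longrightarrow> f \<in> Ar C \<and> cd C f = X \<and> (res F f x, res G f y) \<in> R (dm C f)) \<Longrightarrow> (x, y) \<in> R X"
  shows "relation C F G R"
  unfolding relation_def subsheaf_def
proof (intro conjI allI ballI impI)
  show "R X \<subseteq> sec (prod_sheaf F G) X" for X
    using assms(1) by auto
  show "res (prod_sheaf F G) f x \<in> R (dm C f)" if "f \<in> Ar C" "x \<in> R (cd C f)" for f x
    using assms(2) that by (cases x) auto
  show "x \<in> R X" if "X \<in> Ob C" "U \<in> Cov C X" "x \<in> sec (prod_sheaf F G) X"
    "\<forall>f\<in>U. res (prod_sheaf F G) f x \<in> R (dm C f)" for X U x
    using assms(3)[OF that(1,2), of "fst x" "snd x"] Cov_arrow[OF that(1,2)] that(3,4)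
    by (cases x) auto
qed

subsection \<open>Composition of relations\<close>

text \<open>Together with \<open>relation_rcomp\<close>, the next two rules say that \<open>rcomp\<close> is the least subsheaf
  containing the pointwise composites; \<open>rcompE\<close> is the elimination of a local existential
  quantifier in Kripke-Joyal semantics.\<close>

lemma rcompI:
  assumes F: "presheaf C F" and H: "presheaf C H"
    and x: "x \<in> sec F X" and z: "z \<in> sec H X" and RS: "(x, y) \<in> R X" "(y, z) \<in> S X"
  shows "(x, z) \<in> rcomp C F H R S X"
proof -
  have X: "X \<in> Ob C" using presheaf_Ob[OF F x] .
  have "dm C (idn C X) = X" using idn[OF X] by (simp add: arrows_def)
  then have "\<forall>f\<in>{idn C X}. (res F f x, res H f z) \<in> R (dm C f) O S (dm C f)"
    using RS presheaf_idn[OF F x] presheaf_idn[OF H z] by auto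
  then show ?thesis using Cov_idn[OF X] x z X unfolding rcomp_def by blast
qed

lemma rcompE:
  assumes "(x, z) \<in> rcomp C F H R S X" and Q: "subsheaf C G Q" and g: "g \<in> sec G X"
    and *: "\<And>f y. f \<in> Ar C \<Longrightarrow> cd C f = X \<Longrightarrow> (res F f x, y) \<in> R (dm C f) \<Longrightarrow>
      (y, res H f z) \<in> S (dm C f) \<Longrightarrow> res G f g \<in> Q (dm C f)"
  shows "g \<in> Q X"
proof -
  obtain U where U: "X \<in> Ob C" "U \<in> Cov C X"
    "\<And>f. f \<in> U \<Longrightarrow> (res F f x, res H f z) \<in> R (dm C f) O S (dm C f)"
    using assms(1) unfolding rcomp_def by blast
  show ?thesis
  proof (rule subsheaf_local[OF Q U(1,2) g])
    fix f assume f: "f \<in> U"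
    then obtain y where "(res F f x, y) \<in> R (dm C f)" "(y, res H f z) \<in> S (dm C f)"
      using U(3) by blast
    then show "res G f g \<in> Q (dm C f)" using * Cov_arrow[OF U(1,2) f] by blast
  qed
qed

text \<open>For restriction along \<open>g\<close>, the witnessing cover is pulled back; each new
  member factors through some old \<open>f\<close> by some \<open>k\<close>, and the witness over
  \<open>f\<close> is restricted along \<open>k\<close>. For locality, a witnessing cover is chosen
  over each member of \<open>U\<close>, and the composites form one cover of
  \<open>X\<close>.\<close>

lemma relation_rcomp:
  assumes F: "presheaf C F" and H: "presheaf C H"
    and R: "relation C F G R" and S: "relation C G H S"
  shows "relation C F H (rcomp C F H R S)"
proof (rule relationI)
  show "x \<in> sec F X \<and> z \<in> sec H X" if "(x, z) \<in> rcomp C F H R S X" for X x z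
    using that unfolding rcomp_def by blast
next
  fix g x z assume g: "g \<in> Ar C" and "(x, z) \<in> rcomp C F H R S (cd C g)"
  then obtain U where U: "U \<in> Cov C (cd C g)" and x: "x \<in> sec F (cd C g)" and z: "z \<in> sec H (cd C g)"
    and *: "\<And>f. f \<in> U \<Longrightarrow> (res F f x, res H f z) \<in> R (dm C f) O S (dm C f)"
    unfolding rcomp_def by blast
  have g': "g \<in> arrows C (dm C g) (cd C g)" using g by (simp add: arrows_def)
  obtain V where V: "V \<in> Cov C (dm C g)"
    and fac: "\<And>v. v \<in> V \<Longrightarrow> \<exists>f \<in> U. \<exists>k \<in> arrows C (dm C v) (dm C f). cmp C g v = cmp C f k"
    using Cov_pullback[OF U g'] by blast
  have "(res F v (res F g x), res H v (res H g z)) \<in> R (dm C v) O S (dm C v)" if v: "v \<in> V" for v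
  proof -
    obtain f k where f: "f \<in> U" and k: "k \<in> arrows C (dm C v) (dm C f)" and eq: "cmp C g v = cmp C f k"
      using fac[OF v] by blast
    have v': "v \<in> arrows C (dm C v) (dm C g)"
      using Cov_arrow[OF dm_Ob[OF g] V v] by (simp add: arrows_def)
    have f': "f \<in> arrows C (dm C f) (cd C g)"
      using Cov_arrow[OF cd_Ob[OF g] U f] by (simp add: arrows_def)
    obtain y where y: "(res F f x, y) \<in> R (dm C f)" "(y, res H f z) \<in> S (dm C f)"
      using *[OF f] by blast
    have k': "k \<in> Ar C" "dm C k = dm C v" "cd C k = dm C f" using k by (auto simp: arrows_def)
    have "(res F k (res F f x), res G k y) \<in> R (dm C v)" "(res G k y, res H k (res H f z)) \<in> S (dm C v)"
      using relation_res[OF R k'(1)] relation_res[OF S k'(1)] y k' by auto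
    moreover have "res F v (res F g x) = res F k (res F f x)"
      using presheaf_cmp[OF F v' g' x] presheaf_cmp[OF F k f' x] eq by simp
    moreover have "res H v (res H g z) = res H k (res H f z)"
      using presheaf_cmp[OF H v' g' z] presheaf_cmp[OF H k f' z] eq by simp
    ultimately show ?thesis by auto
  qed
  then show "(res F g x, res H g z) \<in> rcomp C F H R S (dm C g)"
    unfolding rcomp_def
    using V dm_Ob[OF g] presheaf_res[OF F g x] presheaf_res[OF H g z] by blast
next
  fix X U x z
  assume U: "X \<in> Ob C" "U \<in> Cov C X" and x: "x \<in> sec F X" and z: "z \<in> sec H X"
    and *: "\<And>f. f \<in> U \<Longrightarrow> f \<in> Ar C \<and> cd C f = X \<and> (res F f x, res H f z) \<in> rcomp C F H R S (dm C f)"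
  have "\<forall>f \<in> U. \<exists>V. V \<in> Cov C (dm C f) \<and> (\<forall>v \<in> V. (res F v (res F f x), res H v (res H f z))
      \<in> R (dm C v) O S (dm C v))"
    using * unfolding rcomp_def by blast
  then obtain V where V: "\<And>f. f \<in> U \<Longrightarrow> V f \<in> Cov C (dm C f)"
    and V': "\<And>f v. f \<in> U \<Longrightarrow> v \<in> V f \<Longrightarrow>
      (res F v (res F f x), res H v (res H f z)) \<in> R (dm C v) O S (dm C v)"
    by metis
  let ?W = "{cmp C f g | f g. f \<in> U \<and> g \<in> V f}"
  have "(res F w x, res H w z) \<in> R (dm C w) O S (dm C w)" if W: "w \<in> ?W" for w
  proof -
    obtain f v where w: "w = cmp C f v" and f: "f \<in> U" and v: "v \<in> V f" using W by blast
    have f': "f \<in> arrows C (dm C f) X" using *[OF f] by (simp add: arrows_def)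
    have v': "v \<in> arrows C (dm C v) (dm C f)"
      using Cov_arrow[OF _ V[OF f] v] dm_Ob *[OF f] by (simp add: arrows_def)
    have "dm C w = dm C v" using cmp[OF v' f'] w by (simp add: arrows_def)
    then show ?thesis
      using V'[OF f v] presheaf_cmp[OF F v' f' x] presheaf_cmp[OF H v' f' z] w by simp
  qed
  then show "(x, z) \<in> rcomp C F H R S X"
    using Cov_trans[OF U V] U(1) x z unfolding rcomp_def by blast
qed

text \<open>\<open>rcompE\<close> for the pair itself: inclusions of composites reduce to pointwise
  witnesses, since \<open>Q\<close> absorbs the cover.\<close>

lemma rcomp_least:
  assumes "presheaf C F" "presheaf C H" and Q: "relation C F H Q"
    and *: "\<And>X x y z. (x, y) \<in> R X \<Longrightarrow> (y, z) \<in> S X \<Longrightarrow> x \<in> sec F X \<Longrightarrow> z \<in> sec H X \<Longrightarrow> (x, z) \<in> Q X"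
    and m: "(x, z) \<in> rcomp C F H R S X"
  shows "(x, z) \<in> Q X"
proof (rule rcompE[OF m Q[unfolded relation_def]])
  have xz: "x \<in> sec F X" "z \<in> sec H X" using m unfolding rcomp_def by auto
  then show "(x, z) \<in> sec (prod_sheaf F H) X" by simp
  fix f y assume "f \<in> Ar C" "cd C f = X" "(res F f x, y) \<in> R (dm C f)" "(y, res H f z) \<in> S (dm C f)"
  then show "res (prod_sheaf F H) f (x, z) \<in> Q (dm C f)"
    using *[of "res F f x" y "dm C f" "res H f z"] presheaf_res[OF assms(1), of f x]
      presheaf_res[OF assms(2), of f z] xz by simp
qed

lemma relation_eq_iff:
  assumes R: "relation C F G R" and S: "relation C F G S"
  shows "R = S \<longleftrightarrow> (\<forall>X. \<forall>x \<in> sec F X. \<forall>y \<in> sec G X. (x, y) \<in> R X \<longleftrightarrow> (x, y) \<in> S X)"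
proof
  assume *: "\<forall>X. \<forall>x \<in> sec F X. \<forall>y \<in> sec G X. (x, y) \<in> R X \<longleftrightarrow> (x, y) \<in> S X"
  have "(x, y) \<in> R X \<longleftrightarrow> (x, y) \<in> S X" for X x y
    using * relation_sec[OF R] relation_sec[OF S] by metis
  then show "R = S" by (intro ext set_eqI) (metis surj_pair)
qed auto

text \<open>If the pointwise composites already form a relation, no sheafification is left to do.
  This computes the composites whose intermediate element can be written down over the whole object,
  such as those with graphs and those on pairs of states.\<close>

lemma rcomp_eq_pointwise:
  assumes "presheaf C F" "presheaf C H" and Q: "relation C F H Q"
    and *: "\<And>X x z. x \<in> sec F X \<Longrightarrow> z \<in> sec H X \<Longrightarrow>
      (x, z) \<in> Q X \<longleftrightarrow> (\<exists>y. (x, y) \<in> R X \<and> (y, z) \<in> S X)"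
  shows "rcomp C F H R S = Q"
proof -
  have "(x, z) \<in> rcomp C F H R S X \<longleftrightarrow> (x, z) \<in> Q X" for x z X
    using rcomp_least[OF assms(1-3), of R S x z X] * relation_sec[OF Q] rcompI[OF assms(1,2)]
    by metis
  then show ?thesis by (intro ext set_eqI) (metis surj_pair)
qed

subsection \<open>Natural maps and their graphs\<close>

text \<open>Members of \<open>sheaf_mor\<close> must be undefined off their domain. Without that
  condition projections, reassociations and other lambda terms count as natural maps as they
  stand.\<close>

definition natural :: "('o, 'a, 'u) psh \<Rightarrow> ('o, 'a, 'v) psh \<Rightarrow> ('o \<Rightarrow> 'u \<Rightarrow> 'v) \<Rightarrow> bool" where
  "natural F G \<alpha> \<longleftrightarrow> (\<forall>X. \<forall>x \<in> sec F X. \<alpha> X x \<in> sec G X) \<and>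
     (\<forall>f \<in> Ar C. \<forall>x \<in> sec F (cd C f). res G f (\<alpha> (cd C f) x) = \<alpha> (dm C f) (res F f x))"

lemma natural_sec: "natural F G \<alpha> \<Longrightarrow> x \<in> sec F X \<Longrightarrow> \<alpha> X x \<in> sec G X"
  unfolding natural_def by blast

lemma natural_res:
  "natural F G \<alpha> \<Longrightarrow> f \<in> Ar C \<Longrightarrow> x \<in> sec F (cd C f) \<Longrightarrow>
    res G f (\<alpha> (cd C f) x) = \<alpha> (dm C f) (res F f x)"
  unfolding natural_def by blast

lemma sheaf_mor_natural: "presheaf C F \<Longrightarrow> \<alpha> \<in> sheaf_mor C F G \<Longrightarrow> natural F G \<alpha>"
  unfolding natural_def sheaf_mor_def using presheaf_Ob by (fastforce simp: PiE_iff)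

lemma natural_map_prod_id: "natural F G \<alpha> \<Longrightarrow>
    natural (prod_sheaf F S) (prod_sheaf G S) (\<lambda>X. map_prod (\<alpha> X) id)"
  unfolding natural_def by auto

text \<open>Equality of two values in \<open>G\<close> is local because \<open>G\<close> is
  separated. Together with intersections this yields the subsheaves cut out by equations between
  natural maps.\<close>

lemma subsheaf_equalizer:
  assumes F: "presheaf C F" and G: "sheaf C G" and a: "natural F G \<alpha>" and b: "natural F G \<beta>"
  shows "subsheaf C F (\<lambda>X. {x \<in> sec F X. \<alpha> X x = \<beta> X x})"
  unfolding subsheaf_def
proof (intro conjI allI ballI impI)
  show "res F f x \<in> {x \<in> sec F (dm C f). \<alpha> (dm C f) x = \<beta> (dm C f) x}"
    if "f \<in> Ar C" "x \<in> {x \<in> sec F (cd C f). \<alpha> (cd C f) x = \<beta> (cd C f) x}" for f x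
    using that presheaf_res[OF F, of f x] natural_res[OF a, of f x] natural_res[OF b, of f x] by simp
next
  fix X U x
  assume U: "X \<in> Ob C" "U \<in> Cov C X" and x: "x \<in> sec F X"
    and *: "\<forall>f\<in>U. res F f x \<in> {x \<in> sec F (dm C f). \<alpha> (dm C f) x = \<beta> (dm C f) x}"
  have "\<alpha> X x = \<beta> X x"
  proof (rule sheaf_separated[OF G U natural_sec[OF a x] natural_sec[OF b x]])
    fix f assume f: "f \<in> U"
    then show "res G f (\<alpha> X x) = res G f (\<beta> X x)"
      using * Cov_arrow[OF U f] natural_res[OF a] natural_res[OF b] x by force
  qed
  then show "x \<in> {x \<in> sec F X. \<alpha> X x = \<beta> X x}" using x by simp
qed auto

lemma subsheaf_vimage:
  assumes F: "presheaf C F" and a: "natural F G \<alpha>" and R: "subsheaf C G R"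
  shows "subsheaf C F (\<lambda>X. {x \<in> sec F X. \<alpha> X x \<in> R X})"
  unfolding subsheaf_def
proof (intro conjI allI ballI impI)
  show "res F f x \<in> {x \<in> sec F (dm C f). \<alpha> (dm C f) x \<in> R (dm C f)}"
    if "f \<in> Ar C" "x \<in> {x \<in> sec F (cd C f). \<alpha> (cd C f) x \<in> R (cd C f)}" for f x
    using that presheaf_res[OF F, of f x] natural_res[OF a, of f x]
      subsheaf_res[OF R, of f "\<alpha> (cd C f) x"] by simp
next
  fix X U x
  assume U: "X \<in> Ob C" "U \<in> Cov C X" and x: "x \<in> sec F X"
    and *: "\<forall>f\<in>U. res F f x \<in> {x \<in> sec F (dm C f). \<alpha> (dm C f) x \<in> R (dm C f)}"
  have "\<alpha> X x \<in> R X"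
  proof (rule subsheaf_local[OF R U natural_sec[OF a x]])
    fix f assume f: "f \<in> U"
    then show "res G f (\<alpha> X x) \<in> R (dm C f)"
      using * Cov_arrow[OF U f] natural_res[OF a] x by force
  qed
  then show "x \<in> {x \<in> sec F X. \<alpha> X x \<in> R X}" using x by simp
qed auto

lemma subsheaf_Int:
  assumes R: "subsheaf C F R" and S: "subsheaf C F S"
  shows "subsheaf C F (\<lambda>X. R X \<inter> S X)"
  unfolding subsheaf_def
proof (intro conjI allI ballI impI)
  show "x \<in> R X \<inter> S X"
    if "X \<in> Ob C" "U \<in> Cov C X" "x \<in> sec F X" "\<forall>f\<in>U. res F f x \<in> R (dm C f) \<inter> S (dm C f)" for X U x
    using subsheaf_local[OF R that(1-3)] subsheaf_local[OF S that(1-3)] that(4) by blast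
qed (use subsheaf_sec[OF R] subsheaf_res[OF R] subsheaf_res[OF S] in auto)

text \<open>On \<open>F \<times> G\<close> the graph is the equalizer of \<alpha> after the first
  projection with the second projection, so separatedness of the target makes it a subsheaf.\<close>

lemma relation_graph:
  assumes F: "presheaf C F" and G: "sheaf C G" and a: "natural F G \<alpha>"
  shows "relation C F G (graph F \<alpha>)"
proof -
  have "subsheaf C (prod_sheaf F G) (\<lambda>X. {x \<in> sec (prod_sheaf F G) X. \<alpha> X (fst x) = snd x})"
    by (rule subsheaf_equalizer[where G = G])
      (use F G a sheaf_presheaf in \<open>auto intro: presheaf_prod simp: natural_def\<close>)
  moreover have "(\<lambda>X. {x \<in> sec (prod_sheaf F G) X. \<alpha> X (fst x) = snd x}) = graph F \<alpha>"
    using natural_sec[OF a] by (auto simp: fun_eq_iff graph_def)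
  ultimately show ?thesis unfolding relation_def by simp
qed

lemma relation_rid: "sheaf C F \<Longrightarrow> relation C F F (rid F)"
proof -
  assume F: "sheaf C F"
  have "rid F = graph F (\<lambda>X x. x)" by (auto simp: fun_eq_iff rid_def graph_def)
  then show ?thesis using relation_graph[OF sheaf_presheaf[OF F] F, of "\<lambda>X x. x"] F
    by (simp add: natural_def)
qed

lemma relation_rprod:
  assumes R: "relation C F G R" and S: "relation C F' G' S"
  shows "relation C (prod_sheaf F F') (prod_sheaf G G') (rprod R S)"
proof (rule relationI)
  fix X U x y
  assume U: "X \<in> Ob C" "U \<in> Cov C X"
    and xy: "x \<in> sec (prod_sheaf F F') X" "y \<in> sec (prod_sheaf G G') X"
    and *: "\<And>f. f \<in> U \<Longrightarrow> f \<in> Ar C \<and> cd C f = X \<and>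
      (res (prod_sheaf F F') f x, res (prod_sheaf G G') f y) \<in> rprod R S (dm C f)"
  obtain x1 x2 y1 y2 where [simp]: "x = (x1, x2)" "y = (y1, y2)" by (metis surj_pair)
  have "(x1, y1) \<in> R X" by (rule relation_local[OF R U]) (use xy * in auto)
  moreover have "(x2, y2) \<in> S X" by (rule relation_local[OF S U]) (use xy * in auto)
  ultimately show "(x, y) \<in> rprod R S X" by simp
qed (use relation_sec[OF R] relation_sec[OF S] relation_res[OF R] relation_res[OF S] in
    \<open>auto simp: rprod_def\<close>)

lemma relation_point_rel:
  assumes F: "presheaf C F" and I: "subsheaf C F I"
  shows "relation C (one_sheaf C) F (point_rel I)"
proof (rule relationI)
  show "(x, y) \<in> point_rel I X" if "X \<in> Ob C" "U \<in> Cov C X" "x \<in> sec (one_sheaf C) X" "y \<in> sec F X"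
    "\<And>f. f \<in> U \<Longrightarrow> f \<in> Ar C \<and> cd C f = X \<and> (res (one_sheaf C) f x, res F f y) \<in> point_rel I (dm C f)"
  for X U x y
    using subsheaf_local[OF I that(1,2,4)] that(5) by auto
qed (use subsheaf_sec[OF I] subsheaf_res[OF I] in \<open>auto intro: presheaf_Ob[OF F subsheaf_sec[OF I]]\<close>)

lemma relation_char_rel:
  assumes F: "presheaf C F" and I: "subsheaf C F I"
  shows "relation C F (one_sheaf C) (char_rel I)"
proof (rule relationI)
  show "(x, y) \<in> char_rel I X" if "X \<in> Ob C" "U \<in> Cov C X" "x \<in> sec F X" "y \<in> sec (one_sheaf C) X"
    "\<And>f. f \<in> U \<Longrightarrow> f \<in> Ar C \<and> cd C f = X \<and> (res F f x, res (one_sheaf C) f y) \<in> char_rel I (dm C f)"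
  for X U x y
    using subsheaf_local[OF I that(1,2,3)] that(5) by auto
qed (use subsheaf_sec[OF I] subsheaf_res[OF I] in \<open>auto intro: presheaf_Ob[OF F subsheaf_sec[OF I]]\<close>)

lemma relation_vimage:
  assumes F: "presheaf C F" and H: "presheaf C H" and a: "natural F G \<alpha>" and R: "relation C G H R"
  shows "relation C F H (\<lambda>X. {(x, z). x \<in> sec F X \<and> (\<alpha> X x, z) \<in> R X})"
proof -
  have "subsheaf C (prod_sheaf F H)
      (\<lambda>X. {p \<in> sec (prod_sheaf F H) X. map_prod (\<alpha> X) id p \<in> R X})"
    by (rule subsheaf_vimage[OF presheaf_prod[OF F H] natural_map_prod_id[OF a]
          R[unfolded relation_def]])
  moreover have "(\<lambda>X. {p \<in> sec (prod_sheaf F H) X. map_prod (\<alpha> X) id p \<in> R X}) =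
      (\<lambda>X. {(x, z). x \<in> sec F X \<and> (\<alpha> X x, z) \<in> R X})"
    using relation_sec[OF R] by (auto simp: fun_eq_iff)
  ultimately show ?thesis unfolding relation_def by simp
qed

text \<open>The intermediate element is the value of the map, which exists globally. Precomposition
  with a map is therefore substitution.\<close>

lemma rcomp_graph:
  assumes F: "presheaf C F" and H: "presheaf C H" and a: "natural F G \<alpha>" and R: "relation C G H R"
  shows "rcomp C F H (graph F \<alpha>) R = (\<lambda>X. {(x, z). x \<in> sec F X \<and> (\<alpha> X x, z) \<in> R X})"
  by (rule rcomp_eq_pointwise[OF F H relation_vimage[OF assms]]) auto

subsection \<open>Monoids, actions and initial states\<close>

lemma monoid_objD:
  assumes "is_monoid_obj C W"
  shows "sheaf C (mcarrier W)"
    and "natural (prod_sheaf (mcarrier W) (mcarrier W)) (mcarrier W) (mmult W)"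
    and "natural (one_sheaf C) (mcarrier W) (mone W)"
  using assms sheaf_mor_natural presheaf_prod presheaf_one sheaf_presheaf
  unfolding is_monoid_obj_def Let_def by blast+

lemma natural_swap: "natural (prod_sheaf (prod_sheaf V V') S) (prod_sheaf V' (prod_sheaf V S))
    (\<lambda>X ((u, v), s). (v, (u, s)))"
  by (auto simp: natural_def)

lemma natural_assoc: "natural (prod_sheaf (prod_sheaf F G) H) (prod_sheaf F (prod_sheaf G H))
    (\<lambda>X ((x, y), z). (x, (y, z)))"
  by (auto simp: natural_def)

lemma rcomp_rprod_graph:
  assumes "presheaf C F" "presheaf C S" "presheaf C H" "natural F G \<alpha>"
    "relation C (prod_sheaf G S) H R"
  shows "rcomp C (prod_sheaf F S) H (rprod (graph F \<alpha>) (rid S)) R =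
    (\<lambda>X. {((x, s), z). x \<in> sec F X \<and> s \<in> sec S X \<and> ((\<alpha> X x, s), z) \<in> R X})"
  unfolding rprod_graph_rid
  by (subst rcomp_graph[OF presheaf_prod[OF assms(1,2)] assms(3) natural_map_prod_id[OF assms(4)] assms(5)])
    (auto simp: fun_eq_iff)

text \<open>In the unit and multiplication laws every composite with a map becomes substitution.
  What stays a genuine composite is \<rho> followed by \<rho>, where the middle state exists only
  locally. The clause about letters is left as an equation.\<close>

lemma induced_action_iff:
  assumes W: "is_monoid_obj C W" and S: "sheaf C (states N)" and \<rho>: "relation C (prod_sheaf (mcarrier W) (states N)) (states N) \<rho>"
  shows "induced_action C A W \<iota> N \<rho> \<longleftrightarrow>
    (\<forall>X. \<forall>s \<in> sec (states N) X. \<forall>t \<in> sec (states N) X. ((mone W X (), s), t) \<in> \<rho> X \<longleftrightarrow> s = t) \<and>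
    (\<forall>X. \<forall>u \<in> sec (mcarrier W) X. \<forall>v \<in> sec (mcarrier W) X.
       \<forall>s \<in> sec (states N) X. \<forall>t \<in> sec (states N) X.
       ((mmult W X (u, v), s), t) \<in> \<rho> X \<longleftrightarrow>
       ((v, (u, s)), t) \<in> rcomp C (prod_sheaf (mcarrier W) (prod_sheaf (mcarrier W) (states N))) (states N)
          (rprod (rid (mcarrier W)) \<rho>) \<rho> X) \<and>
    rcomp C (prod_sheaf A (states N)) (states N) (rprod (graph A \<iota>) (rid (states N))) \<rho> = trans N"
    (is "_ \<longleftrightarrow> ?unit \<and> ?mult \<and> ?tr")
proof -
  let ?V = "mcarrier W" and ?S = "states N"
  note V = monoid_objD[OF W]
  note PV = sheaf_presheaf[OF V(1)] and PS = sheaf_presheaf[OF S]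
  note PVV = presheaf_prod[OF PV PV] and P1 = presheaf_prod[OF presheaf_one PS]
  have D: "relation C (prod_sheaf ?V (prod_sheaf ?V ?S)) ?S
      (rcomp C (prod_sheaf ?V (prod_sheaf ?V ?S)) ?S (rprod (rid ?V) \<rho>) \<rho>)"
    by (rule relation_rcomp[OF presheaf_prod[OF PV presheaf_prod[OF PV PS]] PS
          relation_rprod[OF relation_rid[OF V(1)] \<rho>] \<rho>])
  have u: "relation C (prod_sheaf (one_sheaf C) ?S) ?S
      (rcomp C (prod_sheaf (one_sheaf C) ?S) ?S (rprod (graph (one_sheaf C) (mone W)) (rid ?S)) \<rho>)"
    by (rule relation_rcomp[OF P1 PS relation_rprod[OF relation_graph[OF presheaf_one V(1,3)]
          relation_rid[OF S]] \<rho>])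
  have g: "relation C (prod_sheaf (one_sheaf C) ?S) ?S (graph (prod_sheaf (one_sheaf C) ?S) (\<lambda>X. snd))"
    by (rule relation_graph[OF P1 S]) (auto simp: natural_def)
  have m: "relation C (prod_sheaf (prod_sheaf ?V ?V) ?S) ?S (rcomp C (prod_sheaf (prod_sheaf ?V ?V) ?S) ?S
        (rprod (graph (prod_sheaf ?V ?V) (mmult W)) (rid ?S)) \<rho>)"
    by (rule relation_rcomp[OF presheaf_prod[OF PVV PS] PS relation_rprod[OF
          relation_graph[OF PVV V(1,2)] relation_rid[OF S]] \<rho>])
  have m': "relation C (prod_sheaf (prod_sheaf ?V ?V) ?S) ?S (rcomp C (prod_sheaf (prod_sheaf ?V ?V) ?S) ?S
        (graph (prod_sheaf (prod_sheaf ?V ?V) ?S) (\<lambda>X ((u, v), s). (v, (u, s))))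
        (rcomp C (prod_sheaf ?V (prod_sheaf ?V ?S)) ?S (rprod (rid ?V) \<rho>) \<rho>))"
    unfolding rcomp_graph[OF presheaf_prod[OF PVV PS] PS natural_swap D]
    by (rule relation_vimage[OF presheaf_prod[OF PVV PS] PS natural_swap D])
  have "rcomp C (prod_sheaf (one_sheaf C) ?S) ?S (rprod (graph (one_sheaf C) (mone W)) (rid ?S)) \<rho> =
      graph (prod_sheaf (one_sheaf C) ?S) (\<lambda>X. snd) \<longleftrightarrow> ?unit"
    unfolding relation_eq_iff[OF u g]
    unfolding rcomp_rprod_graph[OF presheaf_one PS PS V(3) \<rho>]
    using presheaf_Ob[OF PS] by (auto simp: Ball_def)
  moreover have "rcomp C (prod_sheaf (prod_sheaf ?V ?V) ?S) ?S
        (rprod (graph (prod_sheaf ?V ?V) (mmult W)) (rid ?S)) \<rho> =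
      rcomp C (prod_sheaf (prod_sheaf ?V ?V) ?S) ?S
        (graph (prod_sheaf (prod_sheaf ?V ?V) ?S) (\<lambda>X ((u, v), s). (v, (u, s))))
        (rcomp C (prod_sheaf ?V (prod_sheaf ?V ?S)) ?S (rprod (rid ?V) \<rho>) \<rho>) \<longleftrightarrow> ?mult"
    unfolding relation_eq_iff[OF m m']
    unfolding rcomp_rprod_graph[OF PVV PS PS V(2) \<rho>]
      rcomp_graph[OF presheaf_prod[OF PVV PS] PS natural_swap D]
    by (simp add: Ball_def) blast
  ultimately show ?thesis
    unfolding induced_action_def Let_def using \<rho> by simp
qed

lemma rcomp_initial:
  assumes V: "sheaf C V" and S: "presheaf C S" and I: "subsheaf C S I"
  shows "rcomp C V (prod_sheaf V S) (graph V (\<lambda>X w. (w, ()))) (rprod (rid V) (point_rel I)) =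
    (\<lambda>X. {(w, (w', s)). w' = w \<and> w \<in> sec V X \<and> s \<in> I X})" (is "?l = _")
proof -
  note PV = sheaf_presheaf[OF V]
  have "natural V (prod_sheaf V (one_sheaf C)) (\<lambda>X w. (w, ()))"
    using presheaf_Ob[OF PV] by (auto simp: natural_def)
  then have "?l = (\<lambda>X. {(w, z). w \<in> sec V X \<and> ((w, ()), z) \<in> rprod (rid V) (point_rel I) X})"
    by (rule rcomp_graph[OF PV presheaf_prod[OF PV S] _
          relation_rprod[OF relation_rid[OF V] relation_point_rel[OF S I]]])
  then show ?thesis by (auto simp: fun_eq_iff)
qed

text \<open>Read backwards, \<open>rcomp_initial\<close> exhibits this family as a composite of
  relations, and composites are subsheaves.\<close>

lemma relation_initial:
  assumes V: "sheaf C V" and S: "presheaf C S" and I: "subsheaf C S I"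
  shows "relation C V (prod_sheaf V S) (\<lambda>X. {(w, (w', s)). w' = w \<and> w \<in> sec V X \<and> s \<in> I X})"
  unfolding rcomp_initial[OF assms, symmetric]
proof (rule relation_rcomp)
  note PV = sheaf_presheaf[OF V]
  show "relation C V (prod_sheaf V (one_sheaf C)) (graph V (\<lambda>X w. (w, ())))"
    using presheaf_Ob[OF PV] V PV sheaf_separated[OF V]
    by (intro relationI) (auto dest: presheaf_res[OF PV])
qed (use V S I sheaf_presheaf in \<open>auto intro: presheaf_prod relation_rprod relation_rid relation_point_rel\<close>)

lemma recognized_by_nda_iff:
  fixes N :: "('o, 'a, 'u, 'v) nda"
  assumes W: "is_monoid_obj C W" and N: "is_nda C A N" and L: "subsheaf C (mcarrier W) L"
  shows "recognized_by_nda C A W \<iota> N L \<longleftrightarrow> (\<exists>\<rho>. induced_action C A W \<iota> N \<rho> \<and>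
    char_rel L = rcomp C (mcarrier W) (one_sheaf C)
      (rcomp C (mcarrier W) (states N)
        (\<lambda>X. {(w, (w', s)). w' = w \<and> w \<in> sec (mcarrier W) X \<and> s \<in> initial N X}) \<rho>)
      (char_rel (final N)))"
  unfolding recognized_by_nda_def Let_def
  using L N by (simp add: rcomp_initial monoid_objD[OF W] sheaf_presheaf is_nda_def)

text \<open>Closure under products holds only up to isomorphism. The isomorphism is used through its
  two coordinates: they determine a section of \<open>P\<close>, and every pair of sections of
  \<open>S\<close> over an object occurs.\<close>

lemma sheaf_iso_prodE:
  assumes P: "presheaf C P" and iso: "sheaf_iso C P (prod_sheaf S S)"
  obtains a b where "natural P S a" "natural P S b"
    "\<And>X s t. X \<in> Ob C \<Longrightarrow> s \<in> sec S X \<Longrightarrow> t \<in> sec S X \<Longrightarrow> \<exists>p \<in> sec P X. a X p = s \<and> b X p = t"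
    "\<And>X p q. p \<in> sec P X \<Longrightarrow> q \<in> sec P X \<Longrightarrow> a X p = a X q \<Longrightarrow> b X p = b X q \<Longrightarrow> p = q"
proof -
  obtain \<alpha> where \<alpha>: "\<alpha> \<in> sheaf_mor C P (prod_sheaf S S)"
    and bij: "\<And>X. X \<in> Ob C \<Longrightarrow> bij_betw (\<alpha> X) (sec P X) (sec (prod_sheaf S S) X)"
    using iso unfolding sheaf_iso_def by blast
  note n = sheaf_mor_natural[OF P \<alpha>]
  show thesis
  proof (rule that[of "\<lambda>X p. fst (\<alpha> X p)" "\<lambda>X p. snd (\<alpha> X p)"])
    show "natural P S (\<lambda>X p. fst (\<alpha> X p))" "natural P S (\<lambda>X p. snd (\<alpha> X p))"
      using natural_sec[OF n] natural_res[OF n, symmetric]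
      by (auto simp: natural_def mem_Times_iff)
    show "\<exists>p\<in>sec P X. fst (\<alpha> X p) = s \<and> snd (\<alpha> X p) = t"
      if "X \<in> Ob C" "s \<in> sec S X" "t \<in> sec S X" for X s t
    proof -
      have "(s, t) \<in> \<alpha> X ` sec P X" using bij[OF that(1)] that by (simp add: bij_betw_def)
      then show ?thesis by (auto simp: image_iff) (metis fst_conv snd_conv)
    qed
    show "p = q" if "p \<in> sec P X" "q \<in> sec P X" "fst (\<alpha> X p) = fst (\<alpha> X q)"
      "snd (\<alpha> X p) = snd (\<alpha> X q)" for X p q
      using bij[OF presheaf_Ob[OF P that(1)]] that
      by (meson bij_betw_def inj_on_def prod_eq_iff)
  qed
qed

subsection \<open>From automata to promonoids\<close>

text \<open>A section of \<open>P\<close> is best read as an arrow from the state \<open>a\<close>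
  to the state \<open>b\<close>, with multiplication composing arrows. Witnesses for the promonoid
  laws are built from coordinates over the whole object, so these laws are checked pointwise; local
  existence enters through the action \<rho> and the description of \<open>L\<close>.\<close>

lemma recognized_by_nda_imp_promonoid:
  fixes N :: "('o, 'a, 'u, 'v) nda" and P :: "('o, 'a, 'w) psh"
  assumes W: "is_monoid_obj C W" and N: "is_nda C A N"
    and P: "sheaf C P" and iso: "sheaf_iso C P (prod_sheaf (states N) (states N))"
    and rec: "recognized_by_nda C A W \<iota> N L"
  shows "\<exists>Q. is_promonoid C Q \<and> pcarrier Q = P \<and> recognized_by_promonoid C W Q L"
proof -
  define S where "S = states N"
  define V where "V = mcarrier W"
  define m where "m = mmult W"
  define e where "e = mone W"
  define Fin where "Fin = final N"
  define I where "I = initial N"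
  have S: "sheaf C S" and I: "subsheaf C S I" and Fin: "subsheaf C S Fin"
    using N by (auto simp: is_nda_def S_def I_def Fin_def)
  have V: "sheaf C V" and m: "natural (prod_sheaf V V) V m" and e: "natural (one_sheaf C) V e"
    using monoid_objD[OF W] by (simp_all add: V_def m_def e_def)
  note PV = sheaf_presheaf[OF V] and PS = sheaf_presheaf[OF S] and PP = sheaf_presheaf[OF P]
  note PVV = presheaf_prod[OF PV PV] and PPP = presheaf_prod[OF PP PP]
  have L: "subsheaf C V L" using rec by (simp add: recognized_by_nda_def Let_def V_def)
  obtain \<rho> where ind: "induced_action C A W \<iota> N \<rho>"
    and L_eq: "char_rel L = rcomp C V (one_sheaf C)
      (rcomp C V S (\<lambda>X. {(w, (w', s)). w' = w \<and> w \<in> sec V X \<and> s \<in> I X}) \<rho>) (char_rel Fin)"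
    using rec recognized_by_nda_iff[OF W N L[unfolded V_def]]
    unfolding S_def V_def I_def Fin_def by blast
  have \<rho>: "relation C (prod_sheaf V S) S \<rho>"
    using ind by (simp add: induced_action_def Let_def S_def V_def)
  note iff = induced_action_iff[of W N \<rho> A \<iota>, folded S_def V_def m_def e_def, OF W S \<rho>]
  have \<rho>_unit: "((e X (), s), t) \<in> \<rho> X \<longleftrightarrow> s = t" if "s \<in> sec S X" "t \<in> sec S X" for X s t
    using iff ind that by blast
  have \<rho>_mult: "((m X (u, v), s), t) \<in> \<rho> X \<longleftrightarrow>
      ((v, (u, s)), t) \<in> rcomp C (prod_sheaf V (prod_sheaf V S)) S (rprod (rid V) \<rho>) \<rho> X"
    if "u \<in> sec V X" "v \<in> sec V X" "s \<in> sec S X" "t \<in> sec S X" for X u v s t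
    using iff ind that by blast
  obtain a b where a: "natural P S a" and b: "natural P S b"
    and pair: "\<And>X s t. X \<in> Ob C \<Longrightarrow> s \<in> sec S X \<Longrightarrow> t \<in> sec S X \<Longrightarrow>
      \<exists>p \<in> sec P X. a X p = s \<and> b X p = t"
    and pair_eq: "\<And>X p q. p \<in> sec P X \<Longrightarrow> q \<in> sec P X \<Longrightarrow> a X p = a X q \<Longrightarrow> b X p = b X q \<Longrightarrow> p = q"
    by (rule sheaf_iso_prodE[OF PP iso[folded S_def]]) blast
  note a_sec = natural_sec[OF a] and b_sec = natural_sec[OF b]
  have a_res: "a (dm C f) (res P f p) = res S f (a X p)"
    and b_res: "b (dm C f) (res P f p) = res S f (b X p)"
    if "f \<in> Ar C" "cd C f = X" "p \<in> sec P X" for f X p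
    using that natural_res[OF a] natural_res[OF b] by auto

  define \<mu> where "\<mu> = (\<lambda>X. {((p, q), r). p \<in> sec P X \<and> q \<in> sec P X \<and> r \<in> sec P X \<and>
    b X p = a X q \<and> a X r = a X p \<and> b X r = b X q})"
  have \<mu>_iff: "((p, q), r) \<in> \<mu> X \<longleftrightarrow> p \<in> sec P X \<and> q \<in> sec P X \<and> r \<in> sec P X \<and>
    b X p = a X q \<and> a X r = a X p \<and> b X r = b X q" for p q r X
    by (simp add: \<mu>_def)
  have \<mu>: "relation C (prod_sheaf P P) P \<mu>"
  proof -
    \<comment> \<open>Three equations between coordinates cut out an intersection of three
      equalizers.\<close>
    let ?E = "\<lambda>\<alpha> \<beta> X. {w \<in> sec (prod_sheaf (prod_sheaf P P) P) X. \<alpha> X w = \<beta> X w}"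
    have "\<mu> = (\<lambda>X. ?E (\<lambda>X w. b X (fst (fst w))) (\<lambda>X w. a X (snd (fst w))) X \<inter>
       (?E (\<lambda>X w. a X (snd w)) (\<lambda>X w. a X (fst (fst w))) X \<inter>
        ?E (\<lambda>X w. b X (snd w)) (\<lambda>X w. b X (snd (fst w))) X))"
      by (auto simp: \<mu>_def fun_eq_iff)
    then show ?thesis unfolding relation_def
      by (simp only:) (intro subsheaf_Int subsheaf_equalizer[OF presheaf_prod[OF PPP PP] S];
          use a b in \<open>auto simp: natural_def\<close>)
  qed
  define \<eta> where "\<eta> = (\<lambda>X. {p \<in> sec P X. a X p = b X p})"
  have \<eta>: "subsheaf C P \<eta>"
    unfolding \<eta>_def by (rule subsheaf_equalizer[OF PP S a b])
  let ?Q = "\<lparr>pcarrier = P, pmult = \<mu>, punit = \<eta>\<rparr>"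

  \<comment> \<open>The composite of three consecutive arrows. Both bracketings turn out equal to it
    up to reassociation, which gives associativity.\<close>
  define \<mu>3 where "\<mu>3 = (\<lambda>X. {((p, (q, r)), t). p \<in> sec P X \<and> q \<in> sec P X \<and> r \<in> sec P X \<and> t \<in> sec P X \<and>
    b X p = a X q \<and> b X q = a X r \<and> a X t = a X p \<and> b X t = b X r})"
  have \<mu>3: "relation C (prod_sheaf P (prod_sheaf P P)) P \<mu>3"
  proof -
    let ?E = "\<lambda>\<alpha> \<beta> X. {w \<in> sec (prod_sheaf (prod_sheaf P (prod_sheaf P P)) P) X. \<alpha> X w = \<beta> X w}"
    have "\<mu>3 = (\<lambda>X. ?E (\<lambda>X w. b X (fst (fst w))) (\<lambda>X w. a X (fst (snd (fst w)))) X \<inter>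
       (?E (\<lambda>X w. b X (fst (snd (fst w)))) (\<lambda>X w. a X (snd (snd (fst w)))) X \<inter>
       (?E (\<lambda>X w. a X (snd w)) (\<lambda>X w. a X (fst (fst w))) X \<inter>
        ?E (\<lambda>X w. b X (snd w)) (\<lambda>X w. b X (snd (snd (fst w)))) X)))"
      by (auto simp: \<mu>3_def fun_eq_iff)
    then show ?thesis unfolding relation_def
      by (simp only:) (intro subsheaf_Int
          subsheaf_equalizer[OF presheaf_prod[OF presheaf_prod[OF PP PPP] PP] S];
          use a b in \<open>auto simp: natural_def\<close>)
  qed
  have right: "rcomp C (prod_sheaf P (prod_sheaf P P)) P (rprod (rid P) \<mu>) \<mu> = \<mu>3"
  proof (rule rcomp_eq_pointwise[OF presheaf_prod[OF PP PPP] PP \<mu>3])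
    fix X x t assume x: "x \<in> sec (prod_sheaf P (prod_sheaf P P)) X" and t: "t \<in> sec P X"
    obtain p q r where [simp]: "x = (p, (q, r))" by (metis surj_pair)
    have X: "X \<in> Ob C" and pqr: "p \<in> sec P X" "q \<in> sec P X" "r \<in> sec P X"
      using x t presheaf_Ob[OF PP] by auto
    \<comment> \<open>The intermediate element is the product of \<open>q\<close> and
      \<open>r\<close>, the arrow from \<open>a X q\<close> to \<open>b X r\<close>.\<close>
    show "(x, t) \<in> \<mu>3 X \<longleftrightarrow> (\<exists>y. (x, y) \<in> rprod (rid P) \<mu> X \<and> (y, t) \<in> \<mu> X)"
      using pair[OF X a_sec[OF pqr(2)] b_sec[OF pqr(3)]] pqr t
      by (fastforce simp: \<mu>3_def \<mu>_iff)
  qed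
  have left: "rcomp C (prod_sheaf (prod_sheaf P P) P) P (rprod \<mu> (rid P)) \<mu> =
      (\<lambda>X. {(x, z). x \<in> sec (prod_sheaf (prod_sheaf P P) P) X \<and> ((\<lambda>((x, y), z). (x, (y, z))) x, z) \<in> \<mu>3 X})"
  proof (rule rcomp_eq_pointwise[OF presheaf_prod[OF PPP PP] PP
        relation_vimage[OF presheaf_prod[OF PPP PP] PP natural_assoc \<mu>3]])
    fix X x t assume x: "x \<in> sec (prod_sheaf (prod_sheaf P P) P) X" and t: "t \<in> sec P X"
    obtain p q r where [simp]: "x = ((p, q), r)" by (metis surj_pair)
    have X: "X \<in> Ob C" and pqr: "p \<in> sec P X" "q \<in> sec P X" "r \<in> sec P X"
      using x t presheaf_Ob[OF PP] by auto
    show "(x, t) \<in> {(x, z). x \<in> sec (prod_sheaf (prod_sheaf P P) P) X \<and>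
        ((\<lambda>((x, y), z). (x, (y, z))) x, z) \<in> \<mu>3 X} \<longleftrightarrow>
      (\<exists>y. (x, y) \<in> rprod \<mu> (rid P) X \<and> (y, t) \<in> \<mu> X)"
      using pair[OF X a_sec[OF pqr(1)] b_sec[OF pqr(2)]] pqr t
      by (fastforce simp: \<mu>3_def \<mu>_iff)
  qed
  have unit1: "rcomp C (prod_sheaf (one_sheaf C) P) P (rprod (point_rel \<eta>) (rid P)) \<mu> =
      graph (prod_sheaf (one_sheaf C) P) (\<lambda>X. snd)"
  proof (rule rcomp_eq_pointwise[OF presheaf_prod[OF presheaf_one PP] PP
        relation_graph[OF presheaf_prod[OF presheaf_one PP] P]])
    fix X x t assume x: "x \<in> sec (prod_sheaf (one_sheaf C) P) X" and t: "t \<in> sec P X"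
    obtain p where [simp]: "x = ((), p)" using x by (cases x) auto
    have X: "X \<in> Ob C" and p: "p \<in> sec P X"
      using x t presheaf_Ob[OF PP] by auto
    \<comment> \<open>The left unit for \<open>p\<close> is the identity arrow at its source, the
      pair of \<open>a X p\<close> with itself; for the right unit law it is the one at the target.
      The product has the coordinates of \<open>p\<close>, so \<open>pair_eq\<close> identifies it
      with \<open>p\<close>.\<close>
    show "(x, t) \<in> graph (prod_sheaf (one_sheaf C) P) (\<lambda>X. snd) X \<longleftrightarrow>
      (\<exists>y. (x, y) \<in> rprod (point_rel \<eta>) (rid P) X \<and> (y, t) \<in> \<mu> X)"
      using pair[OF X a_sec[OF p] a_sec[OF p]] pair_eq[of t X p] p t X
      by (auto simp: \<mu>_iff \<eta>_def)
  qed (auto simp: natural_def)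
  have unit2: "rcomp C (prod_sheaf P (one_sheaf C)) P (rprod (rid P) (point_rel \<eta>)) \<mu> =
      graph (prod_sheaf P (one_sheaf C)) (\<lambda>X. fst)"
  proof (rule rcomp_eq_pointwise[OF presheaf_prod[OF PP presheaf_one] PP
        relation_graph[OF presheaf_prod[OF PP presheaf_one] P]])
    fix X x t assume x: "x \<in> sec (prod_sheaf P (one_sheaf C)) X" and t: "t \<in> sec P X"
    obtain p where [simp]: "x = (p, ())" using x by (cases x) auto
    have X: "X \<in> Ob C" and p: "p \<in> sec P X"
      using x t presheaf_Ob[OF PP] by auto
    show "(x, t) \<in> graph (prod_sheaf P (one_sheaf C)) (\<lambda>X. fst) X \<longleftrightarrow>
      (\<exists>y. (x, y) \<in> rprod (rid P) (point_rel \<eta>) X \<and> (y, t) \<in> \<mu> X)"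
      using pair[OF X b_sec[OF p] b_sec[OF p]] pair_eq[of t X p] p t X
      by (auto simp: \<mu>_iff \<eta>_def)
  qed (auto simp: natural_def)
  have Q: "is_promonoid C ?Q"
    unfolding is_promonoid_def Let_def
    using P \<mu> \<eta> unit1 unit2
    by (simp add: left right rcomp_graph[OF presheaf_prod[OF PPP PP] PP natural_assoc \<mu>3])

  define h where "h = (\<lambda>X. {(w, p). p \<in> sec P X \<and> ((w, a X p), b X p) \<in> \<rho> X})"
  have h_iff: "(w, p) \<in> h X \<longleftrightarrow> p \<in> sec P X \<and> ((w, a X p), b X p) \<in> \<rho> X" for w p X
    by (simp add: h_def)
  have h: "relation C V P h"
  proof -
    have "h = (\<lambda>X. {w \<in> sec (prod_sheaf V P) X. ((fst w, a X (snd w)), b X (snd w)) \<in> \<rho> X})"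
      using relation_sec[OF \<rho>] by (fastforce simp: h_def fun_eq_iff)
    moreover have "natural (prod_sheaf V P) (prod_sheaf (prod_sheaf V S) S)
        (\<lambda>X w. ((fst w, a X (snd w)), b X (snd w)))"
      using a b by (auto simp: natural_def)
    ultimately show ?thesis
      using subsheaf_vimage[OF presheaf_prod[OF PV PP] _ \<rho>[unfolded relation_def]]
      by (simp add: relation_def)
  qed
  have graph_h: "rcomp C (prod_sheaf V V) P (graph (prod_sheaf V V) m) h =
      (\<lambda>X. {(x, z). x \<in> sec (prod_sheaf V V) X \<and> (m X x, z) \<in> h X})"
    by (rule rcomp_graph[OF PVV PP m h])
  have h_mult: "rcomp C (prod_sheaf V V) P (graph (prod_sheaf V V) m) h =
      rcomp C (prod_sheaf V V) P (rprod h h) \<mu>"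
  proof -
    have hh: "relation C (prod_sheaf V V) P (rcomp C (prod_sheaf V V) P (rprod h h) \<mu>)"
      by (rule relation_rcomp[OF PVV PP relation_rprod[OF h h] \<mu>])
    have hm: "relation C (prod_sheaf V V) P (\<lambda>X. {(x, z). x \<in> sec (prod_sheaf V V) X \<and> (m X x, z) \<in> h X})"
      by (rule relation_vimage[OF PVV PP m h])
    \<comment> \<open>The action law yields, on a cover, a middle state \<open>s\<close> between
      reading \<open>u\<close> and reading \<open>v\<close>. There the arrow \<open>p\<close> splits
      as \<open>p1\<close> from its source to \<open>s\<close> followed by \<open>p2\<close> from
      \<open>s\<close> to its target.\<close>
    have 1: "((u, v), p) \<in> rcomp C (prod_sheaf V V) P (rprod h h) \<mu> X"
      if u: "u \<in> sec V X" and v: "v \<in> sec V X" and muv: "(m X (u, v), p) \<in> h X" for u v p X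
    proof -
      have p: "p \<in> sec P X" and "((m X (u, v), a X p), b X p) \<in> \<rho> X" using muv by (auto simp: h_iff)
      then have "((v, (u, a X p)), b X p) \<in> rcomp C (prod_sheaf V (prod_sheaf V S)) S (rprod (rid V) \<rho>) \<rho> X"
        using \<rho>_mult[OF u v a_sec[OF p] b_sec[OF p]] by simp
      then show ?thesis
      proof (rule rcompE[OF _ hh[unfolded relation_def]])
        show "((u, v), p) \<in> sec (prod_sheaf (prod_sheaf V V) P) X" using u v p by simp
        fix f y assume f: "f \<in> Ar C" "cd C f = X"
          and "(res (prod_sheaf V (prod_sheaf V S)) f (v, (u, a X p)), y) \<in> rprod (rid V) \<rho> (dm C f)"
          and "(y, res S f (b X p)) \<in> \<rho> (dm C f)"
        then obtain s where y: "((res V f u, a (dm C f) (res P f p)), s) \<in> \<rho> (dm C f)"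
          "((res V f v, s), b (dm C f) (res P f p)) \<in> \<rho> (dm C f)"
          using a_res[OF f p] b_res[OF f p] by (cases y) (auto simp: rprod_def)
        have p': "res P f p \<in> sec P (dm C f)" using presheaf_res[OF PP] f p by auto
        have s: "s \<in> sec S (dm C f)" using relation_sec[OF \<rho> y(1)] by simp
        obtain p1 where p1: "p1 \<in> sec P (dm C f)" "a (dm C f) p1 = a (dm C f) (res P f p)" "b (dm C f) p1 = s"
          using pair[OF dm_Ob[OF f(1)] a_sec[OF p'] s] by blast
        obtain p2 where p2: "p2 \<in> sec P (dm C f)" "a (dm C f) p2 = s" "b (dm C f) p2 = b (dm C f) (res P f p)"
          using pair[OF dm_Ob[OF f(1)] s b_sec[OF p']] by blast
        have "((res V f u, res V f v), res P f p) \<in> rcomp C (prod_sheaf V V) P (rprod h h) \<mu> (dm C f)"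
          by (rule rcompI[where y = "(p1, p2)", OF PVV PP])
            (use p1 p2 p' y presheaf_res[OF PV f(1)] f u v in \<open>auto simp: h_iff \<mu>_iff\<close>)
        then show "res (prod_sheaf (prod_sheaf V V) P) f ((u, v), p)
            \<in> rcomp C (prod_sheaf V V) P (rprod h h) \<mu> (dm C f)" by simp
      qed
    qed
    \<comment> \<open>Composable factors bring their middle state with them: \<open>b X p1\<close>
      is the witness for the action law, with no further restriction.\<close>
    have 2: "(x, p) \<in> {(x, z). x \<in> sec (prod_sheaf V V) X \<and> (m X x, z) \<in> h X}"
      if "(x, p) \<in> rcomp C (prod_sheaf V V) P (rprod h h) \<mu> X" for x p X
    proof (rule rcomp_least[OF PVV PP hm _ that])
      fix X x y p assume "(x, y) \<in> rprod h h X" "(y, p) \<in> \<mu> X" and p: "p \<in> sec P X"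
      then obtain u v p1 p2 where x: "x = (u, v)" and h1: "(u, p1) \<in> h X" and h2: "(v, p2) \<in> h X"
        and \<mu>p: "((p1, p2), p) \<in> \<mu> X" by (auto simp: rprod_def)
      have u: "u \<in> sec V X" and v: "v \<in> sec V X" using h1 h2 relation_sec[OF h] by auto
      have "((v, (u, a X p)), b X p) \<in> rcomp C (prod_sheaf V (prod_sheaf V S)) S (rprod (rid V) \<rho>) \<rho> X"
        by (rule rcompI[where y = "(v, b X p1)", OF presheaf_prod[OF PV presheaf_prod[OF PV PS]] PS])
          (use u v h1 h2 \<mu>p a_sec b_sec in \<open>auto simp: h_iff \<mu>_iff\<close>)
      then show "(x, p) \<in> {(x, z). x \<in> sec (prod_sheaf V V) X \<and> (m X x, z) \<in> h X}"
        using \<rho>_mult[OF u v a_sec[OF p] b_sec[OF p]] u v p by (simp add: x h_iff)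
    qed
    show ?thesis
      unfolding graph_h relation_eq_iff[OF hm hh]
    proof (intro allI ballI)
      fix X x p
      show "(x, p) \<in> {(x, z). x \<in> sec (prod_sheaf V V) X \<and> (m X x, z) \<in> h X} \<longleftrightarrow>
          (x, p) \<in> rcomp C (prod_sheaf V V) P (rprod h h) \<mu> X"
        using 1[of "fst x" X "snd x" p] 2[of x p X] by (cases x) auto
    qed
  qed
  have one_graph: "point_rel (\<lambda>X. e X ` sec (one_sheaf C) X) = graph (one_sheaf C) e"
    by (auto simp: fun_eq_iff point_rel_def graph_def)
  have h_unit: "rcomp C (one_sheaf C) P (point_rel (\<lambda>X. e X ` sec (one_sheaf C) X)) h = point_rel \<eta>"
    unfolding one_graph rcomp_graph[OF presheaf_one PP e h]
  proof (intro ext set_eqI)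
    fix X and z :: "unit \<times> 'w"
    obtain p where [simp]: "z = ((), p)" by (cases z) auto
    show "z \<in> {(x, z). x \<in> sec (one_sheaf C) X \<and> (e X x, z) \<in> h X} \<longleftrightarrow> z \<in> point_rel \<eta> X"
      using \<rho>_unit[OF a_sec b_sec, of p X p] presheaf_Ob[OF PP, of p X] by (auto simp: h_iff \<eta>_def)
  qed
  have hom: "promonoid_hom C (monoid_promonoid C W) ?Q h"
    unfolding promonoid_hom_def monoid_promonoid_def Let_def
    using h h_mult h_unit by (simp add: V_def m_def e_def)

  \<comment> \<open>Arrows from an initial to a final state: the two existentials over end states in
    the language of the automaton become a single one over arrows.\<close>
  define G where "G = (\<lambda>X. {p \<in> sec P X. a X p \<in> I X \<and> b X p \<in> Fin X})"
  have G: "subsheaf C P G"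
  proof -
    have "G = (\<lambda>X. {p \<in> sec P X. a X p \<in> I X} \<inter> {p \<in> sec P X. b X p \<in> Fin X})"
      by (auto simp: G_def)
    then show ?thesis
      using subsheaf_Int[OF subsheaf_vimage[OF PP a I] subsheaf_vimage[OF PP b Fin]] by simp
  qed
  let ?J = "\<lambda>X. {(w, (w', s)). w' = w \<and> w \<in> sec V X \<and> s \<in> I X}"
  note J = relation_initial[OF V PS I]
  have \<rho>J: "relation C V S (rcomp C V S ?J \<rho>)"
    by (rule relation_rcomp[OF PV PS J \<rho>])
  have lhs: "relation C V (one_sheaf C) (rcomp C V (one_sheaf C) (rcomp C V S ?J \<rho>) (char_rel Fin))"
    by (rule relation_rcomp[OF PV presheaf_one \<rho>J relation_char_rel[OF PS Fin]])
  have rhs: "relation C V (one_sheaf C) (rcomp C V (one_sheaf C) h (char_rel G))"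
    by (rule relation_rcomp[OF PV presheaf_one h relation_char_rel[OF PP G]])
  have "(w, z) \<in> rcomp C V (one_sheaf C) h (char_rel G) X"
    if "(w, z) \<in> rcomp C V (one_sheaf C) (rcomp C V S ?J \<rho>) (char_rel Fin) X" for w z X
  proof (rule rcomp_least[OF PV presheaf_one rhs _ that])
    fix X w t z
    assume wt: "(w, t) \<in> rcomp C V S ?J \<rho> X" and t: "(t, z) \<in> char_rel Fin X"
      and w: "w \<in> sec V X" and z: "z \<in> sec (one_sheaf C) X"
    show "(w, z) \<in> rcomp C V (one_sheaf C) h (char_rel G) X"
    proof (rule rcompE[OF wt rhs[unfolded relation_def]])
      show "(w, z) \<in> sec (prod_sheaf V (one_sheaf C)) X" using w z by simp
      fix f y assume f: "f \<in> Ar C" "cd C f = X" and "(res V f w, y) \<in> ?J (dm C f)"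
        and "(y, res S f t) \<in> \<rho> (dm C f)"
      then obtain s where s: "s \<in> I (dm C f)" "((res V f w, s), res S f t) \<in> \<rho> (dm C f)" by auto
      have t': "res S f t \<in> Fin (dm C f)" using subsheaf_res[OF Fin f(1)] t f by simp
      \<comment> \<open>The final state \<open>t\<close> is given over \<open>X\<close>, the initial
        state \<open>s\<close> only over the domain of \<open>f\<close>; there both exist and form
        an arrow.\<close>
      obtain p where "p \<in> sec P (dm C f)" "a (dm C f) p = s" "b (dm C f) p = res S f t"
        using pair[OF dm_Ob[OF f(1)] subsheaf_sec[OF I s(1)] subsheaf_sec[OF Fin t']] by blast
      then have "(res V f w, res (one_sheaf C) f z) \<in> rcomp C V (one_sheaf C) h (char_rel G) (dm C f)"
        by (intro rcompI[where y = p] PV presheaf_one)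
          (use s t' f w dm_Ob in \<open>auto simp: h_iff G_def intro: presheaf_res[OF PV]\<close>)
      then show "res (prod_sheaf V (one_sheaf C)) f (w, z) \<in> rcomp C V (one_sheaf C) h (char_rel G) (dm C f)"
        by simp
    qed
  qed
  moreover have "(w, z) \<in> rcomp C V (one_sheaf C) (rcomp C V S ?J \<rho>) (char_rel Fin) X"
    if "(w, z) \<in> rcomp C V (one_sheaf C) h (char_rel G) X" for w z X
  proof (rule rcomp_least[OF PV presheaf_one lhs _ that])
    fix X w p z
    assume wp: "(w, p) \<in> h X" and p: "(p, z) \<in> char_rel G X"
      and w: "w \<in> sec V X" and z: "z \<in> sec (one_sheaf C) X"
    have "(w, b X p) \<in> rcomp C V S ?J \<rho> X"
      by (rule rcompI[where y = "(w, a X p)", OF PV PS]) (use wp p w b_sec in \<open>auto simp: h_iff G_def\<close>)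
    then show "(w, z) \<in> rcomp C V (one_sheaf C) (rcomp C V S ?J \<rho>) (char_rel Fin) X"
      by (rule rcompI[where y = "b X p", OF PV presheaf_one w z]) (use p in \<open>auto simp: G_def\<close>)
  qed
  ultimately have "char_rel L = rcomp C V (one_sheaf C) h (char_rel G)"
    unfolding L_eq relation_eq_iff[OF lhs rhs] by blast
  then have "recognized_by_promonoid C W ?Q L"
    unfolding recognized_by_promonoid_def using L hom G by (auto simp: V_def)
  then show ?thesis using Q by (intro exI[of _ ?Q]) simp
qed

subsection \<open>From promonoids to automata\<close>

text \<open>Acting by \<open>u\<close> and then \<open>v\<close> is right multiplication twice,
  which associativity and multiplicativity of \<open>h\<close> turn into acting by the product.
  Started in the unit, \<open>w\<close> reaches exactly the elements that \<open>h\<close> relates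
  to \<open>w\<close>, since multiplying them by a unit changes nothing; so \<open>F\<close> can
  serve as the final states.\<close>

lemma recognized_by_promonoid_imp_nda:
  fixes P :: "('o, 'a, 'v) promonoid" and A :: "('o, 'a, 'u) psh"
  assumes W: "is_monoid_obj C W" and A: "presheaf C A" and \<iota>: "natural A (mcarrier W) \<iota>"
    and P: "is_promonoid C P" and rec: "recognized_by_promonoid C W P L"
  shows "\<exists>N :: ('o, 'a, 'u, 'v) nda. is_nda C A N \<and> states N = pcarrier P \<and> recognized_by_nda C A W \<iota> N L"
proof -
  define M where "M = pcarrier P"
  define \<mu> where "\<mu> = pmult P"
  define \<eta> where "\<eta> = punit P"
  define V where "V = mcarrier W"
  define m where "m = mmult W"
  define e where "e = mone W"
  have V: "sheaf C V" and m: "natural (prod_sheaf V V) V m" and e: "natural (one_sheaf C) V e"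
    using monoid_objD[OF W] by (simp_all add: V_def m_def e_def)
  have M: "sheaf C M" and \<mu>: "relation C (prod_sheaf M M) M \<mu>" and \<eta>: "subsheaf C M \<eta>"
    and assoc0: "rcomp C (prod_sheaf (prod_sheaf M M) M) M (rprod \<mu> (rid M)) \<mu> =
        rcomp C (prod_sheaf (prod_sheaf M M) M) M
          (graph (prod_sheaf (prod_sheaf M M) M) (\<lambda>X ((x, y), z). (x, (y, z))))
          (rcomp C (prod_sheaf M (prod_sheaf M M)) M (rprod (rid M) \<mu>) \<mu>)"
    and unit1: "rcomp C (prod_sheaf (one_sheaf C) M) M (rprod (point_rel \<eta>) (rid M)) \<mu> =
      graph (prod_sheaf (one_sheaf C) M) (\<lambda>X. snd)"
    and unit2: "rcomp C (prod_sheaf M (one_sheaf C)) M (rprod (rid M) (point_rel \<eta>)) \<mu> =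
      graph (prod_sheaf M (one_sheaf C)) (\<lambda>X. fst)"
    using P unfolding is_promonoid_def Let_def M_def \<mu>_def \<eta>_def by blast+
  note PV = sheaf_presheaf[OF V] and PM = sheaf_presheaf[OF M]
  note PVV = presheaf_prod[OF PV PV] and PMM = presheaf_prod[OF PM PM] and PVM = presheaf_prod[OF PV PM]
  have \<mu>_sec: "x \<in> sec M X \<and> y \<in> sec M X \<and> z \<in> sec M X" if "((x, y), z) \<in> \<mu> X" for x y z X
    using relation_sec[OF \<mu> that] by auto
  have \<mu>_res: "((res M f x, res M f y), res M f z) \<in> \<mu> (dm C f)"
    if "f \<in> Ar C" "cd C f = X" "((x, y), z) \<in> \<mu> X" for f X x y z
    using relation_res[OF \<mu> that(1)] that by auto
  have \<mu>3: "relation C (prod_sheaf M (prod_sheaf M M)) M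
      (rcomp C (prod_sheaf M (prod_sheaf M M)) M (rprod (rid M) \<mu>) \<mu>)"
    by (rule relation_rcomp[OF presheaf_prod[OF PM PMM] PM relation_rprod[OF relation_rid[OF M] \<mu>] \<mu>])
  have assoc: "(((x, y), z), t) \<in> rcomp C (prod_sheaf (prod_sheaf M M) M) M (rprod \<mu> (rid M)) \<mu> X \<longleftrightarrow>
      ((x, (y, z)), t) \<in> rcomp C (prod_sheaf M (prod_sheaf M M)) M (rprod (rid M) \<mu>) \<mu> X" for x y z t X
    unfolding assoc0 rcomp_graph[OF presheaf_prod[OF PMM PM] PM natural_assoc \<mu>3]
    using relation_sec[OF \<mu>3, of "(x, (y, z))" t X] by auto
  have unit_left: "n = t" if "s \<in> \<eta> X" "((s, n), t) \<in> \<mu> X" for s n t X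
  proof -
    have "(((), n), t) \<in> rcomp C (prod_sheaf (one_sheaf C) M) M (rprod (point_rel \<eta>) (rid M)) \<mu> X"
      by (rule rcompI[where y = "(s, n)", OF presheaf_prod[OF presheaf_one PM] PM])
        (use that \<mu>_sec[OF that(2)] presheaf_Ob[OF PM, of n X] in auto)
    then show ?thesis unfolding unit1 by auto
  qed
  have unit_right: "n = t" if "s \<in> \<eta> X" "((n, s), t) \<in> \<mu> X" for s n t X
  proof -
    have "((n, ()), t) \<in> rcomp C (prod_sheaf M (one_sheaf C)) M (rprod (rid M) (point_rel \<eta>)) \<mu> X"
      by (rule rcompI[where y = "(n, s)", OF presheaf_prod[OF PM presheaf_one] PM])
        (use that \<mu>_sec[OF that(2)] presheaf_Ob[OF PM, of n X] in auto)
    then show ?thesis unfolding unit2 by auto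
  qed
  \<comment> \<open>A unit that fixes a given \<open>n\<close> exists only on a cover, since \<eta>
    is a subobject and not an element. This half of the unit law is therefore an elimination rule
    into an arbitrary subsheaf \<open>Q\<close>.\<close>
  have unit_leftE: "g \<in> Q X" if n: "n \<in> sec M X" and Q: "subsheaf C G Q" "g \<in> sec G X"
    "\<And>f s. f \<in> Ar C \<Longrightarrow> cd C f = X \<Longrightarrow> s \<in> \<eta> (dm C f) \<Longrightarrow> ((s, res M f n), res M f n) \<in> \<mu> (dm C f) \<Longrightarrow>
      res G f g \<in> Q (dm C f)" for n X g Q and G :: "('o, 'a, 'g) psh"
  proof -
    have "(((), n), n) \<in> rcomp C (prod_sheaf (one_sheaf C) M) M (rprod (point_rel \<eta>) (rid M)) \<mu> X"
      unfolding unit1 using n presheaf_Ob[OF PM] by auto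
    then show ?thesis by (rule rcompE[OF _ Q(1,2)]) (auto simp: rprod_def intro: Q(3))
  qed
  have unit_rightE: "g \<in> Q X" if n: "n \<in> sec M X" and Q: "subsheaf C G Q" "g \<in> sec G X"
    "\<And>f s. f \<in> Ar C \<Longrightarrow> cd C f = X \<Longrightarrow> s \<in> \<eta> (dm C f) \<Longrightarrow> ((res M f n, s), res M f n) \<in> \<mu> (dm C f) \<Longrightarrow>
      res G f g \<in> Q (dm C f)" for n X g Q and G :: "('o, 'a, 'g) psh"
  proof -
    have "((n, ()), n) \<in> rcomp C (prod_sheaf M (one_sheaf C)) M (rprod (rid M) (point_rel \<eta>)) \<mu> X"
      unfolding unit2 using n presheaf_Ob[OF PM] by auto
    then show ?thesis by (rule rcompE[OF _ Q(1,2)]) (auto simp: rprod_def intro: Q(3))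
  qed

  have L: "subsheaf C V L" using rec by (simp add: recognized_by_promonoid_def V_def)
  obtain h F where hom: "promonoid_hom C (monoid_promonoid C W) P h" and F: "subsheaf C M F"
    and L_eq: "char_rel L = rcomp C V (one_sheaf C) h (char_rel F)"
    using rec unfolding recognized_by_promonoid_def V_def M_def by blast
  have h: "relation C V M h"
    and h_mult0: "rcomp C (prod_sheaf V V) M (graph (prod_sheaf V V) m) h = rcomp C (prod_sheaf V V) M (rprod h h) \<mu>"
    and h_unit0: "rcomp C (one_sheaf C) M (point_rel (\<lambda>X. e X ` sec (one_sheaf C) X)) h = point_rel \<eta>"
    using hom unfolding promonoid_hom_def monoid_promonoid_def Let_def M_def V_def m_def e_def \<mu>_def \<eta>_def
    by simp_all
  have h_sec: "w \<in> sec V X \<and> n \<in> sec M X" if "(w, n) \<in> h X" for w n X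
    using relation_sec[OF h that] .
  have h_res: "(res V f w, res M f n) \<in> h (dm C f)" if "f \<in> Ar C" "cd C f = X" "(w, n) \<in> h X" for f X w n
    using relation_res[OF h that(1)] that by auto
  have h_mult: "(m X (u, v), n) \<in> h X \<longleftrightarrow> ((u, v), n) \<in> rcomp C (prod_sheaf V V) M (rprod h h) \<mu> X"
    if "u \<in> sec V X" "v \<in> sec V X" for u v n X
    using that unfolding h_mult0[symmetric] rcomp_graph[OF PVV PM m h] by simp
  have one_graph: "point_rel (\<lambda>X. e X ` sec (one_sheaf C) X) = graph (one_sheaf C) e"
    by (auto simp: fun_eq_iff point_rel_def graph_def)
  have h_unit: "(e X (), n) \<in> h X \<longleftrightarrow> n \<in> \<eta> X" if "X \<in> Ob C" for n X
  proof -
    have "((), n) \<in> point_rel \<eta> X \<longleftrightarrow> (e X (), n) \<in> h X"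
      unfolding h_unit0[symmetric] one_graph rcomp_graph[OF presheaf_one PM e h] using that by simp
    then show ?thesis by simp
  qed

  \<comment> \<open>The swap followed by \<open>rid M\<close> times \<open>h\<close>. The element
    related to the word is put to the right of the state, so that \<rho> multiplies on the right and
    words act in reading order.\<close>
  define R where "R = (\<lambda>X. {((w, s), (s', n)). s' = s \<and> s \<in> sec M X \<and> (w, n) \<in> h X})"
  have R: "relation C (prod_sheaf V M) (prod_sheaf M M) R"
  proof (rule relationI)
    fix X U x y
    assume U: "X \<in> Ob C" "U \<in> Cov C X"
      and x: "x \<in> sec (prod_sheaf V M) X" and y: "y \<in> sec (prod_sheaf M M) X"
      and *: "\<And>f. f \<in> U \<Longrightarrow> f \<in> Ar C \<and> cd C f = X \<and>
        (res (prod_sheaf V M) f x, res (prod_sheaf M M) f y) \<in> R (dm C f)"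
    obtain w s s' n where [simp]: "x = (w, s)" "y = (s', n)" by (metis surj_pair)
    \<comment> \<open>The state components are known to agree only on the cover; separatedness of
      \<open>M\<close> makes them equal.\<close>
    have "s' = s" by (rule sheaf_separated[OF M U]) (use x y * in \<open>auto simp: R_def\<close>)
    moreover have "(w, n) \<in> h X" by (rule relation_local[OF h U]) (use x y * in \<open>auto simp: R_def\<close>)
    ultimately show "(x, y) \<in> R X" using x by (simp add: R_def)
  qed (use h_sec h_res presheaf_res[OF PM] in \<open>auto simp: R_def\<close>)
  define \<rho> where "\<rho> = rcomp C (prod_sheaf V M) M R \<mu>"
  have \<rho>: "relation C (prod_sheaf V M) M \<rho>"
    unfolding \<rho>_def by (rule relation_rcomp[OF PVM PM R \<mu>])
  have \<rho>_sec: "w \<in> sec V X \<and> s \<in> sec M X \<and> t \<in> sec M X" if "((w, s), t) \<in> \<rho> X" for w s t X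
    using relation_sec[OF \<rho> that] by auto
  have \<rho>_res: "((res V f w, res M f s), res M f t) \<in> \<rho> (dm C f)"
    if "f \<in> Ar C" "cd C f = X" "((w, s), t) \<in> \<rho> X" for f X w s t
    using relation_res[OF \<rho> that(1)] that by auto
  \<comment> \<open>This fact and the next introduce and eliminate the local right factor
    \<open>n\<close> hidden in \<rho>; later steps use them in place of \<open>R\<close>.\<close>
  have \<rho>I: "((w, s), t) \<in> \<rho> X" if "(w, n) \<in> h X" "((s, n), t) \<in> \<mu> X" for w s t n X
    unfolding \<rho>_def
    by (rule rcompI[where y = "(s, n)", OF PVM PM]) (use that h_sec[OF that(1)] \<mu>_sec[OF that(2)] in \<open>auto simp: R_def\<close>)
  have \<rho>E: "g \<in> Q X" if \<rho>: "((w, s), t) \<in> \<rho> X" and Q: "subsheaf C G Q" "g \<in> sec G X"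
    "\<And>f n. f \<in> Ar C \<Longrightarrow> cd C f = X \<Longrightarrow> (res V f w, n) \<in> h (dm C f) \<Longrightarrow>
      ((res M f s, n), res M f t) \<in> \<mu> (dm C f) \<Longrightarrow> res G f g \<in> Q (dm C f)"
    for w s t X g Q and G :: "('o, 'a, 'g) psh"
    by (rule rcompE[OF \<rho>[unfolded \<rho>_def] Q(1,2)]) (auto simp: R_def intro: Q(3))

  \<comment> \<open>Transitions are the action restricted to letters, so the clause of
    \<open>induced_action\<close> about \<iota> holds by definition.\<close>
  define N :: "('o, 'a, 'u, 'v) nda" where "N = \<lparr>states = M, initial = \<eta>, final = F,
    trans = rcomp C (prod_sheaf A M) M (rprod (graph A \<iota>) (rid M)) \<rho>\<rparr>"
  have "relation C (prod_sheaf A M) M (trans N)"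
    unfolding N_def using relation_rcomp[OF presheaf_prod[OF A PM] PM relation_rprod[OF
        relation_graph[OF A V \<iota>[folded V_def]] relation_rid[OF M]] \<rho>] by simp
  then have N: "is_nda C A N"
    unfolding is_nda_def using M \<eta> F by (simp add: N_def)

  let ?D = "rcomp C (prod_sheaf V (prod_sheaf V M)) M (rprod (rid V) \<rho>) \<rho>"
  note PD = presheaf_prod[OF PV PVM]
  have D: "relation C (prod_sheaf V (prod_sheaf V M)) M ?D"
    by (rule relation_rcomp[OF PD PM relation_rprod[OF relation_rid[OF V] \<rho>] \<rho>])

  have act_unit: "((e X (), s), t) \<in> \<rho> X \<longleftrightarrow> s = t" if s: "s \<in> sec M X" and t: "t \<in> sec M X" for s t X
  proof
    have X: "X \<in> Ob C" using presheaf_Ob[OF PM s] .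
    have e_res: "res V f (e X ()) = e (dm C f) ()" if "f \<in> Ar C" "cd C f = X" for f
      using natural_res[OF e that(1), of "()"] that X by simp
    {
      assume "((e X (), s), t) \<in> \<rho> X"
      \<comment> \<open>\<open>h\<close> relates the unit word to units only, so the local right
        factor \<open>n\<close> is a unit and forces \<open>s\<close> and \<open>t\<close> to agree
        locally. Since \<open>rid M\<close> is a subsheaf, they agree over \<open>X\<close>.\<close>
      then have "(s, t) \<in> rid M X"
      proof (rule \<rho>E[OF _ relation_rid[OF M, unfolded relation_def]])
        fix f n assume f: "f \<in> Ar C" "cd C f = X" and n: "(res V f (e X ()), n) \<in> h (dm C f)"
          "((res M f s, n), res M f t) \<in> \<mu> (dm C f)"
        have "n \<in> \<eta> (dm C f)" using n(1) e_res[OF f] h_unit[OF dm_Ob[OF f(1)]] by simp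
        then have "res M f s = res M f t" using unit_right n(2) by blast
        then show "res (prod_sheaf M M) f (s, t) \<in> rid M (dm C f)"
          using presheaf_res[OF PM f(1)] f t by simp
      qed (use s t in simp)
      then show "s = t" by simp
    }
    {
      assume "s = t"
      have "((e X (), s), s) \<in> \<rho> X"
      proof (rule unit_rightE[OF s \<rho>[unfolded relation_def]])
        show "((e X (), s), s) \<in> sec (prod_sheaf (prod_sheaf V M) M) X"
          using s natural_sec[OF e] X by simp
        fix f n assume f: "f \<in> Ar C" "cd C f = X" and n: "n \<in> \<eta> (dm C f)"
          "((res M f s, n), res M f s) \<in> \<mu> (dm C f)"
        show "res (prod_sheaf (prod_sheaf V M) M) f ((e X (), s), s) \<in> \<rho> (dm C f)"
          using \<rho>I[OF _ n(2)] h_unit[OF dm_Ob[OF f(1)]] n(1) e_res[OF f] by simp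
      qed
      then show "((e X (), s), t) \<in> \<rho> X" using \<open>s = t\<close> by simp
    }
  qed

  have m_res: "res V f (m X (u, v)) = m (dm C f) (res V f u, res V f v)"
    if "f \<in> Ar C" "cd C f = X" "u \<in> sec V X" "v \<in> sec V X" for f u v X
    using natural_res[OF m that(1), of "(u, v)"] that by simp
  \<comment> \<open>Acting by a product factors as acting twice, with local existentials removed
    stage by stage. Here all factors are given, and reassociating \<open>s (n1 n2)\<close> to
    \<open>(s n1) n2\<close> produces the middle state \<open>s'\<close> locally;
    \<open>act_mult2\<close> then removes \<open>n1\<close> and \<open>n2\<close>, and
    \<open>act_mult3\<close> removes their product \<open>n\<close>.\<close>
  have act_mult1: "((v, (u, s)), t) \<in> ?D X"
    if u: "(u, n1) \<in> h X" and v: "(v, n2) \<in> h X" and n: "((n1, n2), n) \<in> \<mu> X" and t: "((s, n), t) \<in> \<mu> X"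
    for u v s t n1 n2 n X
  proof -
    have "((s, (n1, n2)), t) \<in> rcomp C (prod_sheaf M (prod_sheaf M M)) M (rprod (rid M) \<mu>) \<mu> X"
      by (rule rcompI[where y = "(s, n)", OF presheaf_prod[OF PM PMM] PM])
        (use n t \<mu>_sec[OF n] \<mu>_sec[OF t] in auto)
    then have "(((s, n1), n2), t) \<in> rcomp C (prod_sheaf (prod_sheaf M M) M) M (rprod \<mu> (rid M)) \<mu> X"
      by (simp add: assoc)
    then show ?thesis
    proof (rule rcompE[OF _ D[unfolded relation_def]])
      show "((v, (u, s)), t) \<in> sec (prod_sheaf (prod_sheaf V (prod_sheaf V M)) M) X"
        using h_sec[OF u] h_sec[OF v] \<mu>_sec[OF t] by simp
      fix f y assume f: "f \<in> Ar C" "cd C f = X"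
        and "(res (prod_sheaf (prod_sheaf M M) M) f ((s, n1), n2), y) \<in> rprod \<mu> (rid M) (dm C f)"
        and "(y, res M f t) \<in> \<mu> (dm C f)"
      then obtain s' where s': "((res M f s, res M f n1), s') \<in> \<mu> (dm C f)"
        "((s', res M f n2), res M f t) \<in> \<mu> (dm C f)" by (cases y) auto
      note uf = \<rho>I[OF h_res[OF f u] s'(1)] and vf = \<rho>I[OF h_res[OF f v] s'(2)]
      have "((res V f v, (res V f u, res M f s)), res M f t) \<in> ?D (dm C f)"
        by (rule rcompI[where y = "(res V f v, s')", OF PD PM])
          (use uf vf \<rho>_sec[OF uf] \<rho>_sec[OF vf] in auto)
      then show "res (prod_sheaf (prod_sheaf V (prod_sheaf V M)) M) f ((v, (u, s)), t) \<in> ?D (dm C f)"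
        by simp
    qed
  qed
  have act_mult2: "((v, (u, s)), t) \<in> ?D X"
    if u: "u \<in> sec V X" and v: "v \<in> sec V X" and n: "(m X (u, v), n) \<in> h X" and t: "((s, n), t) \<in> \<mu> X"
    for u v s t n X
  proof (rule rcompE[OF n[unfolded h_mult[OF u v]] D[unfolded relation_def]])
    show "((v, (u, s)), t) \<in> sec (prod_sheaf (prod_sheaf V (prod_sheaf V M)) M) X"
      using u v \<mu>_sec[OF t] by simp
    fix f y assume f: "f \<in> Ar C" "cd C f = X"
      and "(res (prod_sheaf V V) f (u, v), y) \<in> rprod h h (dm C f)" "(y, res M f n) \<in> \<mu> (dm C f)"
    then show "res (prod_sheaf (prod_sheaf V (prod_sheaf V M)) M) f ((v, (u, s)), t) \<in> ?D (dm C f)"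
      using act_mult1[OF _ _ _ \<mu>_res[OF f t]] by (cases y) auto
  qed
  have act_mult3: "((v, (u, s)), t) \<in> ?D X"
    if u: "u \<in> sec V X" and v: "v \<in> sec V X" and uv: "((m X (u, v), s), t) \<in> \<rho> X"
    for u v s t X
  proof (rule \<rho>E[OF uv D[unfolded relation_def]])
    show "((v, (u, s)), t) \<in> sec (prod_sheaf (prod_sheaf V (prod_sheaf V M)) M) X"
      using u v \<rho>_sec[OF uv] by simp
    fix f n assume f: "f \<in> Ar C" "cd C f = X"
      and n: "(res V f (m X (u, v)), n) \<in> h (dm C f)" "((res M f s, n), res M f t) \<in> \<mu> (dm C f)"
    show "res (prod_sheaf (prod_sheaf V (prod_sheaf V M)) M) f ((v, (u, s)), t) \<in> ?D (dm C f)"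
      using act_mult2[OF _ _ _ n(2), of "res V f u" "res V f v"] n(1) m_res[OF f u v]
        presheaf_res[OF PV f(1)] f u v by simp
  qed
  \<comment> \<open>The converse, in the same manner: associativity produces a local product
    \<open>n\<close> of \<open>n1\<close> and \<open>n2\<close>, which multiplicativity of
    \<open>h\<close> relates to the product of the words. The witnesses \<open>n2\<close>,
    \<open>n1\<close> and \<open>s'\<close> are then removed in turn by the three facts that
    follow.\<close>
  have act_mult4: "((m X (u, v), s), t) \<in> \<rho> X"
    if u: "(u, n1) \<in> h X" and v: "(v, n2) \<in> h X"
      and s': "((s, n1), s') \<in> \<mu> X" and t: "((s', n2), t) \<in> \<mu> X" for u v s s' t n1 n2 X
  proof -
    have "(((s, n1), n2), t) \<in> rcomp C (prod_sheaf (prod_sheaf M M) M) M (rprod \<mu> (rid M)) \<mu> X"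
      by (rule rcompI[where y = "(s', n2)", OF presheaf_prod[OF PMM PM] PM])
        (use s' t \<mu>_sec[OF s'] \<mu>_sec[OF t] in auto)
    then have "((s, (n1, n2)), t) \<in> rcomp C (prod_sheaf M (prod_sheaf M M)) M (rprod (rid M) \<mu>) \<mu> X"
      by (simp add: assoc)
    then show ?thesis
    proof (rule rcompE[OF _ \<rho>[unfolded relation_def]])
      show "((m X (u, v), s), t) \<in> sec (prod_sheaf (prod_sheaf V M) M) X"
        using natural_sec[OF m, of "(u, v)"] h_sec[OF u] h_sec[OF v] \<mu>_sec[OF s'] \<mu>_sec[OF t] by simp
      fix f y assume f: "f \<in> Ar C" "cd C f = X"
        and "(res (prod_sheaf M (prod_sheaf M M)) f (s, (n1, n2)), y) \<in> rprod (rid M) \<mu> (dm C f)"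
        and "(y, res M f t) \<in> \<mu> (dm C f)"
      then obtain n where n: "((res M f n1, res M f n2), n) \<in> \<mu> (dm C f)"
        "((res M f s, n), res M f t) \<in> \<mu> (dm C f)" by (cases y) auto
      note uf = h_res[OF f u] and vf = h_res[OF f v]
      have "((res V f u, res V f v), n) \<in> rcomp C (prod_sheaf V V) M (rprod h h) \<mu> (dm C f)"
        by (rule rcompI[where y = "(res M f n1, res M f n2)", OF PVV PM])
          (use uf vf n h_sec[OF uf] h_sec[OF vf] \<mu>_sec[OF n(1)] in auto)
      then have "(m (dm C f) (res V f u, res V f v), n) \<in> h (dm C f)"
        using h_mult h_sec[OF uf] h_sec[OF vf] by simp
      then show "res (prod_sheaf (prod_sheaf V M) M) f ((m X (u, v), s), t) \<in> \<rho> (dm C f)"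
        using \<rho>I[OF _ n(2)] m_res[OF f] h_sec[OF u] h_sec[OF v] by simp
    qed
  qed
  have act_mult5: "((m X (u, v), s), t) \<in> \<rho> X"
    if u: "(u, n1) \<in> h X" and s': "((s, n1), s') \<in> \<mu> X" and t: "((v, s'), t) \<in> \<rho> X" for u v s s' t n1 X
  proof (rule \<rho>E[OF t \<rho>[unfolded relation_def]])
    show "((m X (u, v), s), t) \<in> sec (prod_sheaf (prod_sheaf V M) M) X"
      using natural_sec[OF m, of "(u, v)"] h_sec[OF u] \<mu>_sec[OF s'] \<rho>_sec[OF t] by simp
    fix f n2 assume f: "f \<in> Ar C" "cd C f = X"
      and n2: "(res V f v, n2) \<in> h (dm C f)" "((res M f s', n2), res M f t) \<in> \<mu> (dm C f)"
    show "res (prod_sheaf (prod_sheaf V M) M) f ((m X (u, v), s), t) \<in> \<rho> (dm C f)"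
      using act_mult4[OF h_res[OF f u] n2(1) \<mu>_res[OF f s'] n2(2)] m_res[OF f] h_sec[OF u] \<rho>_sec[OF t]
      by simp
  qed
  have act_mult6: "((m X (u, v), s), t) \<in> \<rho> X"
    if s': "((u, s), s') \<in> \<rho> X" and t: "((v, s'), t) \<in> \<rho> X" for u v s s' t X
  proof (rule \<rho>E[OF s' \<rho>[unfolded relation_def]])
    show "((m X (u, v), s), t) \<in> sec (prod_sheaf (prod_sheaf V M) M) X"
      using natural_sec[OF m, of "(u, v)"] \<rho>_sec[OF s'] \<rho>_sec[OF t] by simp
    fix f n1 assume f: "f \<in> Ar C" "cd C f = X"
      and n1: "(res V f u, n1) \<in> h (dm C f)" "((res M f s, n1), res M f s') \<in> \<mu> (dm C f)"
    show "res (prod_sheaf (prod_sheaf V M) M) f ((m X (u, v), s), t) \<in> \<rho> (dm C f)"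
      using act_mult5[OF n1 \<rho>_res[OF f t]] m_res[OF f] \<rho>_sec[OF s'] \<rho>_sec[OF t] by simp
  qed
  have act_mult7: "((m X (u, v), s), t) \<in> \<rho> X"
    if D: "((v, (u, s)), t) \<in> ?D X" and "u \<in> sec V X" "v \<in> sec V X" "s \<in> sec M X" "t \<in> sec M X" for u v s t X
  proof (rule rcompE[OF D \<rho>[unfolded relation_def]])
    show "((m X (u, v), s), t) \<in> sec (prod_sheaf (prod_sheaf V M) M) X"
      using natural_sec[OF m, of "(u, v)"] that by simp
    fix f y assume f: "f \<in> Ar C" "cd C f = X"
      and "(res (prod_sheaf V (prod_sheaf V M)) f (v, (u, s)), y) \<in> rprod (rid V) \<rho> (dm C f)"
      and "(y, res M f t) \<in> \<rho> (dm C f)"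
    then show "res (prod_sheaf (prod_sheaf V M) M) f ((m X (u, v), s), t) \<in> \<rho> (dm C f)"
      using act_mult6 m_res[OF f] that by (cases y) auto
  qed
  have act: "induced_action C A W \<iota> N \<rho>"
    using act_unit act_mult3 act_mult7
    by (subst induced_action_iff[OF W]) (use M \<rho> in \<open>auto simp: N_def V_def m_def e_def\<close>)

  let ?J = "\<lambda>X. {(w, (w', s)). w' = w \<and> w \<in> sec V X \<and> s \<in> \<eta> X}"
  note J = relation_initial[OF V PM \<eta>]
  have \<rho>J: "relation C V M (rcomp C V M ?J \<rho>)"
    by (rule relation_rcomp[OF PV PM J \<rho>])
  have lhs: "relation C V (one_sheaf C) (rcomp C V (one_sheaf C) (rcomp C V M ?J \<rho>) (char_rel F))"
    by (rule relation_rcomp[OF PV presheaf_one \<rho>J relation_char_rel[OF PM F]])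
  have rhs: "relation C V (one_sheaf C) (rcomp C V (one_sheaf C) h (char_rel F))"
    by (rule relation_rcomp[OF PV presheaf_one h relation_char_rel[OF PM F]])
  \<comment> \<open>Locally \<open>t\<close> is the product of some unit \<open>s\<close> with
    \<open>t\<close> itself. Hence \<open>w\<close>, acting through its related element
    \<open>t\<close>, leads from the initial state \<open>s\<close> to \<open>t\<close>.\<close>
  have 1: "(w, z) \<in> rcomp C V (one_sheaf C) (rcomp C V M ?J \<rho>) (char_rel F) X"
    if "(w, z) \<in> rcomp C V (one_sheaf C) h (char_rel F) X" for w z X
  proof (rule rcomp_least[OF PV presheaf_one lhs _ that])
    fix X w t z
    assume wt: "(w, t) \<in> h X" and t: "(t, z) \<in> char_rel F X"
      and w: "w \<in> sec V X" and z: "z \<in> sec (one_sheaf C) X"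
    have t': "t \<in> sec M X" using h_sec[OF wt] by simp
    have "(w, t) \<in> rcomp C V M ?J \<rho> X"
    proof (rule unit_leftE[OF t' \<rho>J[unfolded relation_def]])
      show "(w, t) \<in> sec (prod_sheaf V M) X" using w t' by simp
      fix f s assume f: "f \<in> Ar C" "cd C f = X" and s: "s \<in> \<eta> (dm C f)"
        "((s, res M f t), res M f t) \<in> \<mu> (dm C f)"
      note r = \<rho>I[OF h_res[OF f wt] s(2)]
      have "(res V f w, res M f t) \<in> rcomp C V M ?J \<rho> (dm C f)"
        by (rule rcompI[where y = "(res V f w, s)", OF PV PM]) (use r s \<rho>_sec[OF r] in auto)
      then show "res (prod_sheaf V M) f (w, t) \<in> rcomp C V M ?J \<rho> (dm C f)" by simp
    qed
    then show "(w, z) \<in> rcomp C V (one_sheaf C) (rcomp C V M ?J \<rho>) (char_rel F) X"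
      using t by (rule rcompI[OF PV presheaf_one w z])
  qed
  \<comment> \<open>The start \<open>s\<close> is a unit, so \<open>unit_left\<close> identifies the
    local right factor \<open>n\<close> with the state reached, and \<open>n\<close> lies in
    \<open>F\<close>.\<close>
  have 2: "(w, z) \<in> rcomp C V (one_sheaf C) h (char_rel F) X"
    if s: "s \<in> \<eta> X" and r: "((w, s), t) \<in> \<rho> X" and t: "t \<in> F X" and z: "z \<in> sec (one_sheaf C) X"
    for w s t z X
  proof (rule \<rho>E[OF r rhs[unfolded relation_def]])
    show "(w, z) \<in> sec (prod_sheaf V (one_sheaf C)) X" using \<rho>_sec[OF r] z by simp
    fix f n assume f: "f \<in> Ar C" "cd C f = X"
      and n: "(res V f w, n) \<in> h (dm C f)" "((res M f s, n), res M f t) \<in> \<mu> (dm C f)"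
    have "n = res M f t" using unit_left[OF _ n(2)] subsheaf_res[OF \<eta> f(1)] s f by simp
    then have "n \<in> F (dm C f)" using subsheaf_res[OF F f(1)] t f by simp
    then have "(res V f w, res (one_sheaf C) f z) \<in> rcomp C V (one_sheaf C) h (char_rel F) (dm C f)"
      by (intro rcompI[where y = n] PV presheaf_one) (use n h_sec[OF n(1)] dm_Ob[OF f(1)] in auto)
    then show "res (prod_sheaf V (one_sheaf C)) f (w, z) \<in> rcomp C V (one_sheaf C) h (char_rel F) (dm C f)"
      by simp
  qed
  have 3: "(w, z) \<in> rcomp C V (one_sheaf C) h (char_rel F) X"
    if "(w, z) \<in> rcomp C V (one_sheaf C) (rcomp C V M ?J \<rho>) (char_rel F) X" for w z X
  proof (rule rcomp_least[OF PV presheaf_one rhs _ that])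
    fix X w t z
    assume wt: "(w, t) \<in> rcomp C V M ?J \<rho> X" and t: "(t, z) \<in> char_rel F X"
      and w: "w \<in> sec V X" and z: "z \<in> sec (one_sheaf C) X"
    show "(w, z) \<in> rcomp C V (one_sheaf C) h (char_rel F) X"
    proof (rule rcompE[OF wt rhs[unfolded relation_def]])
      show "(w, z) \<in> sec (prod_sheaf V (one_sheaf C)) X" using w z by simp
      fix f y assume f: "f \<in> Ar C" "cd C f = X" and "(res V f w, y) \<in> ?J (dm C f)"
        and "(y, res M f t) \<in> \<rho> (dm C f)"
      then obtain s where s: "s \<in> \<eta> (dm C f)" "((res V f w, s), res M f t) \<in> \<rho> (dm C f)" by auto
      have "res M f t \<in> F (dm C f)" using subsheaf_res[OF F f(1)] t f by simp
      then show "res (prod_sheaf V (one_sheaf C)) f (w, z) \<in> rcomp C V (one_sheaf C) h (char_rel F) (dm C f)"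
        using 2[OF s] dm_Ob[OF f(1)] by simp
    qed
  qed
  have "rcomp C V (one_sheaf C) (rcomp C V M ?J \<rho>) (char_rel F) = rcomp C V (one_sheaf C) h (char_rel F)"
    unfolding relation_eq_iff[OF lhs rhs] using 1 3 by blast
  then have "recognized_by_nda C A W \<iota> N L"
    unfolding recognized_by_nda_iff[OF W N L[unfolded V_def]]
    using act L_eq by (auto simp: N_def V_def)
  then show ?thesis using N by (intro exI[of _ N]) (simp add: N_def M_def)
qed

end

section \<open>Definable predicates and the syntactic site\<close>

subsection \<open>Renaming of variables\<close>

primrec ren_tm :: "(nat \<Rightarrow> nat) \<Rightarrow> 'f tm \<Rightarrow> 'f tm" where
  "ren_tm r (Var i) = Var (r i)"
| "ren_tm r (App f ts) = App f (map (ren_tm r) ts)"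

definition lift_ren :: "(nat \<Rightarrow> nat) \<Rightarrow> nat \<Rightarrow> nat" where
  "lift_ren r = case_nat 0 (\<lambda>i. Suc (r i))"

lemma lift_ren_simps [simp]: "lift_ren r 0 = 0" "lift_ren r (Suc i) = Suc (r i)"
  by (simp_all add: lift_ren_def)

primrec ren_fm :: "(nat \<Rightarrow> nat) \<Rightarrow> ('s, 'f, 'p) fm \<Rightarrow> ('s, 'f, 'p) fm" where
  "ren_fm r (Atom p ts) = Atom p (map (ren_tm r) ts)"
| "ren_fm r (Eq t u) = Eq (ren_tm r t) (ren_tm r u)"
| "ren_fm r Top = Top"
| "ren_fm r (Conj \<phi> \<psi>) = Conj (ren_fm r \<phi>) (ren_fm r \<psi>)"
| "ren_fm r Bot = Bot"
| "ren_fm r (Disj \<phi> \<psi>) = Disj (ren_fm r \<phi>) (ren_fm r \<psi>)"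
| "ren_fm r (Ex s \<phi>) = Ex s (ren_fm (lift_ren r) \<phi>)"

definition ren_ok :: "'s list \<Rightarrow> 's list \<Rightarrow> (nat \<Rightarrow> nat) \<Rightarrow> bool" where
  "ren_ok \<Gamma> \<Delta> r \<longleftrightarrow> (\<forall>i < length \<Gamma>. r i < length \<Delta> \<and> \<Delta> ! r i = \<Gamma> ! i)"

lemma ren_ok_lift: "ren_ok \<Gamma> \<Delta> r \<Longrightarrow> ren_ok (s # \<Gamma>) (s # \<Delta>) (lift_ren r)"
  by (auto simp: ren_ok_def less_Suc_eq_0_disj)

lemma tm_sort_ren: "tm_sort Sg \<Gamma> t s \<Longrightarrow> ren_ok \<Gamma> \<Delta> r \<Longrightarrow> tm_sort Sg \<Delta> (ren_tm r t) s"
proof (induction rule: tm_sort.induct)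
  case (1 i)
  then show ?case using tm_sort.intros(1)[of "r i" \<Delta> Sg] by (simp add: ren_ok_def)
next
  case (2 ts f)
  then have "list_all2 (tm_sort Sg \<Delta>) (map (ren_tm r) ts) (fst (fun_type Sg f))"
    by (auto simp: list_all2_map1 elim: list_all2_mono)
  then show ?case using tm_sort.intros(2) by fastforce
qed

lemma wf_fm_ren: "wf_fm Sg \<Gamma> \<phi> \<Longrightarrow> ren_ok \<Gamma> \<Delta> r \<Longrightarrow> wf_fm Sg \<Delta> (ren_fm r \<phi>)"
proof (induction \<phi> arbitrary: \<Gamma> \<Delta> r)
  case (Atom p ts)
  then show ?case by (auto simp: list_all2_map1 intro: tm_sort_ren elim: list_all2_mono)
next
  case (Eq t u)
  then show ?case by (auto intro: tm_sort_ren)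
next
  case (Ex s \<phi>)
  then show ?case using ren_ok_lift by fastforce
qed auto

lemma tm_val_ren:
  "tm_sort Sg \<Gamma> t s \<Longrightarrow> (\<And>i. i < length \<Gamma> \<Longrightarrow> xs ! r i = ys ! i) \<Longrightarrow>
    tm_val M xs (ren_tm r t) = tm_val M ys t"
proof (induction rule: tm_sort.induct)
  case (2 ts f)
  then have "\<forall>t \<in> set ts. tm_val M xs (ren_tm r t) = tm_val M ys t"
    by (auto simp: list_all2_conv_all_nth in_set_conv_nth)
  then have "map (tm_val M xs) (map (ren_tm r) ts) = map (tm_val M ys) ts" by simp
  then show ?case by (simp only: ren_tm.simps tm_val.simps)
qed simp

text \<open>Only variables of the context \<Gamma> occur in \<phi>, so the two assignments have to
  match there alone. Under a quantifier the lifted renaming fixes the new variable 0, and the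
  hypothesis extends to it.\<close>

lemma sat_ren:
  "wf_fm Sg \<Gamma> \<phi> \<Longrightarrow> (\<And>i. i < length \<Gamma> \<Longrightarrow> xs ! r i = ys ! i) \<Longrightarrow>
    sat M xs (ren_fm r \<phi>) \<longleftrightarrow> sat M ys \<phi>"
proof (induction \<phi> arbitrary: \<Gamma> xs ys r)
  case (Atom p ts)
  have "\<forall>t \<in> set ts. tm_val M xs (ren_tm r t) = tm_val M ys t"
  proof
    fix t assume "t \<in> set ts"
    then obtain s where "tm_sort Sg \<Gamma> t s"
      using Atom.prems(1) by (auto simp: list_all2_conv_all_nth in_set_conv_nth)
    then show "tm_val M xs (ren_tm r t) = tm_val M ys t" using Atom.prems(2) by (rule tm_val_ren)
  qed
  then have "map (tm_val M xs) (map (ren_tm r) ts) = map (tm_val M ys) ts" by simp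
  then show ?case by (simp only: ren_fm.simps sat.simps)
next
  case (Eq t u)
  obtain s where t: "tm_sort Sg \<Gamma> t s" and u: "tm_sort Sg \<Gamma> u s" using Eq.prems(1) by auto
  have "tm_val M xs (ren_tm r t) = tm_val M ys t" using t Eq.prems(2) by (rule tm_val_ren)
  moreover have "tm_val M xs (ren_tm r u) = tm_val M ys u" using u Eq.prems(2) by (rule tm_val_ren)
  ultimately show ?case by simp
next
  case (Conj \<phi> \<psi>)
  have "sat M xs (ren_fm r \<phi>) \<longleftrightarrow> sat M ys \<phi>"
    by (rule Conj.IH(1)[of \<Gamma>]) (use Conj.prems in simp_all)
  moreover have "sat M xs (ren_fm r \<psi>) \<longleftrightarrow> sat M ys \<psi>"
    by (rule Conj.IH(2)[of \<Gamma>]) (use Conj.prems in simp_all)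
  ultimately show ?case by simp
next
  case (Disj \<phi> \<psi>)
  have "sat M xs (ren_fm r \<phi>) \<longleftrightarrow> sat M ys \<phi>"
    by (rule Disj.IH(1)[of \<Gamma>]) (use Disj.prems in simp_all)
  moreover have "sat M xs (ren_fm r \<psi>) \<longleftrightarrow> sat M ys \<psi>"
    by (rule Disj.IH(2)[of \<Gamma>]) (use Disj.prems in simp_all)
  ultimately show ?case by simp
next
  case (Ex s \<phi>)
  have "sat M (a # xs) (ren_fm (lift_ren r) \<phi>) \<longleftrightarrow> sat M (a # ys) \<phi>" for a
    by (rule Ex.IH[of "s # \<Gamma>"]) (use Ex.prems in \<open>auto simp: less_Suc_eq_0_disj\<close>)
  then show ?case by simp
qed auto

subsection \<open>Definable predicates\<close>

lemma tuples_length: "xs \<in> tuples M \<Gamma> \<Longrightarrow> length xs = length \<Gamma>"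
  by (auto simp: tuples_def list_all2_lengthD)

lemma tuples_append: "zs \<in> tuples M (\<Gamma> @ \<Delta>) \<longleftrightarrow>
    take (length \<Gamma>) zs \<in> tuples M \<Gamma> \<and> drop (length \<Gamma>) zs \<in> tuples M \<Delta>"
  unfolding tuples_def mem_Collect_eq list_all2_append2
  by (metis append_take_drop_id append_eq_conv_conj list_all2_lengthD)

lemma tuples_appendI: "xs \<in> tuples M \<Gamma> \<Longrightarrow> ys \<in> tuples M \<Delta> \<Longrightarrow> xs @ ys \<in> tuples M (\<Gamma> @ \<Delta>)"
  by (simp add: tuples_def list_all2_appendI)

text \<open>\<open>Ex\<close> pushes its variable onto the front, so the head of \<Delta> must be
  the innermost quantifier if the bound block is to appear in the order of \<Delta> before the
  context.\<close>

primrec exs :: "'s list \<Rightarrow> ('s, 'f, 'p) fm \<Rightarrow> ('s, 'f, 'p) fm" where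
  "exs [] \<phi> = \<phi>"
| "exs (s # \<Delta>) \<phi> = exs \<Delta> (Ex s \<phi>)"

lemma wf_fm_exs: "wf_fm Sg \<Gamma> (exs \<Delta> \<phi>) \<longleftrightarrow> wf_fm Sg (\<Delta> @ \<Gamma>) \<phi>"
  by (induction \<Delta> arbitrary: \<phi>) auto

lemma sat_exs: "sat M xs (exs \<Delta> \<phi>) \<longleftrightarrow> (\<exists>ys \<in> tuples M \<Delta>. sat M (ys @ xs) \<phi>)"
proof (induction \<Delta> arbitrary: \<phi>)
  case (Cons s \<Delta>)
  show ?case
    unfolding exs.simps Cons.IH
    by (auto simp: tuples_def list_all2_Cons2) force+
qed (simp add: tuples_def)

text \<open>Predicates on models take the place of formulas, so that arrows, which are classes of
  formulas modulo the theory, can be handled semantically.\<close>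

definition definable :: "('s, 'f, 'p) signature \<Rightarrow> ('s, 'f, 'p) sequent set \<Rightarrow> 's list \<Rightarrow>
    (('s, 'f, 'p, 'u) interp \<Rightarrow> 'u list \<Rightarrow> bool) \<Rightarrow> bool" where
  "definable Sg T \<Gamma> Q \<longleftrightarrow> (\<exists>\<theta>. wf_fm Sg \<Gamma> \<theta> \<and>
     (\<forall>M \<in> models Sg T. \<forall>xs \<in> tuples M \<Gamma>. sat M xs \<theta> \<longleftrightarrow> Q M xs))"

lemma definable_cong:
  "definable Sg T \<Gamma> Q \<Longrightarrow>
    (\<And>M xs. M \<in> models Sg T \<Longrightarrow> xs \<in> tuples M \<Gamma> \<Longrightarrow> Q M xs \<longleftrightarrow> Q' M xs) \<Longrightarrow> definable Sg T \<Gamma> Q'"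
  unfolding definable_def by metis

lemma definable_sat: "wf_fm Sg \<Gamma> \<phi> \<Longrightarrow> definable Sg T \<Gamma> (\<lambda>M xs. sat M xs \<phi>)"
  unfolding definable_def by blast

lemma definable_conj:
  assumes "definable Sg T \<Gamma> Q" "definable Sg T \<Gamma> Q'"
  shows "definable Sg T \<Gamma> (\<lambda>M xs. Q M xs \<and> Q' M xs)"
proof -
  obtain \<theta> \<theta>' where "wf_fm Sg \<Gamma> \<theta>" "\<forall>M \<in> models Sg T. \<forall>xs \<in> tuples M \<Gamma>. sat M xs \<theta> \<longleftrightarrow> Q M xs"
    "wf_fm Sg \<Gamma> \<theta>'" "\<forall>M \<in> models Sg T. \<forall>xs \<in> tuples M \<Gamma>. sat M xs \<theta>' \<longleftrightarrow> Q' M xs"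
    using assms unfolding definable_def by blast
  then show ?thesis unfolding definable_def by (intro exI[of _ "Conj \<theta> \<theta>'"]) auto
qed

lemma definable_ex:
  fixes Q :: "('s, 'f, 'p, 'u) interp \<Rightarrow> 'u list \<Rightarrow> bool"
  assumes "definable Sg T (\<Delta> @ \<Gamma>) Q"
  shows "definable Sg T \<Gamma> (\<lambda>M xs. \<exists>ys \<in> tuples M \<Delta>. Q M (ys @ xs))"
proof -
  obtain \<theta> where \<theta>: "wf_fm Sg (\<Delta> @ \<Gamma>) \<theta>"
    and eq: "\<And>M xs. M \<in> models Sg T \<Longrightarrow> xs \<in> tuples M (\<Delta> @ \<Gamma>) \<Longrightarrow> sat M xs \<theta> \<longleftrightarrow> Q M xs"
    using assms unfolding definable_def by blast
  show ?thesis
    unfolding definable_def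
  proof (intro exI[of _ "exs \<Delta> \<theta>"] conjI ballI)
    fix M :: "('s, 'f, 'p, 'u) interp" and xs assume "M \<in> models Sg T" "xs \<in> tuples M \<Gamma>"
    then show "sat M xs (exs \<Delta> \<theta>) \<longleftrightarrow> (\<exists>ys \<in> tuples M \<Delta>. Q M (ys @ xs))"
      unfolding sat_exs by (intro bex_cong refl eq tuples_appendI)
  qed (simp add: wf_fm_exs \<theta>)
qed

lemma tuples_ren:
  assumes "ren_ok \<Gamma> \<Delta> r" "xs \<in> tuples M \<Delta>"
  shows "map (\<lambda>i. xs ! r i) [0..<length \<Gamma>] \<in> tuples M \<Gamma>"
  unfolding tuples_def mem_Collect_eq list_all2_conv_all_nth
proof (intro conjI allI impI)
  fix i assume "i < length (map (\<lambda>i. xs ! r i) [0..<length \<Gamma>])"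
  then have "i < length \<Gamma>" by simp
  then have "r i < length \<Delta>" "\<Delta> ! r i = \<Gamma> ! i" using assms(1) unfolding ren_ok_def by blast+
  then have "xs ! r i \<in> carr M (\<Gamma> ! i)"
    using assms(2) unfolding tuples_def mem_Collect_eq list_all2_conv_all_nth by metis
  then show "map (\<lambda>i. xs ! r i) [0..<length \<Gamma>] ! i \<in> carr M (\<Gamma> ! i)" using \<open>i < length \<Gamma>\<close> by simp
qed simp

text \<open>Closure under reindexing of variables; weakening on either side and exchange of two
  blocks are obtained as instances.\<close>

lemma definable_ren:
  fixes Q :: "('s, 'f, 'p, 'u) interp \<Rightarrow> 'u list \<Rightarrow> bool"
  assumes Q: "definable Sg T \<Gamma> Q" and r: "ren_ok \<Gamma> \<Delta> r"
  shows "definable Sg T \<Delta> (\<lambda>M xs. Q M (map (\<lambda>i. xs ! r i) [0..<length \<Gamma>]))"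
proof -
  obtain \<theta> where \<theta>: "wf_fm Sg \<Gamma> \<theta>"
    "\<forall>M \<in> models Sg T. \<forall>xs \<in> tuples M \<Gamma>. sat M xs \<theta> \<longleftrightarrow> Q M xs"
    using Q unfolding definable_def by blast
  have "sat M xs (ren_fm r \<theta>) \<longleftrightarrow> Q M (map (\<lambda>i. xs ! r i) [0..<length \<Gamma>])"
    if "M \<in> models Sg T" "xs \<in> tuples M \<Delta>" for M xs
  proof -
    have "sat M xs (ren_fm r \<theta>) \<longleftrightarrow> sat M (map (\<lambda>i. xs ! r i) [0..<length \<Gamma>]) \<theta>"
      by (rule sat_ren[OF \<theta>(1)]) simp
    also have "\<dots> \<longleftrightarrow> Q M (map (\<lambda>i. xs ! r i) [0..<length \<Gamma>])"
      using \<theta>(2) that(1) tuples_ren[OF r that(2)] by blast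
    finally show ?thesis .
  qed
  then show ?thesis unfolding definable_def using wf_fm_ren[OF \<theta>(1) r] by blast
qed

lemma definable_eqs:
  fixes T :: "('s, 'f, 'p) sequent set"
  assumes "\<And>i j. (i, j) \<in> set ps \<Longrightarrow> i < length \<Gamma> \<and> j < length \<Gamma> \<and> \<Gamma> ! i = \<Gamma> ! j"
  shows "definable Sg T \<Gamma> (\<lambda>(M :: ('s, 'f, 'p, 'u) interp) xs. \<forall>(i, j) \<in> set ps. xs ! i = xs ! j)"
  using assms
proof (induction ps)
  case Nil
  show ?case using definable_sat[of Sg \<Gamma> Top] by simp
next
  case (Cons p ps)
  obtain i j where [simp]: "p = (i, j)" by (cases p)
  have ij: "i < length \<Gamma>" "j < length \<Gamma>" "\<Gamma> ! i = \<Gamma> ! j"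
    using Cons.prems[of i j] by simp_all
  have "wf_fm Sg \<Gamma> (Eq (Var i) (Var j))"
    using tm_sort.intros(1)[OF ij(1), of Sg] tm_sort.intros(1)[OF ij(2), of Sg] ij(3) by auto
  then have eq: "definable Sg T \<Gamma> (\<lambda>(M :: ('s, 'f, 'p, 'u) interp) xs. sat M xs (Eq (Var i) (Var j)))"
    by (rule definable_sat)
  have "definable Sg T \<Gamma> (\<lambda>(M :: ('s, 'f, 'p, 'u) interp) xs. \<forall>(i, j) \<in> set ps. xs ! i = xs ! j)"
    by (rule Cons.IH, rule Cons.prems) simp
  from definable_conj[OF eq this] show ?case by simp
qed

lemma definable_take:
  fixes Q :: "('s, 'f, 'p, 'u) interp \<Rightarrow> 'u list \<Rightarrow> bool"
  assumes "definable Sg T \<Gamma> Q"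
  shows "definable Sg T (\<Gamma> @ \<Delta>) (\<lambda>M xs. Q M (take (length \<Gamma>) xs))"
proof (rule definable_cong[OF definable_ren[OF assms, of _ "\<lambda>i. i"]])
  fix M :: "('s, 'f, 'p, 'u) interp" and xs assume "xs \<in> tuples M (\<Gamma> @ \<Delta>)"
  then have "map (\<lambda>i. xs ! i) [0..<length \<Gamma>] = take (length \<Gamma>) xs"
    using tuples_length[of xs M "\<Gamma> @ \<Delta>"] by (auto intro: nth_equalityI)
  then show "Q M (map (\<lambda>i. xs ! i) [0..<length \<Gamma>]) \<longleftrightarrow> Q M (take (length \<Gamma>) xs)" by simp
qed (auto simp: ren_ok_def nth_append)

lemma definable_drop:
  fixes Q :: "('s, 'f, 'p, 'u) interp \<Rightarrow> 'u list \<Rightarrow> bool"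
  assumes "definable Sg T \<Delta> Q"
  shows "definable Sg T (\<Gamma> @ \<Delta>) (\<lambda>M xs. Q M (drop (length \<Gamma>) xs))"
proof (rule definable_cong[OF definable_ren[OF assms, of _ "\<lambda>i. length \<Gamma> + i"]])
  fix M :: "('s, 'f, 'p, 'u) interp" and xs assume "xs \<in> tuples M (\<Gamma> @ \<Delta>)"
  then have "map (\<lambda>i. xs ! (length \<Gamma> + i)) [0..<length \<Delta>] = drop (length \<Gamma>) xs"
    using tuples_length[of xs M "\<Gamma> @ \<Delta>"] by (auto intro: nth_equalityI)
  then show "Q M (map (\<lambda>i. xs ! (length \<Gamma> + i)) [0..<length \<Delta>]) \<longleftrightarrow> Q M (drop (length \<Gamma>) xs)" by simp
qed (auto simp: ren_ok_def nth_append)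

lemma definable_swap:
  fixes Q :: "('s, 'f, 'p, 'u) interp \<Rightarrow> 'u list \<Rightarrow> bool"
  assumes "definable Sg T (\<Delta> @ \<Gamma>) Q"
  shows "definable Sg T (\<Gamma> @ \<Delta>) (\<lambda>M zs. Q M (drop (length \<Gamma>) zs @ take (length \<Gamma>) zs))"
proof -
  let ?r = "\<lambda>i. if i < length \<Delta> then length \<Gamma> + i else i - length \<Delta>"
  show ?thesis
  proof (rule definable_cong[OF definable_ren[OF assms, of _ ?r]])
    fix M :: "('s, 'f, 'p, 'u) interp" and zs assume "zs \<in> tuples M (\<Gamma> @ \<Delta>)"
    then have "map (\<lambda>i. zs ! ?r i) [0..<length (\<Delta> @ \<Gamma>)] = drop (length \<Gamma>) zs @ take (length \<Gamma>) zs"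
      using tuples_length[of zs M "\<Gamma> @ \<Delta>"] by (intro nth_equalityI) (auto simp: nth_append)
    then show "Q M (map (\<lambda>i. zs ! ?r i) [0..<length (\<Delta> @ \<Gamma>)]) \<longleftrightarrow>
        Q M (drop (length \<Gamma>) zs @ take (length \<Gamma>) zs)" by simp
  qed (auto simp: ren_ok_def nth_append)
qed

section \<open>Definable relations between two contexts\<close>

definition definable_rel :: "('s, 'f, 'p) signature \<Rightarrow> ('s, 'f, 'p) sequent set \<Rightarrow> 's list \<Rightarrow> 's list \<Rightarrow>
    (('s, 'f, 'p, 'u) interp \<Rightarrow> 'u list \<Rightarrow> 'u list \<Rightarrow> bool) \<Rightarrow> bool" where
  "definable_rel Sg T \<Gamma> \<Delta> Q \<longleftrightarrow> (\<exists>\<theta>. wf_fm Sg (\<Gamma> @ \<Delta>) \<theta> \<and>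
     (\<forall>M \<in> models Sg T. \<forall>xs \<in> tuples M \<Gamma>. \<forall>ys \<in> tuples M \<Delta>. sat M (xs @ ys) \<theta> \<longleftrightarrow> Q M xs ys))"

lemma definable_rel_iff:
  fixes Q :: "('s, 'f, 'p, 'u) interp \<Rightarrow> 'u list \<Rightarrow> 'u list \<Rightarrow> bool"
  shows
  "definable_rel Sg T \<Gamma> \<Delta> Q \<longleftrightarrow>
    definable Sg T (\<Gamma> @ \<Delta>) (\<lambda>M zs. Q M (take (length \<Gamma>) zs) (drop (length \<Gamma>) zs))"
proof -
  have "(\<forall>xs \<in> tuples M \<Gamma>. \<forall>ys \<in> tuples M \<Delta>. sat M (xs @ ys) \<theta> \<longleftrightarrow> Q M xs ys) \<longleftrightarrow>
    (\<forall>zs \<in> tuples M (\<Gamma> @ \<Delta>). sat M zs \<theta> \<longleftrightarrow> Q M (take (length \<Gamma>) zs) (drop (length \<Gamma>) zs))"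
    for M :: "('s, 'f, 'p, 'u) interp" and \<theta>
  proof (rule iffI; intro ballI)
    fix zs
    assume "\<forall>xs \<in> tuples M \<Gamma>. \<forall>ys \<in> tuples M \<Delta>. sat M (xs @ ys) \<theta> \<longleftrightarrow> Q M xs ys"
      and "zs \<in> tuples M (\<Gamma> @ \<Delta>)"
    then have "sat M (take (length \<Gamma>) zs @ drop (length \<Gamma>) zs) \<theta> \<longleftrightarrow>
        Q M (take (length \<Gamma>) zs) (drop (length \<Gamma>) zs)"
      unfolding tuples_append by blast
    then show "sat M zs \<theta> \<longleftrightarrow> Q M (take (length \<Gamma>) zs) (drop (length \<Gamma>) zs)" by simp
  next
    fix xs ys
    assume *: "\<forall>zs \<in> tuples M (\<Gamma> @ \<Delta>). sat M zs \<theta> \<longleftrightarrow> Q M (take (length \<Gamma>) zs) (drop (length \<Gamma>) zs)"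
      and xs: "xs \<in> tuples M \<Gamma>" and ys: "ys \<in> tuples M \<Delta>"
    have "sat M (xs @ ys) \<theta> \<longleftrightarrow> Q M (take (length \<Gamma>) (xs @ ys)) (drop (length \<Gamma>) (xs @ ys))"
      by (rule bspec[OF * tuples_appendI[OF xs ys]])
    then show "sat M (xs @ ys) \<theta> \<longleftrightarrow> Q M xs ys" by (simp add: tuples_length[OF xs])
  qed
  then show ?thesis unfolding definable_rel_def definable_def by (simp only:)
qed

lemma definable_rel_cong:
  "definable_rel Sg T \<Gamma> \<Delta> Q \<Longrightarrow>
    (\<And>M xs ys. M \<in> models Sg T \<Longrightarrow> xs \<in> tuples M \<Gamma> \<Longrightarrow> ys \<in> tuples M \<Delta> \<Longrightarrow> Q M xs ys \<longleftrightarrow> Q' M xs ys) \<Longrightarrow>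
    definable_rel Sg T \<Gamma> \<Delta> Q'"
  unfolding definable_rel_def by metis

lemma definable_rel_swap:
  fixes Q :: "('s, 'f, 'p, 'u) interp \<Rightarrow> 'u list \<Rightarrow> 'u list \<Rightarrow> bool"
  assumes "definable_rel Sg T \<Delta> \<Gamma> Q"
  shows "definable_rel Sg T \<Gamma> \<Delta> (\<lambda>M xs ys. Q M ys xs)"
proof -
  have "definable Sg T (\<Delta> @ \<Gamma>) (\<lambda>M zs. Q M (take (length \<Delta>) zs) (drop (length \<Delta>) zs))"
    using assms by (simp add: definable_rel_iff)
  from definable_swap[OF this] show ?thesis
    unfolding definable_rel_iff by (rule definable_cong) (auto dest: tuples_length)
qed

text \<open>\<open>definable_ex\<close> quantifies a prefix of the context, so both predicates are
  transported to the context \<open>\<Delta> @ \<Gamma> @ \<Theta>\<close>: \<open>Q\<close> by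
  exchange and weakening on the right, \<open>R\<close> by exchange, weakening on the left and a
  rotation that brings \<Delta> to the front.\<close>

lemma definable_rel_comp:
  fixes Q R :: "('s, 'f, 'p, 'u) interp \<Rightarrow> 'u list \<Rightarrow> 'u list \<Rightarrow> bool"
  assumes Q: "definable_rel Sg T \<Gamma> \<Delta> Q" and R: "definable_rel Sg T \<Delta> \<Theta> R"
  shows "definable_rel Sg T \<Gamma> \<Theta> (\<lambda>M xs zs. \<exists>ys \<in> tuples M \<Delta>. Q M xs ys \<and> R M ys zs)"
proof -
  let ?d = "length \<Delta>" and ?g = "length \<Gamma>"
  have "definable Sg T (\<Delta> @ \<Gamma>) (\<lambda>M zs. Q M (drop ?d zs) (take ?d zs))"
    using definable_rel_swap[OF Q] by (simp add: definable_rel_iff)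
  from definable_take[OF this, of \<Theta>]
  have 1: "definable Sg T (\<Delta> @ \<Gamma> @ \<Theta>) (\<lambda>M ws. Q M (take ?g (drop ?d ws)) (take ?d ws))"
    by (simp add: take_drop min_def add.commute)
  have "definable Sg T (\<Theta> @ \<Delta>) (\<lambda>M zs. R M (drop (length \<Theta>) zs) (take (length \<Theta>) zs))"
    using definable_rel_swap[OF R] by (simp add: definable_rel_iff)
  from definable_drop[OF this, of \<Gamma>]
  have "definable Sg T ((\<Gamma> @ \<Theta>) @ \<Delta>)
      (\<lambda>M ws. R M (drop (length \<Theta>) (drop ?g ws)) (take (length \<Theta>) (drop ?g ws)))"
    by (simp only: append_assoc)
  from definable_swap[OF this]
  have 2: "definable Sg T (\<Delta> @ \<Gamma> @ \<Theta>) (\<lambda>M ws. R M (take ?d ws) (drop (?d + ?g) ws))"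
  proof (rule definable_cong)
    fix M :: "('s, 'f, 'p, 'u) interp" and ws assume "ws \<in> tuples M (\<Delta> @ \<Gamma> @ \<Theta>)"
    then have len: "length ws = ?d + (?g + length \<Theta>)" using tuples_length by fastforce
    have "drop (length \<Theta>) (drop ?g (drop ?d ws @ take ?d ws)) = take ?d ws"
      "take (length \<Theta>) (drop ?g (drop ?d ws @ take ?d ws)) = drop (?d + ?g) ws"
      using len by (simp_all add: add.commute)
    then show "R M (drop (length \<Theta>) (drop ?g (drop ?d ws @ take ?d ws)))
        (take (length \<Theta>) (drop ?g (drop ?d ws @ take ?d ws))) \<longleftrightarrow> R M (take ?d ws) (drop (?d + ?g) ws)"
      by simp
  qed
  from definable_ex[OF definable_conj[OF 1 2]] show ?thesis
    unfolding definable_rel_iff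
  proof (rule definable_cong)
    fix M :: "('s, 'f, 'p, 'u) interp" and zs
    have "take ?g (drop ?d (ys @ zs)) = take ?g zs" "take ?d (ys @ zs) = ys"
      "drop (?d + ?g) (ys @ zs) = drop ?g zs" if "ys \<in> tuples M \<Delta>" for ys
      using tuples_length[OF that] by simp_all
    then show "(\<exists>ys \<in> tuples M \<Delta>. Q M (take ?g (drop ?d (ys @ zs))) (take ?d (ys @ zs)) \<and>
        R M (take ?d (ys @ zs)) (drop (?d + ?g) (ys @ zs))) \<longleftrightarrow>
      (\<exists>ys \<in> tuples M \<Delta>. Q M (take ?g zs) ys \<and> R M ys (drop ?g zs))"
      by (intro bex_cong refl) (simp only:)
  qed
qed

text \<open>The graph of a slice is a finite conjunction of equations between variables. Offset 0
  gives identities and first projections; the length of the first block as offset gives second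
  projections.\<close>

lemma definable_rel_graph_nth:
  fixes T :: "('s, 'f, 'p) sequent set"
  assumes "length \<Delta> + n \<le> length \<Gamma>" "take (length \<Delta>) (drop n \<Gamma>) = \<Delta>" 
  shows "definable_rel Sg T \<Gamma> \<Delta> (\<lambda>(M :: ('s, 'f, 'p, 'u) interp) xs ys. ys = take (length \<Delta>) (drop n xs))"
proof -
  have nth: "\<Gamma> ! (n + i) = \<Delta> ! i" if "i < length \<Delta>" for i
    using assms that by (metis nth_take nth_drop add_leD2 add.commute)
  have "definable Sg T (\<Gamma> @ \<Delta>) (\<lambda>(M :: ('s, 'f, 'p, 'u) interp) xs. \<forall>(i, j) \<in> set (map (\<lambda>i. (length \<Gamma> + i, n + i)) [0..<length \<Delta>]). xs ! i = xs ! j)"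
    by (rule definable_eqs) (use assms nth in \<open>auto simp: nth_append\<close>)
  then show ?thesis
    unfolding definable_rel_iff
  proof (rule definable_cong)
    fix M :: "('s, 'f, 'p, 'u) interp" and xs assume "xs \<in> tuples M (\<Gamma> @ \<Delta>)"
    then have len: "length xs = length \<Gamma> + length \<Delta>" by (simp add: tuples_length)
    have "(\<forall>(i, j) \<in> set (map (\<lambda>i. (length \<Gamma> + i, n + i)) [0..<length \<Delta>]). xs ! i = xs ! j) \<longleftrightarrow>
        (\<forall>i < length \<Delta>. xs ! (length \<Gamma> + i) = xs ! (n + i))"
      by (simp add: atLeast0LessThan lessThan_def)
    also have "\<dots> \<longleftrightarrow> drop (length \<Gamma>) xs = take (length \<Delta>) (drop n (take (length \<Gamma>) xs))"
      unfolding list_eq_iff_nth_eq using assms(1) len by simp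
    finally show "(\<forall>(i, j) \<in> set (map (\<lambda>i. (length \<Gamma> + i, n + i)) [0..<length \<Delta>]). xs ! i = xs ! j) \<longleftrightarrow>
        drop (length \<Gamma>) xs = take (length \<Delta>) (drop n (take (length \<Gamma>) xs))" .
  qed
qed

subsection \<open>The site axioms\<close>

lemma definable_rel_conj:
  "definable_rel Sg T \<Gamma> \<Delta> Q \<Longrightarrow> definable_rel Sg T \<Gamma> \<Delta> Q' \<Longrightarrow>
    definable_rel Sg T \<Gamma> \<Delta> (\<lambda>M xs ys. Q M xs ys \<and> Q' M xs ys)"
  unfolding definable_rel_iff by (rule definable_conj)

lemma ext_tuples: "xs \<in> ext M X \<Longrightarrow> xs \<in> tuples M (fst X)"
  by (simp add: ext_def)

lemma definable_rel_ext:
  assumes "wf_fm Sg (fst X) (snd X)"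
  shows "definable_rel Sg T (fst X) \<Delta> (\<lambda>(M :: ('s, 'f, 'p, 'u) interp) xs ys. xs \<in> ext M X)"
proof -
  have "definable_rel Sg T (fst X) \<Delta> (\<lambda>(M :: ('s, 'f, 'p, 'u) interp) xs ys. sat M xs (snd X))"
    unfolding definable_rel_iff by (rule definable_take[OF definable_sat[OF assms]])
  then show ?thesis by (rule definable_rel_cong) (simp add: ext_def)
qed

section \<open>Functional predicates and the arrows they name\<close>

definition functional_rel :: "('s, 'f, 'p) signature \<Rightarrow> ('s, 'f, 'p) sequent set \<Rightarrow>
    ('s, 'f, 'p) obj \<Rightarrow> ('s, 'f, 'p) obj \<Rightarrow>
    (('s, 'f, 'p, 'u) interp \<Rightarrow> 'u list \<Rightarrow> 'u list \<Rightarrow> bool) \<Rightarrow> bool" where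
  "functional_rel Sg T X Y Q \<longleftrightarrow> definable_rel Sg T (fst X) (fst Y) Q \<and>
     (\<forall>M \<in> models Sg T.
        (\<forall>xs \<in> tuples M (fst X). \<forall>ys \<in> tuples M (fst Y). Q M xs ys \<longrightarrow> xs \<in> ext M X \<and> ys \<in> ext M Y) \<and>
        (\<forall>xs \<in> ext M X. \<exists>!ys. ys \<in> ext M Y \<and> Q M xs ys))"

lemma functional_relI:
  assumes "definable_rel Sg T (fst X) (fst Y) Q"
    and "\<And>M xs ys. M \<in> models Sg T \<Longrightarrow> xs \<in> tuples M (fst X) \<Longrightarrow> ys \<in> tuples M (fst Y) \<Longrightarrow> Q M xs ys \<Longrightarrow>
      xs \<in> ext M X \<and> ys \<in> ext M Y"
    and "\<And>M xs. M \<in> models Sg T \<Longrightarrow> xs \<in> ext M X \<Longrightarrow> \<exists>ys \<in> ext M Y. Q M xs ys"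
    and "\<And>M xs ys ys'. M \<in> models Sg T \<Longrightarrow> xs \<in> ext M X \<Longrightarrow> ys \<in> ext M Y \<Longrightarrow> ys' \<in> ext M Y \<Longrightarrow>
      Q M xs ys \<Longrightarrow> Q M xs ys' \<Longrightarrow> ys = ys'"
  shows "functional_rel Sg T X Y Q"
  unfolding functional_rel_def
proof (intro conjI ballI impI)
  show "\<exists>!ys. ys \<in> ext M Y \<and> Q M xs ys" if "M \<in> models Sg T" "xs \<in> ext M X" for M xs
    using assms(3,4)[OF that] by blast
qed (use assms(1,2) in blast)+

text \<open>Names an arrow by a predicate that defines it. Predicates that agree in all models name
  the same arrow, which is how equations between arrows are proved.\<close>

definition mk_arr :: "('s, 'f, 'p) signature \<Rightarrow> ('s, 'f, 'p) sequent set \<Rightarrow> ('s, 'f, 'p) obj \<Rightarrow>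
    (('s, 'f, 'p, 'u) interp \<Rightarrow> 'u list \<Rightarrow> 'u list \<Rightarrow> bool) \<Rightarrow> ('s, 'f, 'p) obj \<Rightarrow> ('s, 'f, 'p) arr" where
  "mk_arr Sg T X Q Y = (X, fm_class Sg T (fst X) (fst Y) Q, Y)"

lemma fm_class_cong:
  assumes "\<And>M xs ys. M \<in> models Sg T \<Longrightarrow> xs \<in> tuples M \<Gamma> \<Longrightarrow> ys \<in> tuples M \<Delta> \<Longrightarrow> Q M xs ys \<longleftrightarrow> Q' M xs ys"
  shows "fm_class Sg T \<Gamma> \<Delta> Q = fm_class Sg T \<Gamma> \<Delta> Q'"
  unfolding fm_class_def using assms by (intro Collect_cong conj_cong refl ball_cong) simp

lemma mk_arr_cong:
  "(\<And>M xs ys. M \<in> models Sg T \<Longrightarrow> xs \<in> tuples M (fst X) \<Longrightarrow> ys \<in> tuples M (fst Y) \<Longrightarrow> Q M xs ys \<longleftrightarrow> Q' M xs ys) \<Longrightarrow>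
    mk_arr Sg T X Q Y = mk_arr Sg T X Q' Y"
  unfolding mk_arr_def using fm_class_cong[of Sg T "fst X" "fst Y" Q Q'] by simp

text \<open>\<open>arr_rel\<close> asks for some formula of the class. Definability makes the class
  nonempty, and all its members agree with \<open>Q\<close> in models.\<close>

lemma arr_rel_mk_arr:
  assumes Q: "definable_rel Sg T (fst X) (fst Y) Q" and M: "M \<in> models Sg T"
    and xs: "xs \<in> tuples M (fst X)" and ys: "ys \<in> tuples M (fst Y)"
  shows "arr_rel (mk_arr Sg T X Q Y) M xs ys \<longleftrightarrow> Q M xs ys"
proof -
  obtain \<theta> where "\<theta> \<in> fm_class Sg T (fst X) (fst Y) Q"
    using Q unfolding definable_rel_def fm_class_def by blast
  moreover have "sat M (xs @ ys) \<theta>' \<longleftrightarrow> Q M xs ys" if "\<theta>' \<in> fm_class Sg T (fst X) (fst Y) Q" for \<theta>'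
    using that M xs ys unfolding fm_class_def by blast
  ultimately show ?thesis unfolding arr_rel_def mk_arr_def by auto
qed

section \<open>Arrows, composition and covers of the syntactic site\<close>

context
  fixes Sg :: "('s, 'f, 'p) signature" and T :: "('s, 'f, 'p) sequent set"
    and C :: "(('s, 'f, 'p) obj, ('s, 'f, 'p) arr) site"
  assumes C_def: "C = syn_site Sg T TYPE('u)"
begin

lemma syn_site_simps:
  "X \<in> Ob C \<longleftrightarrow> wf_fm Sg (fst X) (snd X)"
  "dm C a = fst a" "cd C a = snd (snd a)"
  by (simp_all add: C_def syn_site_def Let_def)

lemma syn_site_Ar:
  "a \<in> Ar C \<longleftrightarrow> (\<exists>X Y \<theta>. a = mk_arr Sg T X (\<lambda>(M :: ('s, 'f, 'p, 'u) interp) xs ys. sat M (xs @ ys) \<theta>) Y \<and>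
     wf_fm Sg (fst X) (snd X) \<and> wf_fm Sg (fst Y) (snd Y) \<and> functional Sg T TYPE('u) X Y \<theta>)"
  unfolding C_def syn_site_def Let_def mk_arr_def site.simps mem_Collect_eq by (rule refl)

lemma mk_arr_arrows:
  fixes Q :: "('s, 'f, 'p, 'u) interp \<Rightarrow> 'u list \<Rightarrow> 'u list \<Rightarrow> bool"
  assumes X: "X \<in> Ob C" and Y: "Y \<in> Ob C" and Q: "functional_rel Sg T X Y Q"
  shows "mk_arr Sg T X Q Y \<in> arrows C X Y"
proof -
  obtain \<theta> where \<theta>: "wf_fm Sg (fst X @ fst Y) \<theta>"
    and eq: "\<And>M xs ys. M \<in> models Sg T \<Longrightarrow> xs \<in> tuples M (fst X) \<Longrightarrow> ys \<in> tuples M (fst Y) \<Longrightarrow>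
      sat M (xs @ ys) \<theta> \<longleftrightarrow> Q M xs ys"
    using Q unfolding functional_rel_def definable_rel_def by metis
  have "functional Sg T TYPE('u) X Y \<theta>"
    unfolding functional_def
  proof (intro conjI ballI impI)
    fix M :: "('s, 'f, 'p, 'u) interp" and xs ys
    assume "M \<in> models Sg T" "xs \<in> tuples M (fst X)" "ys \<in> tuples M (fst Y)" "sat M (xs @ ys) \<theta>"
    then show "xs \<in> ext M X" "ys \<in> ext M Y" using Q eq unfolding functional_rel_def by blast+
  next
    fix M :: "('s, 'f, 'p, 'u) interp" and xs assume M: "M \<in> models Sg T" and xs: "xs \<in> ext M X"
    have "ys \<in> ext M Y \<and> sat M (xs @ ys) \<theta> \<longleftrightarrow> ys \<in> ext M Y \<and> Q M xs ys" for ys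
      using eq[OF M ext_tuples[OF xs] ext_tuples] by blast
    moreover have "\<exists>!ys. ys \<in> ext M Y \<and> Q M xs ys"
      using Q M xs unfolding functional_rel_def by blast
    ultimately show "\<exists>!ys. ys \<in> ext M Y \<and> sat M (xs @ ys) \<theta>" by (simp only:)
  qed (rule \<theta>)
  moreover have "mk_arr Sg T X Q Y =
      mk_arr Sg T X (\<lambda>(M :: ('s, 'f, 'p, 'u) interp) xs ys. sat M (xs @ ys) \<theta>) Y"
    by (rule mk_arr_cong, rule eq[symmetric])
  moreover have "wf_fm Sg (fst X) (snd X)" "wf_fm Sg (fst Y) (snd Y)" using X Y by (simp_all add: syn_site_simps)
  ultimately have "mk_arr Sg T X Q Y \<in> Ar C" unfolding syn_site_Ar by blast
  then show ?thesis by (simp add: arrows_def syn_site_simps mk_arr_def)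
qed

text \<open>Every arrow is named by its own \<open>arr_rel\<close>, so arguments about arrows become
  arguments about functional definable predicates.\<close>

lemma arrowsD:
  assumes a: "a \<in> arrows C X Y"
  shows "X \<in> Ob C" "Y \<in> Ob C"
    and "functional_rel Sg T X Y (arr_rel a :: ('s, 'f, 'p, 'u) interp \<Rightarrow> _)"
    and "a = mk_arr Sg T X (arr_rel a :: ('s, 'f, 'p, 'u) interp \<Rightarrow> _) Y"
proof -
  have "a \<in> Ar C" "fst a = X" "snd (snd a) = Y" using a by (simp_all add: arrows_def syn_site_simps)
  then obtain \<theta> where a_eq: "a = mk_arr Sg T X (\<lambda>(M :: ('s, 'f, 'p, 'u) interp) xs ys. sat M (xs @ ys) \<theta>) Y"
    and XY: "wf_fm Sg (fst X) (snd X)" "wf_fm Sg (fst Y) (snd Y)" and \<theta>: "functional Sg T TYPE('u) X Y \<theta>"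
    unfolding syn_site_Ar by (auto simp: mk_arr_def)
  show "X \<in> Ob C" "Y \<in> Ob C" using XY by (simp_all add: syn_site_simps)
  have def: "definable_rel Sg T (fst X) (fst Y) (\<lambda>(M :: ('s, 'f, 'p, 'u) interp) xs ys. sat M (xs @ ys) \<theta>)"
    using \<theta> unfolding functional_def definable_rel_def by blast
  have eq: "arr_rel a M xs ys \<longleftrightarrow> sat M (xs @ ys) \<theta>"
    if "M \<in> models Sg T" "xs \<in> tuples M (fst X)" "ys \<in> tuples M (fst Y)"
    for M :: "('s, 'f, 'p, 'u) interp" and xs ys
    unfolding a_eq by (rule arr_rel_mk_arr[OF def that])
  have "mk_arr Sg T X (arr_rel a :: ('s, 'f, 'p, 'u) interp \<Rightarrow> _) Y =
      mk_arr Sg T X (\<lambda>(M :: ('s, 'f, 'p, 'u) interp) xs ys. sat M (xs @ ys) \<theta>) Y"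
    by (rule mk_arr_cong, rule eq)
  then show "a = mk_arr Sg T X (arr_rel a :: ('s, 'f, 'p, 'u) interp \<Rightarrow> _) Y"
    by (simp only: a_eq[symmetric])
  show "functional_rel Sg T X Y (arr_rel a :: ('s, 'f, 'p, 'u) interp \<Rightarrow> _)"
  proof (rule functional_relI)
    show "definable_rel Sg T (fst X) (fst Y) (arr_rel a :: ('s, 'f, 'p, 'u) interp \<Rightarrow> _)"
      by (rule definable_rel_cong[OF def]) (simp add: eq)
  next
    fix M :: "('s, 'f, 'p, 'u) interp" and xs ys
    assume "M \<in> models Sg T" "xs \<in> tuples M (fst X)" "ys \<in> tuples M (fst Y)" "arr_rel a M xs ys"
    then show "xs \<in> ext M X \<and> ys \<in> ext M Y" using \<theta> eq unfolding functional_def by blast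
  next
    fix M :: "('s, 'f, 'p, 'u) interp" and xs assume M: "M \<in> models Sg T" and xs: "xs \<in> ext M X"
    then obtain ys where "ys \<in> ext M Y" "sat M (xs @ ys) \<theta>" using \<theta> unfolding functional_def by blast
    then show "\<exists>ys \<in> ext M Y. arr_rel a M xs ys" using eq[OF M ext_tuples[OF xs] ext_tuples] by blast
  next
    fix M :: "('s, 'f, 'p, 'u) interp" and xs ys ys'
    assume M: "M \<in> models Sg T" and xs: "xs \<in> ext M X" and ys: "ys \<in> ext M Y" "ys' \<in> ext M Y"
      and "arr_rel a M xs ys" "arr_rel a M xs ys'"
    then have "sat M (xs @ ys) \<theta>" "sat M (xs @ ys') \<theta>" using eq[OF M ext_tuples[OF xs] ext_tuples] by blast+
    moreover have "\<exists>!ys. ys \<in> ext M Y \<and> sat M (xs @ ys) \<theta>" using \<theta> M xs unfolding functional_def by blast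
    ultimately show "ys = ys'" using ys by blast
  qed
qed

lemma arr_rel_ext:
  fixes M :: "('s, 'f, 'p, 'u) interp"
  assumes "a \<in> arrows C X Y" "M \<in> models Sg T" "xs \<in> tuples M (fst X)" "ys \<in> tuples M (fst Y)" "arr_rel a M xs ys"
  shows "xs \<in> ext M X" "ys \<in> ext M Y"
  using arrowsD(3)[OF assms(1)] assms(2-) unfolding functional_rel_def by blast+

lemma arr_rel_total:
  fixes M :: "('s, 'f, 'p, 'u) interp"
  assumes "a \<in> arrows C X Y" "M \<in> models Sg T" "xs \<in> ext M X"
  shows "\<exists>ys \<in> ext M Y. arr_rel a M xs ys"
  using arrowsD(3)[OF assms(1)] assms(2-) unfolding functional_rel_def by blast

lemma arr_rel_unique:
  fixes M :: "('s, 'f, 'p, 'u) interp"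
  assumes a: "a \<in> arrows C X Y" and M: "M \<in> models Sg T" and xs: "xs \<in> tuples M (fst X)"
    and ys: "ys \<in> tuples M (fst Y)" "ys' \<in> tuples M (fst Y)" "arr_rel a M xs ys" "arr_rel a M xs ys'"
  shows "ys = ys'"
proof -
  have "xs \<in> ext M X" "ys \<in> ext M Y" "ys' \<in> ext M Y"
    using arr_rel_ext[OF a M xs ys(1,3)] arr_rel_ext[OF a M xs ys(2,4)] by blast+
  moreover have "\<exists>!ys. ys \<in> ext M Y \<and> arr_rel a M xs ys"
    using arrowsD(3)[OF a] M \<open>xs \<in> ext M X\<close> unfolding functional_rel_def by blast
  ultimately show ?thesis using ys by blast
qed

lemma arrows_definable:
  "a \<in> arrows C X Y \<Longrightarrow> definable_rel Sg T (fst X) (fst Y) (arr_rel a :: ('s, 'f, 'p, 'u) interp \<Rightarrow> _)"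
  using arrowsD(3) unfolding functional_rel_def by blast

lemma functional_rel_cmp:
  assumes a: "a \<in> arrows C X Y" and b: "b \<in> arrows C Y Z"
  shows "functional_rel Sg T X Z (\<lambda>(M :: ('s, 'f, 'p, 'u) interp) xs zs.
      \<exists>ys \<in> tuples M (fst Y). arr_rel a M xs ys \<and> arr_rel b M ys zs)"
proof (rule functional_relI)
  show "definable_rel Sg T (fst X) (fst Z) (\<lambda>(M :: ('s, 'f, 'p, 'u) interp) xs zs.
      \<exists>ys \<in> tuples M (fst Y). arr_rel a M xs ys \<and> arr_rel b M ys zs)"
    by (rule definable_rel_comp[OF arrows_definable[OF a] arrows_definable[OF b]])
next
  fix M :: "('s, 'f, 'p, 'u) interp" and xs zs
  assume "M \<in> models Sg T" "xs \<in> tuples M (fst X)" "zs \<in> tuples M (fst Z)"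
    "\<exists>ys \<in> tuples M (fst Y). arr_rel a M xs ys \<and> arr_rel b M ys zs"
  then show "xs \<in> ext M X \<and> zs \<in> ext M Z" using arr_rel_ext[OF a] arr_rel_ext[OF b] by blast
next
  fix M :: "('s, 'f, 'p, 'u) interp" and xs assume M: "M \<in> models Sg T" and xs: "xs \<in> ext M X"
  obtain ys where ys: "ys \<in> ext M Y" "arr_rel a M xs ys" using arr_rel_total[OF a M xs] by blast
  obtain zs where "zs \<in> ext M Z" "arr_rel b M ys zs" using arr_rel_total[OF b M ys(1)] by blast
  then show "\<exists>zs \<in> ext M Z. \<exists>ys \<in> tuples M (fst Y). arr_rel a M xs ys \<and> arr_rel b M ys zs"
    using ys ext_tuples by blast
next
  fix M :: "('s, 'f, 'p, 'u) interp" and xs zs zs'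
  assume M: "M \<in> models Sg T" and xs: "xs \<in> ext M X" and zs: "zs \<in> ext M Z" "zs' \<in> ext M Z"
    and "\<exists>ys \<in> tuples M (fst Y). arr_rel a M xs ys \<and> arr_rel b M ys zs"
    and "\<exists>ys \<in> tuples M (fst Y). arr_rel a M xs ys \<and> arr_rel b M ys zs'"
  then obtain ys ys' where "ys \<in> tuples M (fst Y)" "arr_rel a M xs ys" "arr_rel b M ys zs"
    "ys' \<in> tuples M (fst Y)" "arr_rel a M xs ys'" "arr_rel b M ys' zs'" by blast
  moreover from this have "ys = ys'" using arr_rel_unique[OF a M ext_tuples[OF xs]] by blast
  ultimately show "zs = zs'" using arr_rel_unique[OF b M _ ext_tuples ext_tuples] zs by blast
qed

lemma syn_site_cmp:
  assumes a: "a \<in> arrows C X Y" and b: "b \<in> arrows C Y Z"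
  shows "cmp C b a = mk_arr Sg T X (\<lambda>(M :: ('s, 'f, 'p, 'u) interp) xs zs.
      \<exists>ys \<in> tuples M (fst Y). arr_rel a M xs ys \<and> arr_rel b M ys zs) Z"
  using a b by (simp add: arrows_def C_def syn_site_def Let_def mk_arr_def)

lemma arr_rel_cmp:
  fixes M :: "('s, 'f, 'p, 'u) interp"
  assumes "a \<in> arrows C X Y" "b \<in> arrows C Y Z" "M \<in> models Sg T" "xs \<in> tuples M (fst X)" "zs \<in> tuples M (fst Z)"
  shows "arr_rel (cmp C b a) M xs zs \<longleftrightarrow> (\<exists>ys \<in> tuples M (fst Y). arr_rel a M xs ys \<and> arr_rel b M ys zs)"
  unfolding syn_site_cmp[OF assms(1,2)]
  using arr_rel_mk_arr[OF _ assms(3-5)] functional_rel_cmp[OF assms(1,2)] unfolding functional_rel_def by blast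

lemma functional_rel_slice:
  assumes X: "X \<in> Ob C" and le: "length (fst Y) + n \<le> length (fst X)"
    and sl: "take (length (fst Y)) (drop n (fst X)) = fst Y"
    and ext: "\<And>(M :: ('s, 'f, 'p, 'u) interp) xs. M \<in> models Sg T \<Longrightarrow> xs \<in> ext M X \<Longrightarrow>
      take (length (fst Y)) (drop n xs) \<in> ext M Y"
  shows "functional_rel Sg T X Y (\<lambda>(M :: ('s, 'f, 'p, 'u) interp) xs ys.
      xs \<in> ext M X \<and> ys = take (length (fst Y)) (drop n xs))"
  by (rule functional_relI, rule definable_rel_conj[OF definable_rel_ext definable_rel_graph_nth[OF le sl]])
    (use X ext in \<open>auto simp: syn_site_simps\<close>)

text \<open>Equality of tuples is rewritten as the slice at offset 0, which brings identities under
  \<open>functional_rel_slice\<close>.\<close>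

lemma syn_site_idn:
  assumes X: "X \<in> Ob C"
  shows "idn C X = mk_arr Sg T X (\<lambda>(M :: ('s, 'f, 'p, 'u) interp) xs ys.
      xs \<in> ext M X \<and> ys = take (length (fst X)) (drop 0 xs)) X"
proof -
  have "idn C X = mk_arr Sg T X (\<lambda>(M :: ('s, 'f, 'p, 'u) interp) xs ys. xs = ys \<and> xs \<in> ext M X) X"
    by (simp add: C_def syn_site_def Let_def mk_arr_def)
  also have "\<dots> = mk_arr Sg T X (\<lambda>(M :: ('s, 'f, 'p, 'u) interp) xs ys.
      xs \<in> ext M X \<and> ys = take (length (fst X)) (drop 0 xs)) X"
    by (rule mk_arr_cong) (auto dest: tuples_length)
  finally show ?thesis .
qed

lemma functional_rel_idn:
  assumes X: "X \<in> Ob C"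
  shows "functional_rel Sg T X X (\<lambda>(M :: ('s, 'f, 'p, 'u) interp) xs ys.
      xs \<in> ext M X \<and> ys = take (length (fst X)) (drop 0 xs))"
proof (rule functional_rel_slice[OF X])
  fix M :: "('s, 'f, 'p, 'u) interp" and xs assume xs: "xs \<in> ext M X"
  then show "take (length (fst X)) (drop 0 xs) \<in> ext M X"
    using tuples_length[OF ext_tuples[OF xs]] by simp
qed simp_all

lemma arr_rel_idn:
  fixes M :: "('s, 'f, 'p, 'u) interp"
  assumes X: "X \<in> Ob C" and M: "M \<in> models Sg T" and xs: "xs \<in> ext M X"
  shows "arr_rel (idn C X) M xs xs"
  unfolding syn_site_idn[OF X]
  using arr_rel_mk_arr[OF functional_rel_idn[OF X, unfolded functional_rel_def, THEN conjunct1] M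
      ext_tuples[OF xs] ext_tuples[OF xs]] xs tuples_length[OF ext_tuples[OF xs]] by simp

lemma syn_site_Cov:
  "U \<in> Cov C X \<longleftrightarrow> finite U \<and> (\<forall>a \<in> U. a \<in> Ar C \<and> cd C a = X) \<and>
    (\<forall>M \<in> (models Sg T :: ('s, 'f, 'p, 'u) interp set). \<forall>xs \<in> ext M X.
       \<exists>a \<in> U. \<exists>ys \<in> ext M (dm C a). arr_rel a M ys xs)"
  unfolding C_def syn_site_def Let_def by auto

text \<open>\<open>P\<close> is the definable set of tuples \<open>ys @ zs\<close> with a common
  image in \<open>X\<close>, and \<open>v\<close> and \<open>k\<close> are its two slices. The last
  clause, that \<open>v\<close> hits each \<open>ys\<close> that has a partner \<open>zs\<close>, is
  what makes pulled-back families jointly surjective.\<close>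

lemma syn_site_pullback:
  assumes g: "g \<in> arrows C Y X" and f: "f \<in> arrows C Z X"
  obtains P v k where "v \<in> arrows C P Y" "k \<in> arrows C P Z" "cmp C g v = cmp C f k"
    "\<And>(M :: ('s, 'f, 'p, 'u) interp) xs ys zs. M \<in> models Sg T \<Longrightarrow> xs \<in> ext M X \<Longrightarrow> ys \<in> ext M Y \<Longrightarrow> zs \<in> ext M Z \<Longrightarrow>
      arr_rel g M ys xs \<Longrightarrow> arr_rel f M zs xs \<Longrightarrow> \<exists>ps \<in> ext M P. arr_rel v M ps ys"
proof -
  let ?m = "length (fst Y)" and ?n = "length (fst Z)"
  have "definable_rel Sg T (fst Y) (fst Z) (\<lambda>(M :: ('s, 'f, 'p, 'u) interp) ys zs.
      \<exists>xs \<in> tuples M (fst X). arr_rel g M ys xs \<and> arr_rel f M zs xs)"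
    by (rule definable_rel_comp[OF arrows_definable[OF g] definable_rel_swap[OF arrows_definable[OF f]]])
  then obtain \<pi> where \<pi>: "wf_fm Sg (fst Y @ fst Z) \<pi>"
    and sat_\<pi>: "\<And>(M :: ('s, 'f, 'p, 'u) interp) ys zs. M \<in> models Sg T \<Longrightarrow> ys \<in> tuples M (fst Y) \<Longrightarrow>
      zs \<in> tuples M (fst Z) \<Longrightarrow>
      sat M (ys @ zs) \<pi> \<longleftrightarrow> (\<exists>xs \<in> tuples M (fst X). arr_rel g M ys xs \<and> arr_rel f M zs xs)"
    unfolding definable_rel_def by metis
  define P where "P = (fst Y @ fst Z, \<pi>)"
  have P: "P \<in> Ob C" using \<pi> by (simp add: P_def syn_site_simps)
  have P_ext: "\<exists>xs \<in> tuples M (fst X). arr_rel g M (take ?m ps) xs \<and> arr_rel f M (take ?n (drop ?m ps)) xs \<and>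
      take ?m ps \<in> ext M Y \<and> take ?n (drop ?m ps) \<in> ext M Z"
    if M: "M \<in> models Sg T" and ps: "ps \<in> ext M P" for M :: "('s, 'f, 'p, 'u) interp" and ps
  proof -
    have "ps \<in> tuples M (fst Y @ fst Z)" and s: "sat M ps \<pi>" using ps by (simp_all add: ext_def P_def)
    then have t: "take ?m ps \<in> tuples M (fst Y)" "drop ?m ps \<in> tuples M (fst Z)"
      by (simp_all add: tuples_append)
    have d: "take ?n (drop ?m ps) = drop ?m ps" using tuples_length[OF t(2)] by simp
    obtain xs where "xs \<in> tuples M (fst X)" "arr_rel g M (take ?m ps) xs" "arr_rel f M (drop ?m ps) xs"
      using sat_\<pi>[OF M t] s by auto
    then show ?thesis using arr_rel_ext[OF g M] arr_rel_ext[OF f M] t d by auto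
  qed
  let ?v = "\<lambda>(M :: ('s, 'f, 'p, 'u) interp) ps ys. ps \<in> ext M P \<and> ys = take ?m (drop 0 ps)"
  let ?k = "\<lambda>(M :: ('s, 'f, 'p, 'u) interp) ps zs. ps \<in> ext M P \<and> zs = take ?n (drop ?m ps)"
  have fv: "functional_rel Sg T P Y ?v"
    by (rule functional_rel_slice[OF P]) (use P_ext in \<open>auto simp: P_def\<close>)
  have fk: "functional_rel Sg T P Z ?k"
    by (rule functional_rel_slice[OF P]) (use P_ext in \<open>auto simp: P_def\<close>)
  define v where "v = mk_arr Sg T P ?v Y"
  define k where "k = mk_arr Sg T P ?k Z"
  have v: "v \<in> arrows C P Y" and k: "k \<in> arrows C P Z"
    using mk_arr_arrows[OF P _ fv] mk_arr_arrows[OF P _ fk] arrowsD(1)[OF g] arrowsD(1)[OF f]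
    by (simp_all add: v_def k_def)
  have v_rel: "arr_rel v M ps ys \<longleftrightarrow> ps \<in> ext M P \<and> ys = take ?m ps"
    if "M \<in> models Sg T" "ps \<in> tuples M (fst P)" "ys \<in> tuples M (fst Y)" for M :: "('s, 'f, 'p, 'u) interp" and ps ys
    using arr_rel_mk_arr[OF fv[unfolded functional_rel_def, THEN conjunct1] that] by (simp add: v_def)
  have k_rel: "arr_rel k M ps zs \<longleftrightarrow> ps \<in> ext M P \<and> zs = take ?n (drop ?m ps)"
    if "M \<in> models Sg T" "ps \<in> tuples M (fst P)" "zs \<in> tuples M (fst Z)" for M :: "('s, 'f, 'p, 'u) interp" and ps zs
    using arr_rel_mk_arr[OF fk[unfolded functional_rel_def, THEN conjunct1] that] by (simp add: k_def)
  have "cmp C g v = cmp C f k"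
    unfolding syn_site_cmp[OF v g] syn_site_cmp[OF k f]
  proof (rule mk_arr_cong)
    fix M :: "('s, 'f, 'p, 'u) interp" and ps xs
    assume M: "M \<in> models Sg T" and ps: "ps \<in> tuples M (fst P)" and xs: "xs \<in> tuples M (fst X)"
    show "(\<exists>ys \<in> tuples M (fst Y). arr_rel v M ps ys \<and> arr_rel g M ys xs) \<longleftrightarrow>
        (\<exists>zs \<in> tuples M (fst Z). arr_rel k M ps zs \<and> arr_rel f M zs xs)"
    \<comment> \<open>Over an element of \<open>P\<close> both composites reach the common image
      \<open>xs'\<close> and, by functionality, nothing else. Outside \<open>P\<close> neither
      composite relates anything.\<close>
    proof (cases "ps \<in> ext M P")
      case True
      obtain xs' where xs': "xs' \<in> tuples M (fst X)" "arr_rel g M (take ?m ps) xs'"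
        "arr_rel f M (take ?n (drop ?m ps)) xs'"
        "take ?m ps \<in> tuples M (fst Y)" "take ?n (drop ?m ps) \<in> tuples M (fst Z)"
        using P_ext[OF M True] ext_tuples by blast
      have "(\<exists>ys \<in> tuples M (fst Y). arr_rel v M ps ys \<and> arr_rel g M ys xs) \<longleftrightarrow> arr_rel g M (take ?m ps) xs"
        using v_rel[OF M ps] True xs'(4) by blast
      also have "\<dots> \<longleftrightarrow> xs = xs'"
        using arr_rel_unique[OF g M xs'(4) xs xs'(1)] xs'(2) by blast
      also have "\<dots> \<longleftrightarrow> arr_rel f M (take ?n (drop ?m ps)) xs"
        using arr_rel_unique[OF f M xs'(5) xs xs'(1)] xs'(3) by blast
      also have "\<dots> \<longleftrightarrow> (\<exists>zs \<in> tuples M (fst Z). arr_rel k M ps zs \<and> arr_rel f M zs xs)"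
        using k_rel[OF M ps] True xs'(5) by blast
      finally show ?thesis .
    next
      case False
      then show ?thesis using v_rel[OF M ps] k_rel[OF M ps] by blast
    qed
  qed
  moreover have "\<exists>ps \<in> ext M P. arr_rel v M ps ys"
    if M: "M \<in> models Sg T" and xs: "xs \<in> ext M X" and ys: "ys \<in> ext M Y" and zs: "zs \<in> ext M Z"
      and r: "arr_rel g M ys xs" "arr_rel f M zs xs" for M :: "('s, 'f, 'p, 'u) interp" and xs ys zs
  proof -
    note t = tuples_appendI[OF ext_tuples[OF ys] ext_tuples[OF zs]]
    have "sat M (ys @ zs) \<pi>"
      using sat_\<pi>[OF M ext_tuples[OF ys] ext_tuples[OF zs]] r ext_tuples[OF xs] by blast
    then have p: "ys @ zs \<in> ext M P" using t by (simp add: ext_def P_def)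
    moreover have "arr_rel v M (ys @ zs) ys"
      using v_rel[OF M ext_tuples[OF p] ext_tuples[OF ys]] p tuples_length[OF ext_tuples[OF ys]] by simp
    ultimately show ?thesis by blast
  qed
  ultimately show thesis using that[OF v k] by blast
qed

text \<open>For stability, each member of the cover is pulled back separately, and the new family is
  finite as an image of a finite set. For transitivity, a finite union of finite families is finite,
  and elements lift through the two stages one after the other.\<close>

lemma coverage_syn_site: "coverage C"
proof
  show "dm C f \<in> Ob C" "cd C f \<in> Ob C" if "f \<in> Ar C" for f
    using arrowsD(1,2)[of f "dm C f" "cd C f"] that by (simp_all add: arrows_def)
  show idn: "idn C X \<in> arrows C X X" if "X \<in> Ob C" for X
    unfolding syn_site_idn[OF that] by (rule mk_arr_arrows[OF that that functional_rel_idn[OF that]])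
  show cmp: "cmp C g f \<in> arrows C X Z" if "f \<in> arrows C X Y" "g \<in> arrows C Y Z" for f g X Y Z
    unfolding syn_site_cmp[OF that]
    by (rule mk_arr_arrows[OF arrowsD(1)[OF that(1)] arrowsD(2)[OF that(2)] functional_rel_cmp[OF that]])
  show Cov_arrow: "f \<in> Ar C \<and> cd C f = X" if "X \<in> Ob C" "U \<in> Cov C X" "f \<in> U" for f X U
    using that(2,3) unfolding syn_site_Cov by blast
  show "{idn C X} \<in> Cov C X" if X: "X \<in> Ob C" for X
    unfolding syn_site_Cov using idn[OF X] arr_rel_idn[OF X] by (auto simp: arrows_def)
  show "\<exists>V \<in> Cov C Y. \<forall>v \<in> V. \<exists>f \<in> U. \<exists>k \<in> arrows C (dm C v) (dm C f). cmp C g v = cmp C f k"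
    if U: "U \<in> Cov C X" and g: "g \<in> arrows C Y X" for U X Y g
  proof -
    have U_arr: "f \<in> arrows C (dm C f) X" if "f \<in> U" for f
      using U that unfolding syn_site_Cov by (simp add: arrows_def)
    have "\<forall>f \<in> U. \<exists>v. v \<in> arrows C (dm C v) Y \<and> (\<exists>k \<in> arrows C (dm C v) (dm C f). cmp C g v = cmp C f k) \<and>
      (\<forall>M \<in> (models Sg T :: ('s, 'f, 'p, 'u) interp set). \<forall>xs \<in> ext M X. \<forall>ys \<in> ext M Y. \<forall>zs \<in> ext M (dm C f).
        arr_rel g M ys xs \<longrightarrow> arr_rel f M zs xs \<longrightarrow> (\<exists>ps \<in> ext M (dm C v). arr_rel v M ps ys))"
    proof
      fix f assume "f \<in> U"
      from syn_site_pullback[OF g U_arr[OF this]] obtain P v k where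
        "v \<in> arrows C P Y" "k \<in> arrows C P (dm C f)" "cmp C g v = cmp C f k"
        "\<And>(M :: ('s, 'f, 'p, 'u) interp) xs ys zs. M \<in> models Sg T \<Longrightarrow> xs \<in> ext M X \<Longrightarrow> ys \<in> ext M Y \<Longrightarrow>
          zs \<in> ext M (dm C f) \<Longrightarrow> arr_rel g M ys xs \<Longrightarrow> arr_rel f M zs xs \<Longrightarrow> \<exists>ps \<in> ext M P. arr_rel v M ps ys"
        by metis
      moreover from this(1) have "dm C v = P" by (simp add: arrows_def)
      ultimately show "\<exists>v. v \<in> arrows C (dm C v) Y \<and> (\<exists>k \<in> arrows C (dm C v) (dm C f). cmp C g v = cmp C f k) \<and>
        (\<forall>M \<in> (models Sg T :: ('s, 'f, 'p, 'u) interp set). \<forall>xs \<in> ext M X. \<forall>ys \<in> ext M Y. \<forall>zs \<in> ext M (dm C f).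
          arr_rel g M ys xs \<longrightarrow> arr_rel f M zs xs \<longrightarrow> (\<exists>ps \<in> ext M (dm C v). arr_rel v M ps ys))"
        by (intro exI[of _ v]) blast
    qed
    then obtain v where v: "\<And>f. f \<in> U \<Longrightarrow> v f \<in> arrows C (dm C (v f)) Y"
      and k: "\<And>f. f \<in> U \<Longrightarrow> \<exists>k \<in> arrows C (dm C (v f)) (dm C f). cmp C g (v f) = cmp C f k"
      and cov: "\<And>f (M :: ('s, 'f, 'p, 'u) interp) xs ys zs. f \<in> U \<Longrightarrow> M \<in> models Sg T \<Longrightarrow> xs \<in> ext M X \<Longrightarrow>
        ys \<in> ext M Y \<Longrightarrow> zs \<in> ext M (dm C f) \<Longrightarrow> arr_rel g M ys xs \<Longrightarrow> arr_rel f M zs xs \<Longrightarrow>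
        \<exists>ps \<in> ext M (dm C (v f)). arr_rel (v f) M ps ys"
      by metis
    have "v ` U \<in> Cov C Y"
      unfolding syn_site_Cov
    proof (intro conjI ballI)
      show "finite (v ` U)" using U unfolding syn_site_Cov by blast
      show "a \<in> Ar C" "cd C a = Y" if "a \<in> v ` U" for a using that v by (auto simp: arrows_def)
      fix M :: "('s, 'f, 'p, 'u) interp" and ys assume M: "M \<in> models Sg T" and ys: "ys \<in> ext M Y"
      \<comment> \<open>Joint surjectivity: the image \<open>xs\<close> of \<open>ys\<close> under
        \<open>g\<close> is hit by some \<open>zs\<close> along a member \<open>f\<close> of
        \<open>U\<close>, so \<open>ys\<close> is hit from the pullback of \<open>f\<close>.\<close>
      obtain xs where xs: "xs \<in> ext M X" "arr_rel g M ys xs" using arr_rel_total[OF g M ys] by blast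
      then obtain f zs where "f \<in> U" "zs \<in> ext M (dm C f)" "arr_rel f M zs xs"
        using U M unfolding syn_site_Cov by blast
      then show "\<exists>a \<in> v ` U. \<exists>ps \<in> ext M (dm C a). arr_rel a M ps ys"
        using cov[OF _ M xs(1) ys _ xs(2)] by blast
    qed
    moreover have "\<forall>a \<in> v ` U. \<exists>f \<in> U. \<exists>k \<in> arrows C (dm C a) (dm C f). cmp C g a = cmp C f k"
      using k by blast
    ultimately show ?thesis by (rule bexI[rotated])
  qed
  show "{cmp C f g | f g. f \<in> U \<and> g \<in> V f} \<in> Cov C X"
    if X: "X \<in> Ob C" and U: "U \<in> Cov C X" and V: "\<And>f. f \<in> U \<Longrightarrow> V f \<in> Cov C (dm C f)" for X U V
  proof -
    have f_arr: "f \<in> arrows C (dm C f) X" if "f \<in> U" for f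
      using U that unfolding syn_site_Cov by (simp add: arrows_def)
    have g_arr: "g \<in> arrows C (dm C g) (dm C f)" if "f \<in> U" "g \<in> V f" for f g
      using V[OF that(1)] that(2) unfolding syn_site_Cov by (simp add: arrows_def)
    note fg_arr = cmp[OF g_arr f_arr]
    show ?thesis
      unfolding syn_site_Cov
    proof (intro conjI ballI)
      have "{cmp C f g | f g. f \<in> U \<and> g \<in> V f} = (\<Union>f \<in> U. cmp C f ` V f)" by blast
      then show "finite {cmp C f g | f g. f \<in> U \<and> g \<in> V f}"
        using U V unfolding syn_site_Cov by simp
      show "a \<in> Ar C" "cd C a = X" if "a \<in> {cmp C f g | f g. f \<in> U \<and> g \<in> V f}" for a
        using that fg_arr by (auto simp: arrows_def)
      fix M :: "('s, 'f, 'p, 'u) interp" and xs assume M: "M \<in> models Sg T" and xs: "xs \<in> ext M X"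
      obtain f ys where f: "f \<in> U" "ys \<in> ext M (dm C f)" "arr_rel f M ys xs"
        using U M xs unfolding syn_site_Cov by blast
      obtain g zs where g: "g \<in> V f" "zs \<in> ext M (dm C g)" "arr_rel g M zs ys"
        using V[OF f(1)] M f(2) unfolding syn_site_Cov by blast
      have "arr_rel (cmp C f g) M zs xs"
        using arr_rel_cmp[OF g_arr[OF f(1) g(1)] f_arr[OF f(1)] M ext_tuples[OF g(2)] ext_tuples[OF xs]]
          f(3) g(3) ext_tuples[OF f(2)] by blast
      moreover have "dm C (cmp C f g) = dm C g"
        using fg_arr[OF f(1) g(1) f(1)] by (simp add: arrows_def)
      ultimately show "\<exists>a \<in> {cmp C f g | f g. f \<in> U \<and> g \<in> V f}. \<exists>ys \<in> ext M (dm C a). arr_rel a M ys xs"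
        using f(1) g(1,2) by (intro bexI[of _ "cmp C f g"] bexI[of _ zs] CollectI exI[of _ f] exI[of _ g]) simp_all
    qed
  qed
qed

end

theorem mainTheorem12:
  fixes Sg :: "('s, 'f, 'p) signature"
    and T :: "('s, 'f, 'p) sequent set"
    and K :: "(('s, 'f, 'p) obj, ('s, 'f, 'p) arr, 'u) psh set"
    and \<Sigma> :: "(('s, 'f, 'p) obj, ('s, 'f, 'p) arr, 'u) psh"
    and W :: "(('s, 'f, 'p) obj, ('s, 'f, 'p) arr, 'u) monoid_obj"
    and \<iota> :: "('s, 'f, 'p) obj \<Rightarrow> 'u \<Rightarrow> 'u"
  assumes "\<exists>code :: ('s, 'f, 'p) fm \<Rightarrow> 'u. inj code"
    and "positive_existential_theory Sg T"
    and "has_disjoint_coproducts Sg T TYPE('u)"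
    and "eliminates_imaginaries Sg T TYPE('u)"
    and "K \<subseteq> classifying_topos Sg T"
    and "closed_under_products (syn_site Sg T TYPE('u)) K"
    and "\<Sigma> \<in> classifying_topos Sg T"
    and "is_free_monoid (syn_site Sg T TYPE('u)) \<Sigma> W \<iota>"
  shows "{L. \<exists>N. is_nda (syn_site Sg T TYPE('u)) \<Sigma> N \<and> states N \<in> K \<and>
               recognized_by_nda (syn_site Sg T TYPE('u)) \<Sigma> W \<iota> N L} =
         {L. \<exists>P. is_promonoid (syn_site Sg T TYPE('u)) P \<and> pcarrier P \<in> K \<and>
               recognized_by_promonoid (syn_site Sg T TYPE('u)) W P L}"
proof -
  let ?C = "syn_site Sg T TYPE('u)"
  interpret coverage ?C by (rule coverage_syn_site[OF refl])
  have W: "is_monoid_obj ?C W" and \<iota>: "\<iota> \<in> sheaf_mor ?C \<Sigma> (mcarrier W)"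
    using assms(8) by (simp_all add: is_free_monoid_def)
  have \<Sigma>: "presheaf ?C \<Sigma>"
    using assms(7) by (simp add: classifying_topos_def sheaf_presheaf)
  show ?thesis
  proof (rule set_eqI, unfold mem_Collect_eq, rule iffI)
    fix L
    assume "\<exists>N. is_nda ?C \<Sigma> N \<and> states N \<in> K \<and> recognized_by_nda ?C \<Sigma> W \<iota> N L"
    then obtain N where N: "is_nda ?C \<Sigma> N" "states N \<in> K" "recognized_by_nda ?C \<Sigma> W \<iota> N L" by blast
    \<comment> \<open>Closure under products enters here: it supplies an object of \<open>K\<close>
      isomorphic to the square of the object of states.\<close>
    obtain P where P: "P \<in> K" "sheaf_iso ?C P (prod_sheaf (states N) (states N))"
      using assms(6) N(2) unfolding closed_under_products_def by blast
    have "sheaf ?C P" using P(1) assms(5) by (auto simp: classifying_topos_def)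
    from recognized_by_nda_imp_promonoid[OF W N(1) this P(2) N(3)]
    show "\<exists>P. is_promonoid ?C P \<and> pcarrier P \<in> K \<and> recognized_by_promonoid ?C W P L"
      using P(1) by blast
  next
    fix L
    assume "\<exists>P. is_promonoid ?C P \<and> pcarrier P \<in> K \<and> recognized_by_promonoid ?C W P L"
    then obtain P where P: "is_promonoid ?C P" "pcarrier P \<in> K" "recognized_by_promonoid ?C W P L" by blast
    \<comment> \<open>The automaton has the carrier of \<open>P\<close> itself as its object of
      states, so membership in \<open>K\<close> carries over unchanged.\<close>
    from recognized_by_promonoid_imp_nda[OF W \<Sigma> sheaf_mor_natural[OF \<Sigma> \<iota>] P(1,3)]
    show "\<exists>N. is_nda ?C \<Sigma> N \<and> states N \<in> K \<and> recognized_by_nda ?C \<Sigma> W \<iota> N L"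
      using P(2) by metis
  qed
qed

end
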